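(* Let $d\geq 1$ and let $P$ be a Borel probability measure on $\mathbb{R}^d$. Assume that $P$ admits a density $f_P\in\mathcal{S}(\mathbb{R}^d)$ (the Schwartz class) with respect to the Lebesgue measure. Then $F_P^{\mathrm g}\in\mathcal{C}^\infty(\mathbb{R}^d)$ and $$f_P(x)=(\mathcal{L}_d F_P^{\mathrm g})(x)\quad\text{for all } x\in\mathbb{R}^d .$$
   Context: Geometric cdf: for a Borel probability measure $P$ on $\mathbb{R}^d$ and $Z$ a random vector with law $P$, $F_P^{\mathrm g}:\mathbb{R}^d\to\mathbb{R}^d$ is $F_P^{\mathrm g}(x)=\mathbb{E}\big[\frac{x-Z}{\|x-Z\|}\mathbb{I}[Z\neq x]\big]$; it is bounded by $1$ in norm. Fourier transform: $(\mathcal{F}u)(\xi)=\int_{\mathbb{R}^d}u(x)e^{-2i\pi\langle x,\xi\rangle}dx$. For $s>0$ and $\psi\in\mathcal{S}(\mathbb{R}^d)$ (complex-valued Schwartz class), $(-\Delta)^s\psi:=(2\pi)^{2s}\mathcal{F}^{-1}(\|\xi\|^{2s}(\mathcal{F}\psi)(\xi))$. Let $\mathcal{S}_{1/2}(\mathbb{R}^d)$ be the space of $\psi\in\mathcal{C}^\infty(\mathbb{R}^d)$ with $\sup_x|(1+\|x\|^{d+1})\partial^\alpha\psi(x)|<\infty$ for all $\alpha\in\mathbb{N}^d$, with the topology given by these seminorms, and $\mathcal{S}_{1/2}(\mathbb{R}^d)'$ the space of continuous linear maps $\mathcal{S}_{1/2}(\mathbb{R}^d)\to\mathbb{C}$.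 This space contains $L^\infty(\mathbb{R}^d)$ and is closed under distributional differentiation, and $(-\Delta)^{1/2}$ maps $\mathcal{S}(\mathbb{R}^d)$ continuously into $\mathcal{S}_{1/2}(\mathbb{R}^d)$. For $T\in\mathcal{S}_{1/2}(\mathbb{R}^d)'$, $(-\Delta)^{1/2}T$ is the tempered distribution $\psi\mapsto\langle T,(-\Delta)^{1/2}\psi\rangle$, $\psi\in\mathcal{S}(\mathbb{R}^d)$. For $T$ a bounded measurable vector field on $\mathbb{R}^d$ (derivatives in the sense of distributions, $\nabla\cdot$ the divergence), the tempered distribution $\mathcal{L}_dT$ is $$\mathcal{L}_dT:=\gamma_d\,(-\Delta)^{\frac{d-1}{2}}(\nabla\cdot T),\qquad \gamma_d^{-1}=2^d\pi^{\frac{d-1}{2}}\Gamma\big(\tfrac{d+1}{2}\big),$$ where, for $d$ odd, $(-\Delta)^{(d-1)/2}$ is $-\Delta$ iterated $(d-1)/2$ times, and, for $d$ even, $(-\Delta)^{(d-1)/2}:=(-\Delta)^{1/2}(-\Delta)^{(d-2)/2}$ with $(-\Delta)^{(d-2)/2}$ being $-\Delta$ iterated $(d-2)/2$ times. The pointwise equality means that the distribution $\mathcal{L}_dF_P^{\mathrm g}$ is (represented by) a continuous function which equals $f_P$ at every point. *)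

theory Defs
  imports "HOL-Analysis.Analysis" "HOL-Probability.Probability"
begin

section \<open>Smooth functions and test function spaces\<close>

definition partial_deriv :: "'n::finite \<Rightarrow> (real^'n \<Rightarrow> 'b::real_normed_vector) \<Rightarrow> real^'n \<Rightarrow> 'b" where
  "partial_deriv i f x = vector_derivative (\<lambda>t. f (x + t *\<^sub>R axis i 1)) (at 0)"

text \<open>Partial derivatives of all orders are indexed by words of coordinates rather than by
  multi-indices, so that no order of differentiation has to be singled out: the word
  \<open>[i\<^sub>1, \<dots>, i\<^sub>k]\<close> stands for \<open>\<partial>\<^sub>i\<^sub>1 \<dots> \<partial>\<^sub>i\<^sub>k\<close>.  For smooth functions mixed partial derivatives
  commute, so words and multi-indices give the same family of derivatives.\<close>

definition partial_derivs :: "'n::finite list \<Rightarrow> (real^'n \<Rightarrow> 'b::real_normed_vector) \<Rightarrow> real^'n \<Rightarrow> 'b" where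
  "partial_derivs is f = foldr partial_deriv is f"

definition smooth :: "(real^'n::finite \<Rightarrow> 'b::real_normed_vector) \<Rightarrow> bool" where
  "smooth f \<longleftrightarrow> (\<forall>is. continuous_on UNIV (partial_derivs is f) \<and>
     (\<forall>i x. (\<lambda>t. partial_derivs is f (x + t *\<^sub>R axis i 1)) differentiable (at 0)))"

definition schwartz :: "(real^'n::finite \<Rightarrow> complex) set" where
  "schwartz = {\<psi>. smooth \<psi> \<and>
     (\<forall>(\<beta> :: 'n \<Rightarrow> nat) is. bounded (range (\<lambda>x. complex_of_real (\<Prod>j\<in>UNIV. (x $ j) ^ \<beta> j) * partial_derivs is \<psi> x)))}"

definition s_half :: "(real^'n::finite \<Rightarrow> complex) set" where
  "s_half = {\<psi>. smooth \<psi> \<and>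
     (\<forall>is. bounded (range (\<lambda>x. (1 + norm x ^ (CARD('n) + 1)) *\<^sub>R partial_derivs is \<psi> x)))}"

definition s_half_seminorm :: "'n::finite list \<Rightarrow> (real^'n \<Rightarrow> complex) \<Rightarrow> real" where
  "s_half_seminorm is \<psi> = (SUP x. norm ((1 + norm x ^ (CARD('n) + 1)) *\<^sub>R partial_derivs is \<psi> x))"

definition s_half_topology :: "(real^'n::finite \<Rightarrow> complex) topology" where
  "s_half_topology = topology_generated_by
     {{\<psi> \<in> s_half. s_half_seminorm is (\<lambda>x. \<psi> x - \<phi> x) < \<epsilon>} | is \<phi> \<epsilon>. \<phi> \<in> s_half \<and> \<epsilon> > 0}"

section \<open>Distributions\<close>

text \<open>A distribution is a functional on all functions \<open>real^'n \<Rightarrow> complex\<close>, of which only the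
  values on the relevant test function space are meaningful.\<close>

type_synonym 'n functional = "(real^'n \<Rightarrow> complex) \<Rightarrow> complex"

definition s_half_dual :: "'n::finite functional set" where
  "s_half_dual = {T.
     (\<forall>\<phi>\<in>s_half. \<forall>\<psi>\<in>s_half. T (\<lambda>x. \<phi> x + \<psi> x) = T \<phi> + T \<psi>) \<and>
     (\<forall>c. \<forall>\<psi>\<in>s_half. T (\<lambda>x. c * \<psi> x) = c * T \<psi>) \<and>
     continuous_map s_half_topology euclidean T}"

definition function_dist :: "(real^'n::finite \<Rightarrow> complex) \<Rightarrow> 'n functional" where
  "function_dist u = (\<lambda>\<psi>. \<integral>x. u x * \<psi> x \<partial>lborel)"

definition dist_deriv :: "'n::finite \<Rightarrow> 'n functional \<Rightarrow> 'n functional" where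
  "dist_deriv i T = (\<lambda>\<psi>. - T (partial_deriv i \<psi>))"

definition dist_neg_laplacian :: "'n::finite functional \<Rightarrow> 'n functional" where
  "dist_neg_laplacian T = (\<lambda>\<psi>. - (\<Sum>i\<in>UNIV. dist_deriv i (dist_deriv i T) \<psi>))"

definition dist_divergence :: "(real^'n::finite \<Rightarrow> real^'n) \<Rightarrow> 'n functional" where
  "dist_divergence T = (\<lambda>\<psi>. \<Sum>i\<in>UNIV. dist_deriv i (function_dist (\<lambda>x. complex_of_real (T x $ i))) \<psi>)"

section \<open>Fractional Laplacian\<close>

definition fourier :: "(real^'n::finite \<Rightarrow> complex) \<Rightarrow> real^'n \<Rightarrow> complex" where
  "fourier u \<xi> = (\<integral>x. u x * exp (- 2 * \<i> * complex_of_real (pi * (x \<bullet> \<xi>))) \<partial>lborel)"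

definition inverse_fourier :: "(real^'n::finite \<Rightarrow> complex) \<Rightarrow> real^'n \<Rightarrow> complex" where
  "inverse_fourier u x = (\<integral>\<xi>. u \<xi> * exp (2 * \<i> * complex_of_real (pi * (x \<bullet> \<xi>))) \<partial>lborel)"

definition frac_laplacian :: "real \<Rightarrow> (real^'n::finite \<Rightarrow> complex) \<Rightarrow> real^'n \<Rightarrow> complex" where
  "frac_laplacian s \<psi> x = complex_of_real ((2 * pi) powr (2 * s)) *
     inverse_fourier (\<lambda>\<xi>. complex_of_real (norm \<xi> powr (2 * s)) * fourier \<psi> \<xi>) x"

text \<open>The operator is available on \<^term>\<open>s_half_dual\<close> only, hence the guard.\<close>

definition dist_sqrt_laplacian :: "'n::finite functional \<Rightarrow> 'n functional" where
  "dist_sqrt_laplacian T =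
     (if T \<in> s_half_dual then (\<lambda>\<psi>. T (frac_laplacian (1/2) \<psi>)) else undefined)"

section \<open>The operator and the geometric cdf\<close>

definition gamma_const :: "nat \<Rightarrow> real" where
  "gamma_const d = inverse (2 ^ d * pi powr ((real d - 1) / 2) * Gamma ((real d + 1) / 2))"

definition dist_neg_laplacian_power :: "'n::finite functional \<Rightarrow> 'n functional" where
  \<comment> \<open>the power \<open>(-\<Delta>)\<close> to the \<open>(d - 1) / 2\<close>, where \<open>d = CARD('n)\<close>\<close>
  "dist_neg_laplacian_power T =
     (if odd CARD('n) then (dist_neg_laplacian ^^ ((CARD('n) - 1) div 2)) T
      else dist_sqrt_laplacian ((dist_neg_laplacian ^^ ((CARD('n) - 2) div 2)) T))"

definition L_op :: "(real^'n::finite \<Rightarrow> real^'n) \<Rightarrow> 'n functional" where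
  "L_op T = (\<lambda>\<psi>. complex_of_real (gamma_const CARD('n)) *
     dist_neg_laplacian_power (dist_divergence T) \<psi>)"

definition represented_by :: "'n::finite functional \<Rightarrow> (real^'n \<Rightarrow> complex) \<Rightarrow> bool" where
  "represented_by T g \<longleftrightarrow>
     (\<forall>\<psi>\<in>schwartz. integrable lborel (\<lambda>x. g x * \<psi> x) \<and> T \<psi> = function_dist g \<psi>)"

definition geometric_cdf :: "(real^'n::finite) measure \<Rightarrow> real^'n \<Rightarrow> real^'n" where
  "geometric_cdf P x =
     (\<integral>z. indicator {z. z \<noteq> x} z *\<^sub>R ((x - z) /\<^sub>R norm (x - z)) \<partial>P)"

end

theory Submission
  imports Defs
begin

text \<open>
  The geometric cdf of \<open>P\<close> is the convolution of the density \<open>f\<close> with the bounded kernel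
  \<open>sgn x = x / norm x\<close>.  It is smooth because every derivative can be moved onto the rapidly decreasing
  \<open>f\<close> (\<open>smooth_convol_schwartz\<close>).  The identity \<open>L F = f\<close> is a computation with Fourier symbols: the
  divergence of \<open>sgn\<close> has the Fourier transform \<open>(2 \<pi> norm \<xi>) ^ (1 - d) / \<gamma>\<close>, with \<open>\<gamma>\<close> the normalising
  constant of the operator, and the power \<open>(d - 1) / 2\<close> of the Laplacian has the reciprocal symbol up to \<open>\<gamma>\<close>.

  The transform of \<open>sgn\<close> exists only as a distribution.  The representation
  \<open>1 / r = \<integral> t powr (- 1 / 2) * exp (- t * r\<^sup>2) / sqrt \<pi>\<close> over \<open>t > 0\<close> writes \<open>sgn\<close> as a superposition of the
  fields \<open>y * exp (- t * (norm y)\<^sup>2)\<close>, whose transforms are explicit.  Let \<open>\<phi>\<close> be an integrable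
  function which is the inverse Fourier transform of an integrable function.  Fubini and the
  multiplication formula turn the integral of \<open>F\<^sub>j * \<phi>\<close> into an integral over \<open>t\<close> of absolutely
  convergent integrals over the frequency (\<open>sign_mixture_pairing\<close>).  In this form every Laplacian multiplies
  the integrand by \<open>(2 \<pi> norm \<xi>)\<^sup>2\<close> (\<open>laplacian_power_pairing\<close>).  Once all factors are collected, the
  double integral converges absolutely, the integral over \<open>t\<close> is a Gamma integral whose value is
  \<open>1 / \<gamma>\<close> at every frequency except the origin (\<open>integral_riesz_slice\<close>), and what remains is
  Parseval's identity (\<open>laplacian_power_divergence\<close>).

  In odd dimension \<open>\<phi>\<close> is a derivative of the Schwartz test function \<open>\<psi>\<close>.  In even dimension it is a
  derivative of \<open>(-\<Delta>) powr (1 / 2)\<close> applied to \<open>\<psi>\<close>, in general not a Schwartz function, and the point is that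
  it is integrable.  For this, \<open>sqrt a\<close> is written as \<open>a\<close> times the Laplace transform of an integrable weight
  plus the Laplace transform of a finite signed measure (\<open>sqrt_as_Laplace_transforms\<close>); with \<open>a = (2 \<pi> norm \<xi>)\<^sup>2\<close> these are
  the Fourier transforms of integrable mixtures of heat kernels.  Hence the square root of the Laplacian of \<open>\<psi>\<close> is a
  combination of convolutions of \<open>\<psi>\<close> and its second derivatives with integrable kernels (\<open>frac_laplacian_half_convol\<close>).
\<close>

section \<open>Integration over products and translates\<close>

lemma prod_over_Basis_vec:
  fixes F :: "real^'n::finite \<Rightarrow> 'a::comm_monoid_mult"
  shows "(\<Prod>b\<in>Basis. F b) = (\<Prod>j\<in>UNIV. F (axis j 1))"
proof -
  have B: "(Basis :: (real^'n) set) = range (\<lambda>j. axis j 1)"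
    by (auto simp: Basis_vec_def)
  have "inj (\<lambda>j::'n. axis j (1::real))"
    by (auto simp: inj_def axis_eq_axis)
  then show ?thesis
    unfolding B by (simp add: prod.reindex)
qed

text \<open>Lebesgue measure on \<open>real^'n\<close> is the image of the product measure indexed by the standard basis, so the
  product formulas for product measures carry over.\<close>

lemma coordinatewise_product:
  fixes g :: "'n::finite \<Rightarrow> real \<Rightarrow> 'a::{real_normed_field,banach,second_countable_topology}"
  assumes g: "\<And>j. integrable lborel (g j)"
  shows integrable_prod_vec: "integrable lborel (\<lambda>x::real^'n. \<Prod>j\<in>UNIV. g j (x $ j))"
    and integral_prod_vec:
      "(\<integral>x. (\<Prod>j\<in>UNIV. g j ((x::real^'n) $ j)) \<partial>lborel) = (\<Prod>j\<in>UNIV. \<integral>t. g j t \<partial>lborel)"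
proof -
  define h where "h = inv (\<lambda>j::'n. axis j (1::real))"
  have inj: "inj (\<lambda>j::'n. axis j (1::real))"
    by (auto simp: inj_def axis_eq_axis)
  have h: "h (axis j 1) = j" for j
    unfolding h_def by (rule inv_f_f[OF inj])
  define G where "G b = g (h b)" for b
  interpret product_sigma_finite "\<lambda>_::real^'n. lborel :: real measure" ..
  define T where "T = (\<lambda>f::real^'n \<Rightarrow> real. \<Sum>b\<in>Basis. f b *\<^sub>R b)"
  have T[measurable]: "T \<in> measurable (\<Pi>\<^sub>M b\<in>Basis. lborel) borel"
    unfolding T_def by measurable
  have gm[measurable]: "g j \<in> borel_measurable borel" for j
    using borel_measurable_integrable[OF g[of j]] by simp
  have gmeas: "(\<lambda>x::real^'n. \<Prod>j\<in>UNIV. g j (x $ j)) \<in> borel_measurable borel"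
    by measurable
  have Tj: "T f $ j = f (axis j 1)" for f j
  proof -
    have "T f $ j = T f \<bullet> axis j 1"
      by (simp add: inner_axis)
    also have "\<dots> = f (axis j 1)"
      unfolding T_def by (intro inner_sum_left_Basis) (auto simp: Basis_vec_def)
    finally show ?thesis .
  qed
  have eq: "(\<Prod>j\<in>UNIV. g j (T f $ j)) = (\<Prod>b\<in>Basis. G b (f b))" for f
    unfolding prod_over_Basis_vec G_def h Tj ..
  have "integrable (\<Pi>\<^sub>M b\<in>Basis. lborel) (\<lambda>f. \<Prod>b\<in>(Basis::(real^'n) set). G b (f b))"
    by (intro product_integrable_prod) (auto simp: G_def g)
  then have "integrable (\<Pi>\<^sub>M b\<in>Basis. lborel) (\<lambda>f. \<Prod>j\<in>UNIV. g j (T f $ j))"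
    by (simp add: eq)
  then have "integrable (distr (\<Pi>\<^sub>M b\<in>Basis. lborel) borel T) (\<lambda>x::real^'n. \<Prod>j\<in>UNIV. g j (x $ j))"
    by (subst integrable_distr_eq[OF T gmeas])
  then show "integrable lborel (\<lambda>x::real^'n. \<Prod>j\<in>UNIV. g j (x $ j))"
    by (simp add: lborel_eq[where 'a="real^'n"] T_def)
  have "(\<integral>x. (\<Prod>j\<in>UNIV. g j ((x::real^'n) $ j)) \<partial>lborel)
      = (\<integral>x. (\<Prod>j\<in>UNIV. g j ((x::real^'n) $ j)) \<partial>(distr (\<Pi>\<^sub>M b\<in>Basis. lborel) borel T))"
    by (simp add: lborel_eq[where 'a="real^'n"] T_def)
  also have "\<dots> = (\<integral>f. (\<Prod>j\<in>UNIV. g j (T f $ j)) \<partial>(\<Pi>\<^sub>M b\<in>Basis. lborel))"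
    by (rule integral_distr[OF T gmeas])
  also have "\<dots> = (\<integral>f. (\<Prod>b\<in>(Basis::(real^'n) set). G b (f b)) \<partial>(\<Pi>\<^sub>M b\<in>Basis. lborel))"
    by (simp add: eq)
  also have "\<dots> = (\<Prod>b\<in>Basis. integral\<^sup>L lborel (G b))"
    by (intro product_integral_prod) (auto simp: G_def g)
  also have "\<dots> = (\<Prod>j\<in>UNIV. \<integral>t. g j t \<partial>lborel)"
    unfolding prod_over_Basis_vec G_def h ..
  finally show "(\<integral>x. (\<Prod>j\<in>UNIV. g j ((x::real^'n) $ j)) \<partial>lborel) = (\<Prod>j\<in>UNIV. \<integral>t. g j t \<partial>lborel)" .
qed

lemma lborel_distr_diff:
  fixes c :: "'a::euclidean_space"
  shows "distr lborel borel (\<lambda>x. c - x) = lborel"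
  by (subst lborel_affine[of "-1" c]) (auto simp: density_1)

text \<open>Measurability is invariant under the substitution in both directions, so the identity also holds for
  functions that are not measurable, both sides being zero.\<close>

lemma integral_lborel_diff:
  fixes f :: "'a::euclidean_space \<Rightarrow> 'b::{banach,second_countable_topology}"
  shows "(\<integral>x. f (c - x) \<partial>lborel) = (\<integral>x. f x \<partial>lborel)"
proof (cases "f \<in> borel_measurable borel")
  case True
  then show ?thesis
    by (subst (2) lborel_distr_diff[of c, symmetric]) (simp add: integral_distr)
next
  case False
  moreover have "(\<lambda>x. f (c - x)) \<notin> borel_measurable borel"
  proof
    assume "(\<lambda>x. f (c - x)) \<in> borel_measurable borel"
    then have "(\<lambda>x. f (c - x)) \<circ> (\<lambda>x. c - x) \<in> borel_measurable borel"
      by (intro measurable_comp) auto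
    then show False using False by (simp add: o_def)
  qed
  ultimately have "\<not> integrable lborel f" "\<not> integrable lborel (\<lambda>x. f (c - x))"
    using borel_measurable_integrable by force+
  then show ?thesis by (simp add: not_integrable_integral_eq)
qed

lemma integrable_lborel_diff:
  fixes f :: "'a::euclidean_space \<Rightarrow> 'b::{banach,second_countable_topology}"
  assumes "integrable lborel f"
  shows "integrable lborel (\<lambda>x. f (c - x))"
proof -
  have "integrable (distr lborel borel (\<lambda>x. c - x)) f"
    using assms by (simp add: lborel_distr_diff)
  then show ?thesis
    using borel_measurable_integrable[OF assms] by (subst (asm) integrable_distr_eq) auto
qed

lemma integral_lborel_plus:
  fixes f :: "'a::euclidean_space \<Rightarrow> 'b::{banach,second_countable_topology}"
  shows "(\<integral>x. f (x + c) \<partial>lborel) = (\<integral>x. f x \<partial>lborel)"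
  using integral_lborel_diff[of f 0] integral_lborel_diff[of "\<lambda>x. f (- x)" "- c"] by (simp add: add.commute)

lemma integrable_lborel_plus:
  fixes f :: "'a::euclidean_space \<Rightarrow> 'b::{banach,second_countable_topology}"
  assumes "integrable lborel f"
  shows "integrable lborel (\<lambda>x. f (x + c))"
  using integrable_lborel_diff[OF integrable_lborel_diff[OF assms, of 0], of "- c"] by (simp add: add.commute)

lemma integral_lborel_pair:
  fixes g :: "'a::euclidean_space \<times> 'b::euclidean_space \<Rightarrow> complex"
  assumes "integrable lborel g"
  shows "(\<integral>w. g w \<partial>lborel) = (\<integral>x. (\<integral>z. g (x, z) \<partial>lborel) \<partial>lborel)"
    and "(\<integral>w. g w \<partial>lborel) = (\<integral>z. (\<integral>x. g (x, z) \<partial>lborel) \<partial>lborel)"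
proof -
  have int: "integrable (lborel \<Otimes>\<^sub>M lborel) (\<lambda>(x, z). g (x, z))"
    using assms by (simp add: lborel_prod)
  from lborel_pair.integral_fst'[OF int]
  show "(\<integral>w. g w \<partial>lborel) = (\<integral>x. (\<integral>z. g (x, z) \<partial>lborel) \<partial>lborel)"
    by (simp add: lborel_prod)
  with lborel_pair.Fubini_integral[OF int]
  show "(\<integral>w. g w \<partial>lborel) = (\<integral>z. (\<integral>x. g (x, z) \<partial>lborel) \<partial>lborel)"
    by simp
qed

lemma measurable_vec_nth [measurable (raw)]:
  "f \<in> borel_measurable M \<Longrightarrow> (\<lambda>x. f x $ j) \<in> borel_measurable M" for f :: "_ \<Rightarrow> real^'n::finite"
  unfolding cart_eq_inner_axis by (intro borel_measurable_inner borel_measurable_const)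

section \<open>A product weight dominating Schwartz functions\<close>

text \<open>A product is chosen rather than a power of \<open>1 + norm x\<close> because its integral factorises and because
  expanding its inverse gives exactly the monomials \<open>\<Prod>j\<in>S. (x $ j)\<^sup>2\<close> that bounds on Schwartz functions provide.\<close>

definition decay_weight :: "real^'n::finite \<Rightarrow> real" where
  "decay_weight x = (\<Prod>j\<in>UNIV. inverse (1 + (x $ j)\<^sup>2))"

lemma decay_weight_pos: "0 < decay_weight x"
  unfolding decay_weight_def by (intro prod_pos) (auto simp: add_pos_nonneg)

lemma decay_weight_nonneg [simp]: "0 \<le> decay_weight x"
  using decay_weight_pos[of x] by simp

lemma abs_decay_weight [simp]: "\<bar>decay_weight x\<bar> = decay_weight x"
  using decay_weight_pos[of x] by simp

lemma decay_weight_le_1: "decay_weight x \<le> 1"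
  unfolding decay_weight_def by (intro prod_le_1) (auto simp: inverse_le_1_iff)

lemma continuous_decay_weight: "continuous_on UNIV (decay_weight :: real^'n::finite \<Rightarrow> real)"
proof -
  have "1 + y\<^sup>2 \<noteq> 0" for y::real
    by (metis add_pos_nonneg less_numeral_extra(1) less_numeral_extra(3) zero_le_power2)
  then show ?thesis unfolding decay_weight_def by (intro continuous_intros) auto
qed

lemma measurable_decay_weight [measurable]:
  "(decay_weight :: real^'n::finite \<Rightarrow> real) \<in> borel_measurable borel"
  using continuous_decay_weight by (rule borel_measurable_continuous_onI)


lemma integrable_cauchy_weight: "integrable lborel (\<lambda>x::real. inverse (1 + x\<^sup>2))"
  using integrable_inverse_1_plus_square by (simp add: set_integrable_def)

lemma integrable_decay_weight: "integrable lborel (decay_weight :: real^'n::finite \<Rightarrow> real)"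
proof -
  have "integrable lborel (\<lambda>x::real^'n. \<Prod>j\<in>UNIV. inverse (1 + (x $ j)\<^sup>2))"
    by (rule integrable_prod_vec[of "\<lambda>_ t. inverse (1 + t\<^sup>2)"])
      (rule integrable_cauchy_weight)
  then show ?thesis unfolding decay_weight_def .
qed

text \<open>Uniformity in small shifts is what makes the weight usable as a dominating function when differentiating or
  passing to limits under an integral.\<close>

lemma decay_weight_shift_le:
  fixes x h :: "real^'n::finite"
  assumes "norm h \<le> 1"
  shows "decay_weight (x + h) \<le> 3 ^ CARD('n) * decay_weight x"
proof -
  have "inverse (1 + ((x + h) $ j)\<^sup>2) \<le> 3 * inverse (1 + (x $ j)\<^sup>2)" for j
  proof -
    have "\<bar>h $ j\<bar> \<le> 1"
      using component_le_norm_cart[of h j] assms by linarith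
    then have "(h $ j)\<^sup>2 \<le> 1" by (simp add: abs_square_le_1)
    moreover have "(x $ j)\<^sup>2 \<le> 2 * (x $ j + h $ j)\<^sup>2 + 2 * (h $ j)\<^sup>2"
      using zero_le_power2[of "x $ j + 2 * h $ j"] by (simp add: power2_eq_square algebra_simps)
    moreover have "1 + a \<le> 3 * (1 + b)" if "c \<le> 1" "a \<le> 2 * b + 2 * c" "0 \<le> b" for a b c :: real
      using that by simp
    ultimately have "1 + (x $ j)\<^sup>2 \<le> 3 * (1 + ((x + h) $ j)\<^sup>2)"
      unfolding vector_add_component by (metis zero_le_power2)
    then show ?thesis
      by (simp add: field_simps add_pos_nonneg)
  qed
  then have "decay_weight (x + h) \<le> (\<Prod>j\<in>(UNIV::'n set). 3 * inverse (1 + (x $ j)\<^sup>2))"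
    unfolding decay_weight_def by (intro prod_mono) (auto simp: add_pos_nonneg)
  also have "\<dots> = 3 ^ CARD('n) * decay_weight x"
    unfolding decay_weight_def by (simp add: prod.distrib)
  finally show ?thesis .
qed

lemma bounded_by_decay_weight:
  fixes g :: "real^'n::finite \<Rightarrow> 'b::real_normed_vector"
  assumes "\<And>S. \<exists>C. \<forall>x. (\<Prod>j\<in>S. (x $ j)\<^sup>2) * norm (g x) \<le> C"
  shows "\<exists>C. \<forall>x. norm (g x) \<le> C * decay_weight x"
proof -
  obtain C where C: "\<And>S x. (\<Prod>j\<in>S. (x $ j)\<^sup>2) * norm (g x) \<le> C S"
    using assms by metis
  have "norm (g x) \<le> (\<Sum>S\<in>Pow UNIV. C S) * decay_weight x" for x
  proof -
    \<comment> \<open>Expanding the inverse of the weight gives one monomial for each set of coordinates.\<close>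
    have "(\<Prod>j\<in>UNIV. (x $ j)\<^sup>2 + 1) * norm (g x)
        = (\<Sum>S\<in>Pow UNIV. (\<Prod>j\<in>S. (x $ j)\<^sup>2) * norm (g x))"
      by (subst prod_add) (simp_all add: sum_distrib_right)
    also have "\<dots> \<le> (\<Sum>S\<in>Pow UNIV. C S)"
      by (intro sum_mono C)
    finally have *: "(\<Prod>j\<in>UNIV. (x $ j)\<^sup>2 + 1) * norm (g x) \<le> (\<Sum>S\<in>Pow UNIV. C S)" .
    have "(\<Prod>j\<in>UNIV. (x $ j)\<^sup>2 + 1) * decay_weight x = 1"
      unfolding decay_weight_def prod.distrib[symmetric]
      by (intro prod.neutral ballI) (simp add: add_pos_nonneg add.commute[of _ 1] pos_add_strict less_imp_neq[symmetric])
    then have "norm (g x) = ((\<Prod>j\<in>UNIV. (x $ j)\<^sup>2 + 1) * norm (g x)) * decay_weight x"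
      by (simp add: algebra_simps)
    also have "\<dots> \<le> (\<Sum>S\<in>Pow UNIV. C S) * decay_weight x"
      using * decay_weight_pos[of x] by (intro mult_right_mono) auto
    finally show ?thesis .
  qed
  then show ?thesis by blast
qed

section \<open>Partial derivatives of all orders\<close>

lemma partial_derivs_Nil [simp]: "partial_derivs [] f = f"
  by (simp add: partial_derivs_def)

lemma partial_derivs_Cons: "partial_derivs (i # w) f = partial_deriv i (partial_derivs w f)"
  by (simp add: partial_derivs_def)

lemma partial_derivs_snoc: "partial_derivs (w @ [i]) f = partial_derivs w (partial_deriv i f)"
  by (simp add: partial_derivs_def)

lemma smooth_partial_deriv: "smooth f \<Longrightarrow> smooth (partial_deriv i f)"
  unfolding smooth_def by (metis partial_derivs_snoc)

lemma smooth_continuous: "smooth f \<Longrightarrow> continuous_on UNIV f"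
  unfolding smooth_def by (metis partial_derivs_Nil)

lemma partial_deriv_eqI:
  assumes "((\<lambda>t. f (x + t *\<^sub>R axis i 1)) has_vector_derivative f') (at 0)"
  shows "partial_deriv i f x = f'"
  unfolding partial_deriv_def by (rule vector_derivative_at[OF assms])

text \<open>A relation is used alongside the operator \<^const>\<open>partial_deriv\<close>, which has a meaningless value where there is
  no derivative: the relation asserts existence as well.\<close>

definition partially_differentiable ::
    "'n::finite \<Rightarrow> (real^'n \<Rightarrow> 'b::real_normed_vector) \<Rightarrow> (real^'n \<Rightarrow> 'b) \<Rightarrow> bool" where
  "partially_differentiable i f f' \<longleftrightarrow>
     (\<forall>x. ((\<lambda>t. f (x + t *\<^sub>R axis i 1)) has_vector_derivative f' x) (at 0))"

lemma partially_differentiable_imp: "partially_differentiable i f f' \<Longrightarrow> partial_deriv i f = f'"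
  unfolding partially_differentiable_def by (intro ext partial_deriv_eqI) auto

lemma smooth_partially_differentiable:
  assumes "smooth f"
  shows "partially_differentiable i f (partial_deriv i f)"
proof -
  have "(\<lambda>t. f (x + t *\<^sub>R axis i 1)) differentiable (at 0)" for x
    using assms unfolding smooth_def by (metis partial_derivs_Nil)
  then show ?thesis
    unfolding partially_differentiable_def partial_deriv_def using vector_derivative_works by blast
qed

lemma partially_differentiable_line:
  assumes "partially_differentiable i f f'"
  shows "((\<lambda>t. f (x + t *\<^sub>R axis i 1)) has_vector_derivative f' (x + s *\<^sub>R axis i 1)) (at s)"
proof -
  have "((\<lambda>t. f ((x + s *\<^sub>R axis i 1) + t *\<^sub>R axis i 1)) has_vector_derivative f' (x + s *\<^sub>R axis i 1)) (at 0)"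
    using assms unfolding partially_differentiable_def by blast
  then have "((\<lambda>t. f ((x + s *\<^sub>R axis i 1) + t *\<^sub>R axis i 1)) \<circ> (\<lambda>t. t - s)
      has_vector_derivative 1 *\<^sub>R f' (x + s *\<^sub>R axis i 1)) (at s)"
    by (intro vector_diff_chain_at) (auto intro!: derivative_eq_intros)
  then show ?thesis by (simp add: algebra_simps o_def)
qed

lemma has_vector_derivative_at_0_iff:
  fixes f :: "real \<Rightarrow> 'b::real_normed_vector"
  shows "(f has_vector_derivative D) (at 0) \<longleftrightarrow> ((\<lambda>t. (f t - f 0) /\<^sub>R t) \<longlongrightarrow> D) (at 0)"
proof -
  have eq: "norm (f t - f 0 - t *\<^sub>R D) / \<bar>t\<bar> = norm ((f t - f 0) /\<^sub>R t - D)" if "t \<noteq> 0" for t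
  proof -
    have "(f t - f 0) /\<^sub>R t - D = (f t - f 0 - t *\<^sub>R D) /\<^sub>R t"
      using that by (simp add: scaleR_diff_right)
    then show ?thesis by (simp add: divide_inverse mult.commute)
  qed
  have "(f has_vector_derivative D) (at 0) \<longleftrightarrow> ((\<lambda>t. norm (f t - f 0 - t *\<^sub>R D) / \<bar>t\<bar>) \<longlongrightarrow> 0) (at 0)"
    unfolding has_vector_derivative_def has_derivative_at
    using bounded_linear_scaleR_left[of D] by simp
  also have "\<dots> \<longleftrightarrow> ((\<lambda>t. norm ((f t - f 0) /\<^sub>R t - D)) \<longlongrightarrow> 0) (at 0)"
    using eq by (intro filterlim_cong) (auto simp: eventually_at_filter)
  also have "\<dots> \<longleftrightarrow> ((\<lambda>t. (f t - f 0) /\<^sub>R t) \<longlongrightarrow> D) (at 0)"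
    by (simp add: tendsto_norm_zero_iff LIM_zero_iff)
  finally show ?thesis .
qed

text \<open>The mean value inequality on the segment from \<open>0\<close> to \<open>t\<close>, for either sign of \<open>t\<close>.\<close>

lemma norm_increment_le:
  fixes f :: "real \<Rightarrow> 'b::real_normed_vector"
  assumes "\<And>s. (f has_vector_derivative f' s) (at s)" and "\<And>s. \<bar>s\<bar> \<le> \<bar>t\<bar> \<Longrightarrow> norm (f' s) \<le> B"
  shows "norm (f t - f 0) \<le> \<bar>t\<bar> * B"
proof -
  have "norm (f t - f 0) \<le> B * norm (t - 0)"
  proof (rule differentiable_bound[of "closed_segment 0 t" f "\<lambda>s h. h *\<^sub>R f' s"])
    fix s assume s: "s \<in> closed_segment 0 t"
    then have "\<bar>s\<bar> \<le> \<bar>t\<bar>" by (auto simp: closed_segment_eq_real_ivl split: if_splits)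
    then show "onorm (\<lambda>h. h *\<^sub>R f' s) \<le> B"
      using assms(2)[of s] order_trans[OF norm_ge_zero[of "f' s"]]
      by (intro onorm_bound) (auto simp: mult.commute[of B] intro!: mult_left_mono)
    show "(f has_derivative (\<lambda>h. h *\<^sub>R f' s)) (at s within closed_segment 0 t)"
      using assms(1)[of s] unfolding has_vector_derivative_def by (rule has_derivative_at_withinI)
  qed auto
  then show ?thesis by (simp add: mult.commute)
qed

lemma smooth_bounded_linear_comp:
  assumes "bounded_linear L" "smooth f"
  shows "smooth (\<lambda>x. L (f x)) \<and> partial_derivs w (\<lambda>x. L (f x)) = (\<lambda>x. L (partial_derivs w f x))"
proof -
  interpret bounded_linear L by fact
  have *: "partially_differentiable i (\<lambda>x. L (g x)) (\<lambda>x. L (g' x))"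
    if "partially_differentiable i g g'" for i g g'
    using that unfolding partially_differentiable_def by (auto intro: has_vector_derivative)
  have sm: "smooth (partial_derivs w f)" for w
    by (induction w) (auto simp: assms(2) partial_derivs_Cons smooth_partial_deriv)
  have eq: "partial_derivs w (\<lambda>x. L (f x)) = (\<lambda>x. L (partial_derivs w f x))" for w
    by (induction w)
      (auto simp: partial_derivs_Cons intro!: partially_differentiable_imp * smooth_partially_differentiable sm)
  have "(\<lambda>t. L (partial_derivs w f (x + t *\<^sub>R axis i 1))) differentiable (at 0)" for w i x
    using *[OF smooth_partially_differentiable[OF sm], of i w]
    unfolding partially_differentiable_def differentiable_def has_vector_derivative_def by blast
  then have "smooth (\<lambda>x. L (f x))"
    unfolding smooth_def eq using smooth_continuous[OF sm] by (auto intro: continuous_on)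
  then show ?thesis using eq by blast
qed

lemma partially_differentiable_add:
  assumes "partially_differentiable i f f'" "partially_differentiable i g g'"
  shows "partially_differentiable i (\<lambda>x. f x + g x) (\<lambda>x. f' x + g' x)"
  using assms unfolding partially_differentiable_def by (auto intro!: derivative_intros)

text \<open>A candidate family \<open>D\<close> of derivatives of all orders is given; the induction over words identifies it with
  the actual one.\<close>

lemma smoothI:
  assumes "\<And>w. continuous_on UNIV (D w)" "\<And>w i. partially_differentiable i (D w) (D (i # w))" "D [] = f"
  shows "smooth f" and "partial_derivs w f = D w"
proof -
  have eq: "partial_derivs w f = D w" for w
    by (induction w) (auto simp: assms partial_derivs_Cons intro!: partially_differentiable_imp)
  have "(\<lambda>t. D w (x + t *\<^sub>R axis i 1)) differentiable (at 0)" for w i x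
    using assms(2)[of i w] unfolding partially_differentiable_def differentiable_def has_vector_derivative_def by blast
  then show "smooth f" unfolding smooth_def eq using assms(1) by blast
  show "partial_derivs w f = D w" by (rule eq)
qed

lemma smooth_partial_derivs: "smooth f \<Longrightarrow> smooth (partial_derivs w f)"
  by (induction w) (auto simp: partial_derivs_Cons smooth_partial_deriv)

lemma smooth_add:
  assumes "smooth f" "smooth g"
  shows "smooth (\<lambda>x. f x + g x)" "partial_derivs w (\<lambda>x. f x + g x) = (\<lambda>x. partial_derivs w f x + partial_derivs w g x)"
proof -
  have D: "partially_differentiable i (\<lambda>x. partial_derivs w f x + partial_derivs w g x)
    (\<lambda>x. partial_derivs (i # w) f x + partial_derivs (i # w) g x)" for w i
    unfolding partial_derivs_Cons
    by (intro partially_differentiable_add smooth_partially_differentiable smooth_partial_derivs assms)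
  have C: "continuous_on UNIV (\<lambda>x. partial_derivs w f x + partial_derivs w g x)" for w
    by (intro continuous_intros smooth_continuous smooth_partial_derivs assms)
  show "smooth (\<lambda>x. f x + g x)" "partial_derivs w (\<lambda>x. f x + g x) = (\<lambda>x. partial_derivs w f x + partial_derivs w g x)"
    by (rule smoothI[of "\<lambda>w x. partial_derivs w f x + partial_derivs w g x", OF C D]; simp)+
qed

lemma smooth_cmult:
  fixes f :: "real^'n::finite \<Rightarrow> complex"
  assumes "smooth f"
  shows "smooth (\<lambda>x. c * f x)" "partial_derivs w (\<lambda>x. c * f x) = (\<lambda>x. c * partial_derivs w f x)"
  using smooth_bounded_linear_comp[OF bounded_linear_mult_right[of c] assms] by blast+

section \<open>Schwartz functions\<close>

lemma schwartz_smooth: "\<psi> \<in> schwartz \<Longrightarrow> smooth \<psi>"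
  by (simp add: schwartz_def)

lemma schwartz_partial_deriv: "\<psi> \<in> schwartz \<Longrightarrow> partial_deriv i \<psi> \<in> schwartz"
  unfolding schwartz_def by (auto simp: smooth_partial_deriv simp flip: partial_derivs_snoc)

lemma schwartz_continuous: "\<psi> \<in> schwartz \<Longrightarrow> continuous_on UNIV \<psi>"
  by (simp add: schwartz_smooth smooth_continuous)

lemma schwartz_partial_derivs: "\<psi> \<in> schwartz \<Longrightarrow> partial_derivs w \<psi> \<in> schwartz"
  by (induction w) (auto simp: partial_derivs_Cons schwartz_partial_deriv)

lemma schwartz_decay:
  fixes \<psi> :: "real^'n::finite \<Rightarrow> complex"
  assumes "\<psi> \<in> schwartz"
  shows "\<exists>C. \<forall>x. norm (\<psi> x) \<le> C * decay_weight x"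
proof (rule bounded_by_decay_weight)
  fix S :: "'n set"
  define \<beta> where "\<beta> j = (if j \<in> S then 2 else 0::nat)" for j
  have "bounded (range (\<lambda>x. complex_of_real (\<Prod>j\<in>UNIV. (x $ j) ^ \<beta> j) * \<psi> x))"
    using assms unfolding schwartz_def by (auto dest!: spec[of _ \<beta>] spec[of _ "[]"])
  then obtain C where C: "norm (complex_of_real (\<Prod>j\<in>UNIV. (x $ j) ^ \<beta> j) * \<psi> x) \<le> C" for x
    unfolding bounded_iff by auto
  have "(\<Prod>j\<in>UNIV. (x $ j) ^ \<beta> j) = (\<Prod>j\<in>S. (x $ j)\<^sup>2)" for x :: "real^'n"
    unfolding \<beta>_def by (rule prod.mono_neutral_cong_right) auto
  then have "(\<Prod>j\<in>S. (x $ j)\<^sup>2) * norm (\<psi> x) \<le> C" for x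
    using C[of x] by (simp add: norm_mult abs_prod prod_nonneg flip: of_real_prod)
  then show "\<exists>C. \<forall>x. (\<Prod>j\<in>S. (x $ j)\<^sup>2) * norm (\<psi> x) \<le> C" by blast
qed

section \<open>Convolution with functions of rapid decay\<close>

text \<open>The product is a parameter so that the vector field \<^const>\<open>sgn\<close> can be convolved with a scalar function and
  complex kernels with complex functions by the same lemmas.\<close>

definition convol :: "('b \<Rightarrow> 'c \<Rightarrow> 'd) \<Rightarrow> (real^'n::finite \<Rightarrow> 'b) \<Rightarrow> (real^'n \<Rightarrow> 'c) \<Rightarrow> real^'n \<Rightarrow>
    'd::{second_countable_topology,banach}" where
  "convol p k h x = (\<integral>y. p (k y) (h (x - y)) \<partial>lborel)"

text \<open>The condition is met by bounded measurable kernels and by integrable ones: the first case serves the field \<^const>\<open>sgn\<close> and the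
  characters of the Fourier transform, the second the kernels of the square root of the Laplacian.\<close>

definition convolvable :: "(real^'n::finite \<Rightarrow> 'b::real_normed_vector) \<Rightarrow> bool" where
  "convolvable k \<longleftrightarrow> k \<in> borel_measurable borel \<and>
     (\<forall>x. integrable lborel (\<lambda>y. norm (k y) * decay_weight (x - y)))"

lemma convolvable_bounded:
  fixes k :: "real^'n::finite \<Rightarrow> 'b::real_normed_vector"
  assumes [measurable]: "k \<in> borel_measurable borel" and "\<And>y. norm (k y) \<le> B"
  shows "convolvable k"
proof -
  have "integrable lborel (\<lambda>y. norm (k y) * decay_weight (x - y))" for x
  proof (rule Bochner_Integration.integrable_bound)
    show "integrable lborel (\<lambda>y. B * decay_weight (x - y))"
      by (intro integrable_mult_right integrable_lborel_diff integrable_decay_weight)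
    show "AE y in lborel. norm (norm (k y) * decay_weight (x - y)) \<le> norm (B * decay_weight (x - y))"
      using assms(2) decay_weight_pos
      by (intro AE_I2) (auto simp: abs_mult abs_of_pos intro!: mult_right_mono intro: order_trans[OF _ abs_ge_self])
  qed simp
  then show ?thesis unfolding convolvable_def by simp
qed

lemma convolvable_integrable:
  fixes k :: "real^'n::finite \<Rightarrow> 'b::{banach,second_countable_topology}"
  assumes k: "integrable lborel k"
  shows "convolvable k"
proof -
  have [measurable]: "k \<in> borel_measurable borel"
    using borel_measurable_integrable[OF k] by simp
  have "integrable lborel (\<lambda>y. norm (k y) * decay_weight (x - y))" for x
  proof (rule Bochner_Integration.integrable_bound)
    show "integrable lborel (\<lambda>y. norm (k y))"
      using k by simp
    show "AE y in lborel. norm (norm (k y) * decay_weight (x - y)) \<le> norm (norm (k y))"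
      using decay_weight_pos decay_weight_le_1
      by (intro AE_I2) (auto simp: abs_mult intro!: mult_left_le)
  qed simp
  then show ?thesis unfolding convolvable_def by simp
qed

lemma measurable_bilinear:
  fixes p :: "'b::{second_countable_topology,real_normed_vector} \<Rightarrow> 'c::{second_countable_topology,real_normed_vector}
      \<Rightarrow> 'd::real_normed_vector"
  assumes "bounded_bilinear p" "f \<in> borel_measurable M" "g \<in> borel_measurable M"
  shows "(\<lambda>x. p (f x) (g x)) \<in> borel_measurable M"
proof (rule borel_measurable_continuous_Pair[OF assms(2,3)])
  interpret bounded_bilinear p by fact
  show "continuous_on UNIV (\<lambda>x. p (fst x) (snd x))"
    by (intro continuous_on continuous_intros)
qed

context
  fixes p :: "'b::{second_countable_topology,real_normed_vector} \<Rightarrow> 'c::{second_countable_topology,real_normed_vector}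
      \<Rightarrow> 'd::{second_countable_topology,banach}"
    and k :: "real^'n::finite \<Rightarrow> 'b"
  assumes p: "bounded_bilinear p" and k: "convolvable k"
begin

lemma measurable_convol:
  assumes "h \<in> borel_measurable borel"
  shows "(\<lambda>y. p (k y) (h (x - y))) \<in> borel_measurable borel"
  using assms k unfolding convolvable_def by (intro measurable_bilinear[OF p]) auto

lemma convol_dominated:
  assumes "\<And>x. norm (h x) \<le> C * decay_weight x"
  obtains K where "\<And>x y. norm (p (k y) (h (x - y))) \<le> K * (norm (k y) * decay_weight (x - y))"
proof -
  interpret bounded_bilinear p by (rule p)
  obtain K where K: "K > 0" "\<And>a b. norm (p a b) \<le> norm a * norm b * K"
    using pos_bounded by blast
  have "norm (p (k y) (h (x - y))) \<le> (K * C) * (norm (k y) * decay_weight (x - y))" for x y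
  proof -
    have "norm (k y) * norm (h (x - y)) * K \<le> norm (k y) * (C * decay_weight (x - y)) * K"
      using K assms by (intro mult_left_mono mult_right_mono) auto
    then show ?thesis using K(2)[of "k y" "h (x - y)"] by (simp add: mult_ac)
  qed
  then show ?thesis using that by blast
qed

lemma integrable_convol:
  assumes h: "h \<in> borel_measurable borel" and C: "\<And>x. norm (h x) \<le> C * decay_weight x"
  shows "integrable lborel (\<lambda>y. p (k y) (h (x - y)))"
proof -
  obtain K where K: "\<And>x y. norm (p (k y) (h (x - y))) \<le> K * (norm (k y) * decay_weight (x - y))"
    using convol_dominated[OF C] by blast
  show ?thesis
  proof (rule Bochner_Integration.integrable_bound)
    show "integrable lborel (\<lambda>y. K * (norm (k y) * decay_weight (x - y)))"
      using k unfolding convolvable_def by auto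
    show "AE y in lborel. norm (p (k y) (h (x - y))) \<le> norm (K * (norm (k y) * decay_weight (x - y)))"
      using K by (intro AE_I2) (metis abs_ge_self order_trans real_norm_def)
  qed (use measurable_convol[OF h] in simp)
qed

lemma continuous_convol:
  assumes h: "continuous_on UNIV h" and C: "\<And>x. norm (h x) \<le> C * decay_weight x"
  shows "continuous_on UNIV (convol p k h)"
proof -
  interpret bounded_bilinear p by (rule p)
  have hm: "h \<in> borel_measurable borel"
    using h by (rule borel_measurable_continuous_onI)
  obtain K where K: "\<And>x y. norm (p (k y) (h (x - y))) \<le> K * (norm (k y) * decay_weight (x - y))"
    using convol_dominated[OF C] by blast
  have "(convol p k h \<longlongrightarrow> convol p k h x) (at x within ball x 1)" for x
    unfolding tendsto_at_iff_sequentially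
  proof (intro allI impI)
    fix X assume X: "\<forall>n. X n \<in> ball x 1 - {x}" "X \<longlonglongrightarrow> x"
    have "(\<lambda>n. \<integral>y. p (k y) (h (X n - y)) \<partial>lborel) \<longlonglongrightarrow> (\<integral>y. p (k y) (h (x - y)) \<partial>lborel)"
    proof (rule integral_dominated_convergence)
      show "integrable lborel (\<lambda>y. \<bar>K\<bar> * 3 ^ CARD('n) * (norm (k y) * decay_weight (x - y)))"
        using k unfolding convolvable_def by auto
      show "AE y in lborel. (\<lambda>n. p (k y) (h (X n - y))) \<longlonglongrightarrow> p (k y) (h (x - y))"
      proof (intro AE_I2 tendsto tendsto_const)
        fix y
        have "isCont h (x - y)" using h by (simp add: continuous_on_eq_continuous_at)
        then show "(\<lambda>n. h (X n - y)) \<longlonglongrightarrow> h (x - y)"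
          by (rule isCont_tendsto_compose) (intro tendsto_intros X)
      qed
      show "AE y in lborel. norm (p (k y) (h (X n - y))) \<le> \<bar>K\<bar> * 3 ^ CARD('n) * (norm (k y) * decay_weight (x - y))" for n
      proof (intro AE_I2)
        fix y
        have "norm (X n - x) \<le> 1"
          using X(1) by (auto simp: dist_norm norm_minus_commute less_imp_le dest!: spec[of _ n])
        then have "decay_weight ((x - y) + (X n - x)) \<le> 3 ^ CARD('n) * decay_weight (x - y)"
          by (rule decay_weight_shift_le)
        then have W: "decay_weight (X n - y) \<le> 3 ^ CARD('n) * decay_weight (x - y)" by simp
        have "norm (p (k y) (h (X n - y))) \<le> \<bar>K\<bar> * (norm (k y) * decay_weight (X n - y))"
          using K[of y "X n"] decay_weight_pos[of "X n - y"]
          by (smt (verit, best) mult_right_mono mult_nonneg_nonneg norm_ge_zero)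
        also have "\<dots> \<le> \<bar>K\<bar> * (norm (k y) * (3 ^ CARD('n) * decay_weight (x - y)))"
          by (intro mult_left_mono W) auto
        finally show "norm (p (k y) (h (X n - y))) \<le> \<bar>K\<bar> * 3 ^ CARD('n) * (norm (k y) * decay_weight (x - y))"
          by (simp add: mult_ac)
      qed
    qed (use measurable_convol[OF hm] in simp_all)
    then show "(convol p k h \<circ> X) \<longlonglongrightarrow> convol p k h x" by (simp add: convol_def o_def)
  qed
  then show ?thesis
    by (simp add: continuous_on_eq_continuous_at isCont_def at_within_open[of _ "ball _ 1"])
qed

text \<open>The difference quotients of \<open>h\<close> are bounded by a multiple of \<^const>\<open>decay_weight\<close>, uniformly for steps of
  length at most one, so the derivative passes under the integral by dominated convergence.\<close>

lemma partially_differentiable_convol: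
  assumes h: "h \<in> borel_measurable borel" and C: "\<And>x. norm (h x) \<le> C * decay_weight x"
    and C': "\<And>x. norm (h' x) \<le> C' * decay_weight x"
    and hd: "partially_differentiable i h h'" and h': "h' \<in> borel_measurable borel"
  shows "partially_differentiable i (convol p k h) (convol p k h')"
  unfolding partially_differentiable_def has_vector_derivative_at_0_iff
proof
  interpret bounded_bilinear p by (rule p)
  fix x
  define e where "e = (axis i 1 :: real^'n)"
  have e: "norm e = 1" by (simp add: e_def norm_axis_1)
  have C'0: "C' \<ge> 0"
    using C'[of 0] decay_weight_pos[of "0::real^'n"] norm_ge_zero[of "h' 0"] by (smt (verit) mult_neg_pos)
  obtain K where K: "K > 0" "\<And>a b. norm (p a b) \<le> norm a * norm b * K"
    using pos_bounded by blast
  have bound: "norm ((h (x + t *\<^sub>R e - y) - h (x - y)) /\<^sub>R t) \<le> C' * 3 ^ CARD('n) * decay_weight (x - y)"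
    if t: "t \<noteq> 0" "\<bar>t\<bar> < 1" for t y
  proof -
    have "norm (h (x - y + t *\<^sub>R e) - h (x - y + 0 *\<^sub>R e)) \<le> \<bar>t\<bar> * (C' * 3 ^ CARD('n) * decay_weight (x - y))"
    proof (rule norm_increment_le[where f = "\<lambda>t. h (x - y + t *\<^sub>R e)" and f' = "\<lambda>t. h' (x - y + t *\<^sub>R e)"])
      show "((\<lambda>t. h (x - y + t *\<^sub>R e)) has_vector_derivative h' (x - y + s *\<^sub>R e)) (at s)" for s
        unfolding e_def by (rule partially_differentiable_line[OF hd])
      fix s :: real assume "\<bar>s\<bar> \<le> \<bar>t\<bar>"
      then have "norm (s *\<^sub>R e) \<le> 1" using t e by simp
      then have "decay_weight (x - y + s *\<^sub>R e) \<le> 3 ^ CARD('n) * decay_weight (x - y)"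
        by (rule decay_weight_shift_le)
      then show "norm (h' (x - y + s *\<^sub>R e)) \<le> C' * 3 ^ CARD('n) * decay_weight (x - y)"
        using C'[of "x - y + s *\<^sub>R e"] C'0 by (smt (verit, best) mult.assoc mult_left_mono)
    qed
    then have "norm (h (x + t *\<^sub>R e - y) - h (x - y)) \<le> \<bar>t\<bar> * (C' * 3 ^ CARD('n) * decay_weight (x - y))"
      by (simp add: algebra_simps)
    then show ?thesis using t by (simp add: pos_divide_le_eq divide_inverse[symmetric] mult.commute[of "inverse _"] mult.commute[of "\<bar>t\<bar>"])
  qed
  have "((\<lambda>t. (convol p k h (x + t *\<^sub>R e) - convol p k h x) /\<^sub>R t) \<longlongrightarrow> convol p k h' x) (at 0 within ball 0 1)"
    unfolding tendsto_at_iff_sequentially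
  proof (intro allI impI)
    fix T :: "nat \<Rightarrow> real" assume T: "\<forall>n. T n \<in> ball 0 1 - {0}" "T \<longlonglongrightarrow> 0"
    have "(\<lambda>n. \<integral>y. p (k y) ((h (x + T n *\<^sub>R e - y) - h (x - y)) /\<^sub>R T n) \<partial>lborel) \<longlonglongrightarrow> (\<integral>y. p (k y) (h' (x - y)) \<partial>lborel)"
    proof (rule integral_dominated_convergence)
      show "integrable lborel (\<lambda>y. K * C' * 3 ^ CARD('n) * (norm (k y) * decay_weight (x - y)))"
        using k unfolding convolvable_def by auto
      show "AE y in lborel. (\<lambda>n. p (k y) ((h (x + T n *\<^sub>R e - y) - h (x - y)) /\<^sub>R T n)) \<longlonglongrightarrow> p (k y) (h' (x - y))"
      proof (intro AE_I2 tendsto tendsto_const)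
        fix y
        have "((\<lambda>t. (h (x - y + t *\<^sub>R e) - h (x - y)) /\<^sub>R t) \<longlongrightarrow> h' (x - y)) (at 0)"
          using hd unfolding partially_differentiable_def has_vector_derivative_at_0_iff e_def by auto
        then show "(\<lambda>n. (h (x + T n *\<^sub>R e - y) - h (x - y)) /\<^sub>R T n) \<longlonglongrightarrow> h' (x - y)"
          unfolding tendsto_at_iff_sequentially using T by (auto simp: o_def algebra_simps)
      qed
      show "AE y in lborel. norm (p (k y) ((h (x + T n *\<^sub>R e - y) - h (x - y)) /\<^sub>R T n))
          \<le> K * C' * 3 ^ CARD('n) * (norm (k y) * decay_weight (x - y))" for n
      proof (intro AE_I2)
        fix y
        let ?q = "(h (x + T n *\<^sub>R e - y) - h (x - y)) /\<^sub>R T n"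
        have "norm ?q \<le> C' * 3 ^ CARD('n) * decay_weight (x - y)"
          using T(1) by (intro bound) (auto dest!: spec[of _ n])
        then have "norm (k y) * norm ?q * K \<le> norm (k y) * (C' * 3 ^ CARD('n) * decay_weight (x - y)) * K"
          using K by (intro mult_right_mono mult_left_mono) auto
        then show "norm (p (k y) ?q) \<le> K * C' * 3 ^ CARD('n) * (norm (k y) * decay_weight (x - y))"
          using K(2)[of "k y" ?q] by (simp add: mult_ac)
      qed
      show "(\<lambda>y. p (k y) (h' (x - y))) \<in> borel_measurable lborel"
        using measurable_convol[OF h'] by simp
      show "(\<lambda>y. p (k y) ((h (x + T n *\<^sub>R e - y) - h (x - y)) /\<^sub>R T n)) \<in> borel_measurable lborel" for n
        using h k unfolding convolvable_def by (intro measurable_bilinear[OF p]) auto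
    qed
    moreover have "(\<integral>y. p (k y) ((h (x + t *\<^sub>R e - y) - h (x - y)) /\<^sub>R t) \<partial>lborel)
        = (convol p k h (x + t *\<^sub>R e) - convol p k h x) /\<^sub>R t" for t
      unfolding convol_def by (simp add: scaleR_right diff_right integrable_convol[OF h C])
    ultimately show "((\<lambda>t. (convol p k h (x + t *\<^sub>R e) - convol p k h x) /\<^sub>R t) \<circ> T) \<longlonglongrightarrow> convol p k h' x"
      by (simp add: o_def convol_def)
  qed
  then show "((\<lambda>t. (convol p k h (x + t *\<^sub>R axis i 1) - convol p k h (x + 0 *\<^sub>R axis i 1)) /\<^sub>R t) \<longlongrightarrow> convol p k h' x) (at 0)"
    by (simp add: e_def at_within_open[of _ "ball _ 1"])
qed

end

lemma convol_schwartz: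
  fixes k :: "real^'n::finite \<Rightarrow> 'b::{second_countable_topology,real_normed_vector}"
    and p :: "'b \<Rightarrow> complex \<Rightarrow> 'd::{second_countable_topology,banach}"
  assumes p: "bounded_bilinear p" and k: "convolvable k" and \<eta>: "\<eta> \<in> schwartz"
  shows continuous_convol_schwartz: "continuous_on UNIV (convol p k \<eta>)"
    and partially_differentiable_convol_schwartz:
      "partially_differentiable i (convol p k \<eta>) (convol p k (partial_deriv i \<eta>))"
proof -
  obtain C where C: "\<And>x. norm (\<eta> x) \<le> C * decay_weight x"
    using schwartz_decay[OF \<eta>] by blast
  obtain C' where C': "\<And>x. norm (partial_deriv i \<eta> x) \<le> C' * decay_weight x"
    using schwartz_decay[OF schwartz_partial_deriv[OF \<eta>]] by blast
  show "continuous_on UNIV (convol p k \<eta>)"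
    by (rule continuous_convol[OF p k schwartz_continuous[OF \<eta>] C])
  show "partially_differentiable i (convol p k \<eta>) (convol p k (partial_deriv i \<eta>))"
    by (intro partially_differentiable_convol[OF p k _ C C'] borel_measurable_continuous_onI
      schwartz_continuous schwartz_partial_deriv \<eta> smooth_partially_differentiable schwartz_smooth)
qed

lemma smooth_convol_schwartz:
  fixes k :: "real^'n::finite \<Rightarrow> 'b::{second_countable_topology,real_normed_vector}"
    and p :: "'b \<Rightarrow> complex \<Rightarrow> 'd::{second_countable_topology,banach}"
  assumes "bounded_bilinear p" "convolvable k" "\<eta> \<in> schwartz"
  shows "smooth (convol p k \<eta>)"
  by (rule smoothI(1)[of "\<lambda>w. convol p k (partial_derivs w \<eta>)"])
    (simp_all add: assms partial_derivs_Cons convol_schwartz schwartz_partial_derivs)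

section \<open>Fourier transforms of integrable functions\<close>

lemma exp_pi_cis:
  "exp (- 2 * \<i> * complex_of_real (pi * a)) = cis (- 2 * pi * a)"
  "exp (2 * \<i> * complex_of_real (pi * a)) = cis (2 * pi * a)"
  by (simp_all add: cis_conv_exp mult_ac)

lemma fourier_cis: "fourier u \<xi> = (\<integral>x. u x * cis (- 2 * pi * (x \<bullet> \<xi>)) \<partial>lborel)"
  unfolding fourier_def exp_pi_cis ..

lemma inverse_fourier_cis: "inverse_fourier u x = (\<integral>\<xi>. u \<xi> * cis (2 * pi * (x \<bullet> \<xi>)) \<partial>lborel)"
  unfolding inverse_fourier_def exp_pi_cis ..

lemma inverse_fourier_eq_fourier: "inverse_fourier u x = fourier u (- x)"
  by (simp add: fourier_cis inverse_fourier_cis inner_commute)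

lemma measurable_cis [measurable]: "cis \<in> borel_measurable borel"
  by (intro borel_measurable_continuous_onI continuous_intros)

lemma measurable_fourier:
  assumes [measurable]: "u \<in> borel_measurable borel"
  shows "fourier u \<in> borel_measurable borel"
  unfolding fourier_cis by measurable

lemma norm_fourier_le: "norm (fourier u \<xi>) \<le> (\<integral>x. norm (u x) \<partial>lborel)"
proof -
  have "norm (fourier u \<xi>) \<le> (\<integral>x. norm (u x * cis (- 2 * pi * (x \<bullet> \<xi>))) \<partial>lborel)"
    unfolding fourier_cis by (rule integral_norm_bound)
  then show ?thesis by (simp add: norm_mult)
qed

lemma integrable_mult_bounded:
  fixes u k :: "'a \<Rightarrow> complex"
  assumes u: "integrable M u" and k: "k \<in> borel_measurable M" "\<And>x. norm (k x) \<le> B"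
  shows "integrable M (\<lambda>x. u x * k x)"
proof (rule Bochner_Integration.integrable_bound)
  show "integrable M (\<lambda>x. B * norm (u x))" using u by simp
  show "AE x in M. norm (u x * k x) \<le> norm (B * norm (u x))"
  proof (intro AE_I2)
    fix x
    have "norm (u x * k x) \<le> B * norm (u x)"
      using mult_right_mono[OF k(2) norm_ge_zero[of "u x"], of x] by (simp add: norm_mult mult.commute)
    then show "norm (u x * k x) \<le> norm (B * norm (u x))" by (rule order_trans) simp
  qed
  show "(\<lambda>x. u x * k x) \<in> borel_measurable M"
    using k(1) borel_measurable_integrable[OF u] by measurable
qed

lemma integrable_mult_cis:
  fixes u :: "real^'n::finite \<Rightarrow> complex"
  assumes "integrable lborel u"
  shows "integrable lborel (\<lambda>x. u x * cis (c * (y \<bullet> x)))" "integrable lborel (\<lambda>x. u x * cis (c * (x \<bullet> y)))"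
  by (intro integrable_mult_bounded[OF assms, where B=1]; simp)+

text \<open>With \<open>k\<close> a character, this exchanges an integral over space with one over frequency.\<close>

lemma Fubini_bounded_kernel:
  fixes h :: "'a::euclidean_space \<Rightarrow> complex" and u :: "'b::euclidean_space \<Rightarrow> complex"
  assumes h: "integrable lborel h" and u: "integrable lborel u"
    and k[measurable]: "case_prod k \<in> borel_measurable (lborel \<Otimes>\<^sub>M lborel)" and B: "\<And>x y. norm (k x y) \<le> B"
  shows "integrable (lborel \<Otimes>\<^sub>M lborel) (\<lambda>(x,y). h x * (u y * k x y))"
    and "(\<integral>x. h x * (\<integral>y. u y * k x y \<partial>lborel) \<partial>lborel) = (\<integral>y. u y * (\<integral>x. h x * k x y \<partial>lborel) \<partial>lborel)"
    and "integrable lborel (\<lambda>x. h x * (\<integral>y. u y * k x y \<partial>lborel))"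
proof -
  have [measurable]: "h \<in> borel_measurable borel" "u \<in> borel_measurable borel"
    using borel_measurable_integrable[OF h] borel_measurable_integrable[OF u] by auto
  have *: "integrable (lborel \<Otimes>\<^sub>M lborel) (\<lambda>(x,y). h x * u y)"
  proof (rule lborel_pair.Fubini_integrable)
    show "integrable lborel (\<lambda>x. LINT y|lborel. norm (case (x, y) of (x, y) \<Rightarrow> h x * u y))"
      using h by (simp add: norm_mult)
    show "AE x in lborel. integrable lborel (\<lambda>y. case (x, y) of (x, y) \<Rightarrow> h x * u y)"
      using u by simp
  qed measurable
  have "integrable (lborel \<Otimes>\<^sub>M lborel) (\<lambda>z. (case z of (x,y) \<Rightarrow> h x * u y) * case_prod k z)"
    using B by (intro integrable_mult_bounded[OF *, where B=B] k) auto
  then show int: "integrable (lborel \<Otimes>\<^sub>M lborel) (\<lambda>(x,y). h x * (u y * k x y))"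
    by (simp add: case_prod_beta' mult.assoc)
  have "(\<integral>x. h x * (\<integral>y. u y * k x y \<partial>lborel) \<partial>lborel) = (\<integral>x. (\<integral>y. h x * (u y * k x y) \<partial>lborel) \<partial>lborel)"
    by simp
  also have "\<dots> = (\<integral>y. (\<integral>x. h x * (u y * k x y) \<partial>lborel) \<partial>lborel)"
    by (rule lborel_pair.Fubini_integral[OF int, symmetric])
  also have "\<dots> = (\<integral>y. u y * (\<integral>x. h x * k x y \<partial>lborel) \<partial>lborel)"
    by (simp add: mult.left_commute flip: integral_mult_right_zero)
  finally show "(\<integral>x. h x * (\<integral>y. u y * k x y \<partial>lborel) \<partial>lborel) = (\<integral>y. u y * (\<integral>x. h x * k x y \<partial>lborel) \<partial>lborel)" .
  show "integrable lborel (\<lambda>x. h x * (\<integral>y. u y * k x y \<partial>lborel))"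
    using lborel_pair.integrable_fst'[OF int] by simp
qed

lemma inverse_fourier_multiplication:
  fixes h u :: "real^'n::finite \<Rightarrow> complex"
  assumes "integrable lborel h" "integrable lborel u"
  shows "(\<integral>x. h x * inverse_fourier u x \<partial>lborel) = (\<integral>\<xi>. u \<xi> * inverse_fourier h \<xi> \<partial>lborel)"
  unfolding inverse_fourier_cis
  using Fubini_bounded_kernel(2)[OF assms, of "\<lambda>x y. cis (2 * pi * (x \<bullet> y))" 1]
  by (simp add: inner_commute)

lemma fourier_translate:
  "fourier (\<lambda>x. u (x - a)) \<xi> = cis (- 2 * pi * (a \<bullet> \<xi>)) * fourier u \<xi>"
proof -
  have "fourier (\<lambda>x. u (x - a)) \<xi> = (\<integral>x. u ((x + a) - a) * cis (- 2 * pi * ((x + a) \<bullet> \<xi>)) \<partial>lborel)"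
    unfolding fourier_cis by (rule integral_lborel_plus[symmetric])
  also have "\<dots> = (\<integral>x. cis (- 2 * pi * (a \<bullet> \<xi>)) * (u x * cis (- 2 * pi * (x \<bullet> \<xi>))) \<partial>lborel)"
    by (intro Bochner_Integration.integral_cong refl) (simp add: cis_mult inner_add_left algebra_simps)
  finally show ?thesis unfolding fourier_cis by simp
qed

lemma integrable_decaying:
  fixes h :: "real^'n::finite \<Rightarrow> complex"
  assumes "h \<in> borel_measurable borel" "\<And>x. norm (h x) \<le> C * decay_weight x"
  shows "integrable lborel h"
proof (rule Bochner_Integration.integrable_bound)
  show "integrable lborel (\<lambda>x::real^'n. C * decay_weight x)"
    by (intro integrable_mult_right integrable_decay_weight)
  show "AE x in lborel. norm (h x) \<le> norm (C * decay_weight x)"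
    using assms(2) by (intro AE_I2) (metis abs_ge_self order_trans real_norm_def)
qed (use assms in simp)

lemma schwartz_measurable: "\<psi> \<in> schwartz \<Longrightarrow> \<psi> \<in> borel_measurable borel"
  by (intro borel_measurable_continuous_onI schwartz_continuous)

lemma schwartz_integrable: "\<psi> \<in> schwartz \<Longrightarrow> integrable lborel \<psi>"
  using schwartz_decay schwartz_measurable integrable_decaying by metis

text \<open>The convolution of a function \<open>h\<close> with the character of frequency \<open>\<xi>\<close>
  is the character times \<open>fourier h \<xi>\<close>; computing its partial derivative at the origin in two ways, on the
  character and under the integral, gives the formula.\<close>

lemma fourier_partially_differentiable:
  fixes h h' :: "real^'n::finite \<Rightarrow> complex"
  assumes h: "h \<in> borel_measurable borel" and C: "\<And>x. norm (h x) \<le> C * decay_weight x"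
    and C': "\<And>x. norm (h' x) \<le> C' * decay_weight x"
    and hd: "partially_differentiable i h h'" and h': "h' \<in> borel_measurable borel"
  shows "fourier h' \<xi> = 2 * pi * \<i> * (\<xi> $ i) * fourier h \<xi>"
proof -
  define k where "k y = cis (2 * pi * (y \<bullet> \<xi>))" for y
  have k: "convolvable k"
    unfolding k_def by (rule convolvable_bounded[where B=1]) auto
  have conv: "convol (*) k g x = cis (2 * pi * (x \<bullet> \<xi>)) * fourier g \<xi>" for g x
  proof -
    have "convol (*) k g x = (\<integral>y. k (x - y) * g (x - (x - y)) \<partial>lborel)"
      unfolding convol_def by (rule integral_lborel_diff[symmetric])
    also have "\<dots> = (\<integral>y. cis (2 * pi * (x \<bullet> \<xi>)) * (g y * cis (- 2 * pi * (y \<bullet> \<xi>))) \<partial>lborel)"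
      unfolding k_def
      by (intro Bochner_Integration.integral_cong refl) (simp add: cis_mult inner_diff_left algebra_simps)
    finally show ?thesis unfolding fourier_cis by simp
  qed
  have "partially_differentiable i (convol (*) k h) (convol (*) k h')"
    by (rule partially_differentiable_convol[OF bounded_bilinear_mult k h C C' hd h'])
  then have "((\<lambda>t. cis (2 * pi * ((t *\<^sub>R axis i 1) \<bullet> \<xi>)) * fourier h \<xi>) has_vector_derivative fourier h' \<xi>) (at 0)"
    unfolding partially_differentiable_def conv by (auto dest!: spec[of _ 0])
  then have D: "((\<lambda>t. cis (2 * pi * (t * \<xi> $ i)) * fourier h \<xi>) has_vector_derivative fourier h' \<xi>) (at 0)"
    by (simp add: inner_axis' )
  have "((\<lambda>t. cis (2 * pi * (t * \<xi> $ i)) * fourier h \<xi>) has_vector_derivative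
      (2 * pi * \<i> * (\<xi> $ i) * fourier h \<xi>)) (at 0)"
  proof -
    have "((\<lambda>t. exp (t *\<^sub>R (2 * pi * \<i> * (\<xi> $ i))) * fourier h \<xi>) has_vector_derivative
        exp (0 *\<^sub>R (2 * pi * \<i> * (\<xi> $ i))) * (2 * pi * \<i> * (\<xi> $ i)) * fourier h \<xi>) (at 0)"
      by (intro has_vector_derivative_mult_left exp_scaleR_has_vector_derivative_right)
    then show ?thesis
      by (simp add: cis_conv_exp scaleR_conv_of_real mult_ac)
  qed
  with D show ?thesis by (rule vector_derivative_unique_at)
qed

lemma fourier_partial_deriv:
  fixes \<psi> :: "real^'n::finite \<Rightarrow> complex"
  assumes \<psi>: "\<psi> \<in> schwartz"
  shows "fourier (partial_deriv i \<psi>) \<xi> = 2 * pi * \<i> * (\<xi> $ i) * fourier \<psi> \<xi>"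
proof -
  obtain C where C: "\<And>x. norm (\<psi> x) \<le> C * decay_weight x"
    using schwartz_decay[OF \<psi>] by blast
  obtain C' where C': "\<And>x. norm (partial_deriv i \<psi> x) \<le> C' * decay_weight x"
    using schwartz_decay[OF schwartz_partial_deriv[OF \<psi>]] by blast
  show ?thesis
    by (intro fourier_partially_differentiable[OF _ C C'] schwartz_measurable schwartz_partial_deriv \<psi>
      smooth_partially_differentiable schwartz_smooth)
qed

text \<open>Multiplying the transform by \<open>(\<xi> $ j)\<^sup>2\<close> amounts to differentiating \<open>\<psi>\<close> twice, and the transform of an
  integrable function is bounded.\<close>

lemma fourier_schwartz_decay:
  fixes \<psi> :: "real^'n::finite \<Rightarrow> complex"
  assumes "\<psi> \<in> schwartz"
  shows "\<exists>C. \<forall>\<xi>. norm (fourier \<psi> \<xi>) \<le> C * decay_weight \<xi>"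
proof (rule bounded_by_decay_weight)
  fix S :: "'n set"
  have "finite S" by simp
  then show "\<exists>C. \<forall>\<xi>. (\<Prod>j\<in>S. (\<xi> $ j)\<^sup>2) * norm (fourier \<psi> \<xi>) \<le> C"
    using assms
  proof (induction S arbitrary: \<psi>)
    case empty
    then show ?case using norm_fourier_le by auto
  next
    case (insert j S)
    have S: "partial_deriv j (partial_deriv j \<psi>) \<in> schwartz"
      by (intro schwartz_partial_deriv insert.prems)
    then obtain C where C: "\<And>\<xi>. (\<Prod>j\<in>S. (\<xi> $ j)\<^sup>2) * norm (fourier (partial_deriv j (partial_deriv j \<psi>)) \<xi>) \<le> C"
      using insert.IH by blast
    have "(\<Prod>j\<in>insert j S. (\<xi> $ j)\<^sup>2) * norm (fourier \<psi> \<xi>) \<le> C / (2 * pi)\<^sup>2" for \<xi>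
    proof -
      have "norm (fourier (partial_deriv j (partial_deriv j \<psi>)) \<xi>) = (2 * pi)\<^sup>2 * (\<xi> $ j)\<^sup>2 * norm (fourier \<psi> \<xi>)"
        by (simp add: fourier_partial_deriv schwartz_partial_deriv insert.prems norm_mult power2_eq_square)
      then have "(\<Prod>j\<in>S. (\<xi> $ j)\<^sup>2) * ((2 * pi)\<^sup>2 * (\<xi> $ j)\<^sup>2 * norm (fourier \<psi> \<xi>)) \<le> C"
        using C[of \<xi>] by simp
      then show ?thesis
        using insert.hyps by (simp add: pos_le_divide_eq mult_ac)
    qed
    then show ?case by blast
  qed
qed

lemma fourier_schwartz_integrable:
  fixes \<psi> :: "real^'n::finite \<Rightarrow> complex"
  assumes "\<psi> \<in> schwartz"
  shows "integrable lborel (fourier \<psi>)"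
  using fourier_schwartz_decay[OF assms] measurable_fourier[OF schwartz_measurable[OF assms]] integrable_decaying
  by blast

lemma norm_fourier_schwartz_integrable:
  fixes \<psi> :: "real^'n::finite \<Rightarrow> complex"
  assumes \<psi>: "\<psi> \<in> schwartz"
  shows "integrable lborel (\<lambda>\<xi>. complex_of_real (norm \<xi>) * fourier \<psi> \<xi>)"
proof (rule Bochner_Integration.integrable_bound)
  show "integrable lborel (\<lambda>\<xi>. (\<Sum>i\<in>UNIV. norm (fourier (partial_deriv i \<psi>) \<xi>)) / (2 * pi))"
    by (intro integrable_divide Bochner_Integration.integrable_sum integrable_norm fourier_schwartz_integrable schwartz_partial_deriv \<psi>)
  show "(\<lambda>\<xi>. complex_of_real (norm \<xi>) * fourier \<psi> \<xi>) \<in> borel_measurable lborel"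
    using measurable_fourier[OF schwartz_measurable[OF \<psi>]] by measurable
  show "AE \<xi> in lborel. norm (complex_of_real (norm \<xi>) * fourier \<psi> \<xi>)
      \<le> norm ((\<Sum>i\<in>UNIV. norm (fourier (partial_deriv i \<psi>) \<xi>)) / (2 * pi))"
  proof (intro AE_I2)
    fix \<xi> :: "real^'n"
    have "norm (complex_of_real (norm \<xi>) * fourier \<psi> \<xi>) \<le> (\<Sum>i\<in>UNIV. \<bar>\<xi> $ i\<bar>) * norm (fourier \<psi> \<xi>)"
      by (simp add: norm_mult mult_right_mono norm_le_l1_cart)
    also have "\<dots> = (\<Sum>i\<in>UNIV. norm (fourier (partial_deriv i \<psi>) \<xi>)) / (2 * pi)"
      by (simp add: fourier_partial_deriv \<psi> norm_mult sum_distrib_left sum_distrib_right sum_divide_distrib mult_ac)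
    finally show "norm (complex_of_real (norm \<xi>) * fourier \<psi> \<xi>)
      \<le> norm ((\<Sum>i\<in>UNIV. norm (fourier (partial_deriv i \<psi>) \<xi>)) / (2 * pi))"
      by (simp add: sum_nonneg)
  qed
qed

section \<open>Gaussians\<close>

text \<open>The characteristic function of the standard normal distribution, rescaled.\<close>

lemma gaussian_fourier_1D:
  assumes t: "t > 0"
  shows "integrable lborel (\<lambda>y. exp (- t * y\<^sup>2))"
    and "(\<integral>y. complex_of_real (exp (- t * y\<^sup>2)) * cis (- 2 * pi * (y * \<xi>)) \<partial>lborel)
      = complex_of_real (sqrt (pi / t) * exp (- (pi\<^sup>2 * \<xi>\<^sup>2) / t))"
proof -
  define c where "c = 1 / sqrt (2 * t)"
  have c: "c > 0" "c\<^sup>2 = 1 / (2 * t)" using t by (auto simp: c_def power_divide)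
  have N: "std_normal_density x = 1 / sqrt (2 * pi) * exp (- x\<^sup>2 / 2)" for x
    by (simp add: std_normal_density_def)
  have *: "std_normal_density (0 + (1 / c) * y) = 1 / sqrt (2 * pi) * exp (- t * y\<^sup>2)" for y
    unfolding N using c t by (simp add: power_mult_distrib power_divide field_simps)
  have "integrable lborel (\<lambda>y. std_normal_density (0 + (1 / c) * y))"
    using c by (intro lborel_integrable_real_affine integrable_normal_density) auto
  then show int: "integrable lborel (\<lambda>y. exp (- t * y\<^sup>2))"
    unfolding * using integrable_mult_right[of "sqrt (2 * pi)" lborel "\<lambda>y. 1 / sqrt (2 * pi) * exp (- t * y\<^sup>2)"] by simp
  have "complex_of_real (exp (- ((2 * pi * c * (- \<xi>))\<^sup>2) / 2)) = char std_normal_distribution (2 * pi * c * (- \<xi>))"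
    by (simp add: char_std_normal_distribution)
  also have "\<dots> = (\<integral>x. std_normal_density x *\<^sub>R cis (2 * pi * c * (- \<xi>) * x) \<partial>lborel)"
    unfolding char_def
    by (subst integral_density) (auto simp: normal_density_nonneg cis_conv_exp)
  also have "\<dots> = \<bar>1 / c\<bar> *\<^sub>R (\<integral>y. std_normal_density (0 + (1 / c) * y) *\<^sub>R cis (2 * pi * c * (- \<xi>) * (0 + (1 / c) * y)) \<partial>lborel)"
    using c by (intro lborel_integral_real_affine) auto
  also have "\<dots> = (1 / c * (1 / sqrt (2 * pi))) *\<^sub>R (\<integral>y. complex_of_real (exp (- t * y\<^sup>2)) * cis (- 2 * pi * (y * \<xi>)) \<partial>lborel)"
    unfolding * using c(1) by (simp add: scaleR_conv_of_real mult_ac flip: integral_mult_right_zero)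
  finally have "(\<integral>y. complex_of_real (exp (- t * y\<^sup>2)) * cis (- 2 * pi * (y * \<xi>)) \<partial>lborel)
      = complex_of_real (c * sqrt (2 * pi)) * complex_of_real (exp (- ((2 * pi * c * (- \<xi>))\<^sup>2) / 2))"
    using c(1) by (simp add: scaleR_conv_of_real)
  moreover have "c * sqrt (2 * pi) = sqrt (pi / t)"
    using t by (simp add: c_def real_sqrt_mult real_sqrt_divide)
  moreover have "- ((2 * pi * c * (- \<xi>))\<^sup>2) / 2 = - (pi\<^sup>2 * \<xi>\<^sup>2) / t"
    using t by (simp add: power_mult_distrib c(2) field_simps)
  ultimately show "(\<integral>y. complex_of_real (exp (- t * y\<^sup>2)) * cis (- 2 * pi * (y * \<xi>)) \<partial>lborel)
      = complex_of_real (sqrt (pi / t) * exp (- (pi\<^sup>2 * \<xi>\<^sup>2) / t))"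
    by (simp only: of_real_mult)
qed

lemma norm_squared_vec: "(norm (x::real^'n::finite))\<^sup>2 = (\<Sum>j\<in>UNIV. (x $ j)\<^sup>2)"
  by (simp add: norm_vec_def L2_set_def sum_nonneg)

lemma exp_norm_squared_vec: "exp (c * (norm (x::real^'n::finite))\<^sup>2) = (\<Prod>j\<in>UNIV. exp (c * (x $ j)\<^sup>2))"
  by (simp add: norm_squared_vec sum_distrib_left exp_sum)

lemma cis_sum: "finite A \<Longrightarrow> cis (\<Sum>j\<in>A. f j) = (\<Prod>j\<in>A. cis (f j))"
  by (induction A rule: finite_induct) (auto simp: cis_mult[symmetric])

lemma gaussian_integrable:
  assumes "t > 0"
  shows "integrable lborel (\<lambda>x::real^'n::finite. exp (- t * (norm x)\<^sup>2))"
  unfolding exp_norm_squared_vec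
  by (rule integrable_prod_vec[of "\<lambda>_ y. exp (- t * y\<^sup>2)"]) (rule gaussian_fourier_1D(1)[OF assms])

lemma gaussian_fourier:
  fixes \<xi> :: "real^'n::finite"
  assumes t: "t > 0"
  shows "fourier (\<lambda>x. complex_of_real (exp (- t * (norm x)\<^sup>2))) \<xi>
    = complex_of_real (sqrt (pi / t) ^ CARD('n) * exp (- (pi\<^sup>2 * (norm \<xi>)\<^sup>2) / t))"
proof -
  have int: "integrable lborel (\<lambda>y. complex_of_real (exp (- t * y\<^sup>2)) * cis (- 2 * pi * (y * \<xi> $ j)))" for j
    by (rule integrable_mult_bounded[where B=1])
       (use gaussian_fourier_1D(1)[OF t] in \<open>auto simp: complex_of_real_integrable_eq simp del: of_real_exp\<close>)
  have "cis (- 2 * pi * (x \<bullet> \<xi>)) = (\<Prod>j\<in>UNIV. cis (- 2 * pi * (x $ j * \<xi> $ j)))" for x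
    by (simp add: inner_vec_def sum_distrib_left cis_sum[symmetric] del: cis_mult)
  then have "complex_of_real (exp (- t * (norm x)\<^sup>2)) * cis (- 2 * pi * (x \<bullet> \<xi>))
      = (\<Prod>j\<in>UNIV. complex_of_real (exp (- t * (x $ j)\<^sup>2)) * cis (- 2 * pi * (x $ j * \<xi> $ j)))" for x
    by (simp only: exp_norm_squared_vec of_real_prod prod.distrib)
  then have "fourier (\<lambda>x. complex_of_real (exp (- t * (norm x)\<^sup>2))) \<xi>
      = (\<integral>x. (\<Prod>j\<in>UNIV. complex_of_real (exp (- t * (x $ j)\<^sup>2)) * cis (- 2 * pi * (x $ j * \<xi> $ j))) \<partial>lborel)"
    unfolding fourier_cis by simp
  also have "\<dots> = (\<Prod>j\<in>UNIV. \<integral>y. complex_of_real (exp (- t * y\<^sup>2)) * cis (- 2 * pi * (y * \<xi> $ j)) \<partial>lborel)"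
    by (rule integral_prod_vec[OF int])
  also have "\<dots> = (\<Prod>j\<in>UNIV. complex_of_real (sqrt (pi / t) * exp (- (pi\<^sup>2 / t) * (\<xi> $ j)\<^sup>2)))"
    unfolding gaussian_fourier_1D(2)[OF t] by (intro prod.cong refl) (simp add: field_simps)
  also have "\<dots> = complex_of_real (sqrt (pi / t) ^ CARD('n) * exp (- (pi\<^sup>2 / t) * (norm \<xi>)\<^sup>2))"
    unfolding exp_norm_squared_vec of_real_prod[symmetric] prod.distrib by simp
  finally show ?thesis by (simp add: field_simps)
qed

lemma gaussian_integral:
  assumes "t > 0"
  shows "(\<integral>x. exp (- t * (norm (x::real^'n::finite))\<^sup>2) \<partial>lborel) = sqrt (pi / t) ^ CARD('n)"
proof -
  have "complex_of_real (\<integral>x. exp (- t * (norm (x::real^'n))\<^sup>2) \<partial>lborel) = complex_of_real (sqrt (pi / t) ^ CARD('n))"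
    using gaussian_fourier[OF assms, of "0::real^'n"] unfolding integral_complex_of_real[symmetric] fourier_cis by simp
  then show ?thesis by (simp only: of_real_eq_iff)
qed

lemma gaussian_decay:
  assumes t: "t > 0"
  shows "exp (- t * (norm x)\<^sup>2) \<le> (1 + 1 / t) ^ CARD('n) * decay_weight (x::real^'n::finite)"
proof -
  have "exp (- t * y\<^sup>2) \<le> (1 + 1 / t) * inverse (1 + y\<^sup>2)" for y
  proof -
    have "t * y\<^sup>2 \<le> exp (t * y\<^sup>2)" using exp_ge_add_one_self[of "t * y\<^sup>2"] by linarith
    then have "y\<^sup>2 \<le> (1 / t) * exp (t * y\<^sup>2)" using t by (simp add: field_simps)
    moreover have "1 \<le> exp (t * y\<^sup>2)" using t by simp
    ultimately have "1 + y\<^sup>2 \<le> (1 + 1 / t) * exp (t * y\<^sup>2)" unfolding distrib_right by linarith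
    moreover have "1 + y\<^sup>2 > 0" by (simp add: add_pos_nonneg)
    ultimately show ?thesis by (simp add: exp_minus divide_simps mult.commute)
  qed
  then have "exp (- t * (norm x)\<^sup>2) \<le> (\<Prod>j\<in>(UNIV::'n set). (1 + 1 / t) * inverse (1 + (x $ j)\<^sup>2))"
    unfolding exp_norm_squared_vec by (intro prod_mono) auto
  then show ?thesis unfolding decay_weight_def prod.distrib by simp
qed

lemma coordinate_gaussian_decay:
  assumes t: "t > 0"
  obtains C where "\<And>x::real^'n::finite. \<bar>x $ j\<bar> * exp (- t * (norm x)\<^sup>2) \<le> C * decay_weight x"
proof -
  have "\<bar>x $ j\<bar> * exp (- t * (norm x)\<^sup>2) \<le> (1 / t + 1) * (1 + 1 / (t / 2)) ^ CARD('n) * decay_weight x" for x :: "real^'n"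
  proof -
    have "\<bar>x $ j\<bar> \<le> norm x" by (rule component_le_norm_cart)
    \<comment> \<open>Half of the Gaussian is sacrificed to absorb the linear factor.\<close>
    also have "norm x \<le> 1 / 2 * (norm x)\<^sup>2 + 1"
      using zero_le_power2[of "norm x - 1"] by (simp add: power2_eq_square algebra_simps)
    also have "\<dots> \<le> (1 / t + 1) * exp (t / 2 * (norm x)\<^sup>2)"
    proof -
      have "t / 2 * (norm x)\<^sup>2 \<le> exp (t / 2 * (norm x)\<^sup>2)" using exp_ge_add_one_self[of "t / 2 * (norm x)\<^sup>2"] by linarith
      then have "1 / 2 * (norm x)\<^sup>2 \<le> (1 / t) * exp (t / 2 * (norm x)\<^sup>2)" using t by (simp add: field_simps)
      moreover have "1 \<le> exp (t / 2 * (norm x)\<^sup>2)" using t by simp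
      ultimately show ?thesis unfolding distrib_right by linarith
    qed
    finally have "\<bar>x $ j\<bar> * exp (- t * (norm x)\<^sup>2) \<le> (1 / t + 1) * exp (t / 2 * (norm x)\<^sup>2) * exp (- t * (norm x)\<^sup>2)"
      by (intro mult_right_mono) auto
    also have "\<dots> = (1 / t + 1) * exp (- (t / 2) * (norm x)\<^sup>2)"
      by (simp add: mult.assoc flip: exp_add)
    also have "\<dots> \<le> (1 / t + 1) * ((1 + 1 / (t / 2)) ^ CARD('n) * decay_weight x)"
      using t by (intro mult_left_mono gaussian_decay) auto
    finally show ?thesis by (simp only: mult.assoc)
  qed
  then show ?thesis using that by blast
qed

text \<open>Up to the factor \<open>- 2 * t\<close>, the function is the partial derivative of the Gaussian.\<close>

lemma coordinate_gaussian_fourier: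
  fixes \<xi> :: "real^'n::finite"
  assumes t: "t > 0"
  shows "fourier (\<lambda>x. complex_of_real (x $ j * exp (- t * (norm x)\<^sup>2))) \<xi>
    = - (pi * \<i> * (\<xi> $ j) / t) * complex_of_real (sqrt (pi / t) ^ CARD('n) * exp (- (pi\<^sup>2 * (norm \<xi>)\<^sup>2) / t))"
proof -
  define h where "h x = complex_of_real (exp (- t * (norm x)\<^sup>2))" for x :: "real^'n"
  define h' where "h' x = complex_of_real (- 2 * t) * complex_of_real (x $ j * exp (- t * (norm x)\<^sup>2))" for x :: "real^'n"
  obtain C where C: "\<And>x::real^'n. \<bar>x $ j\<bar> * exp (- t * (norm x)\<^sup>2) \<le> C * decay_weight x"
    using coordinate_gaussian_decay[OF t] by blast
  have "partially_differentiable j h h'"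
    unfolding partially_differentiable_def
  proof
    fix x :: "real^'n"
    have eq: "(norm (x + s *\<^sub>R axis j 1))\<^sup>2 = (norm x)\<^sup>2 + 2 * s * x $ j + s\<^sup>2" for s
      unfolding power2_norm_eq_inner by (simp add: inner_axis inner_axis' inner_simps power2_eq_square algebra_simps)
    have "((\<lambda>s. exp (- t * (norm (x + s *\<^sub>R axis j 1))\<^sup>2)) has_real_derivative - 2 * t * (x $ j * exp (- t * (norm x)\<^sup>2))) (at 0)"
      unfolding eq by (auto intro!: derivative_eq_intros)
    then show "((\<lambda>s. h (x + s *\<^sub>R axis j 1)) has_vector_derivative h' x) (at 0)"
      unfolding h_def h'_def
      by (metis has_vector_derivative_of_real has_real_derivative_iff_has_vector_derivative of_real_mult)
  qed
  then have "fourier h' \<xi> = 2 * pi * \<i> * (\<xi> $ j) * fourier h \<xi>"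
  proof (rule fourier_partially_differentiable[rotated 3])
    show "norm (h x) \<le> (1 + 1 / t) ^ CARD('n) * decay_weight x" for x
      using gaussian_decay[OF t, of x] unfolding h_def by (simp del: of_real_exp)
    show "norm (h' x) \<le> 2 * t * C * decay_weight x" for x
      using C[of x] t unfolding h'_def norm_mult norm_of_real abs_mult by (simp add: mult_ac)
  qed (unfold h_def h'_def; measurable)+
  moreover have "fourier h' \<xi> = complex_of_real (- 2 * t) * fourier (\<lambda>x. complex_of_real (x $ j * exp (- t * (norm x)\<^sup>2))) \<xi>"
    unfolding fourier_def h'_def mult.assoc by (rule integral_mult_right_zero)
  moreover have "complex_of_real (- 2 * t) \<noteq> 0"
    using t by simp
  ultimately have "fourier (\<lambda>x. complex_of_real (x $ j * exp (- t * (norm x)\<^sup>2))) \<xi>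
      = (2 * pi * \<i> * (\<xi> $ j) * fourier h \<xi>) / complex_of_real (- 2 * t)"
    by (metis nonzero_mult_div_cancel_left)
  also have "\<dots> = - (pi * \<i> * (\<xi> $ j) / t) * fourier h \<xi>"
    using t by simp
  finally show ?thesis
    unfolding h_def gaussian_fourier[OF t] .
qed

section \<open>Fourier inversion\<close>

lemma integral_lborel_scale:
  fixes f :: "real^'n::finite \<Rightarrow> complex"
  assumes c: "c > 0" and [measurable]: "f \<in> borel_measurable borel"
  shows "(\<integral>y. f y \<partial>lborel) = complex_of_real (c ^ CARD('n)) * (\<integral>z. f (x + c *\<^sub>R z) \<partial>lborel)"
proof -
  have "(\<integral>y. f y \<partial>lborel) = (\<integral>y. f y \<partial>density (distr lborel borel (\<lambda>z. x + c *\<^sub>R z)) (\<lambda>_. ennreal (\<bar>c\<bar> ^ DIM(real^'n))))"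
    using lborel_affine[of c x] c by simp
  also have "\<dots> = (\<integral>z. (\<bar>c\<bar> ^ DIM(real^'n)) *\<^sub>R f (x + c *\<^sub>R z) \<partial>lborel)"
    by (subst integral_density) (auto simp: integral_distr)
  finally show ?thesis using c by (simp add: scaleR_conv_of_real)
qed

lemma gaussian_total:
  "(\<integral>x. complex_of_real (exp (- (norm (x::real^'n::finite))\<^sup>2)) \<partial>lborel) = complex_of_real (sqrt pi ^ CARD('n))"
  using gaussian_fourier[of 1 "0::real^'n"] by (simp add: fourier_cis)

text \<open>Damping the inversion integral by \<open>exp (- s * (norm \<xi>)\<^sup>2)\<close> makes Fubini applicable and produces an average
  of \<open>\<psi>\<close> over a Gaussian centred at \<open>x\<close> whose width tends to zero with \<open>s\<close>.\<close>

theorem fourier_inversion: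
  fixes \<psi> :: "real^'n::finite \<Rightarrow> complex"
  assumes \<psi>: "continuous_on UNIV \<psi>" "\<And>x. norm (\<psi> x) \<le> B" "integrable lborel \<psi>"
    and F: "integrable lborel (fourier \<psi>)"
  shows "inverse_fourier (fourier \<psi>) x = \<psi> x"
proof -
  have [measurable]: "\<psi> \<in> borel_measurable borel" "fourier \<psi> \<in> borel_measurable borel"
    using borel_measurable_continuous_onI[OF \<psi>(1)] measurable_fourier by auto
  define s where "s n = inverse (real (Suc n))" for n
  have s: "s n > 0" for n by (simp add: s_def)
  have s0: "s \<longlonglongrightarrow> 0" unfolding s_def by (rule LIMSEQ_inverse_real_of_nat)
  define A where "A n = (\<integral>\<xi>. fourier \<psi> \<xi> * cis (2 * pi * (x \<bullet> \<xi>)) * complex_of_real (exp (- s n * (norm \<xi>)\<^sup>2)) \<partial>lborel)" for n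
  have "A \<longlonglongrightarrow> (\<integral>\<xi>. fourier \<psi> \<xi> * cis (2 * pi * (x \<bullet> \<xi>)) \<partial>lborel)"
    unfolding A_def
  proof (rule integral_dominated_convergence)
    show "integrable lborel (\<lambda>\<xi>. norm (fourier \<psi> \<xi>))" using F by simp
    have "(\<lambda>n. fourier \<psi> \<xi> * cis (2 * pi * (x \<bullet> \<xi>)) * complex_of_real (exp (- s n * (norm \<xi>)\<^sup>2)))
        \<longlonglongrightarrow> fourier \<psi> \<xi> * cis (2 * pi * (x \<bullet> \<xi>)) * complex_of_real (exp (- 0 * (norm \<xi>)\<^sup>2))" for \<xi>
      by (intro tendsto_intros s0)
    then show "AE \<xi> in lborel. (\<lambda>n. fourier \<psi> \<xi> * cis (2 * pi * (x \<bullet> \<xi>)) * complex_of_real (exp (- s n * (norm \<xi>)\<^sup>2)))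
        \<longlonglongrightarrow> fourier \<psi> \<xi> * cis (2 * pi * (x \<bullet> \<xi>))" by simp
    show "AE \<xi> in lborel. norm (fourier \<psi> \<xi> * cis (2 * pi * (x \<bullet> \<xi>)) * complex_of_real (exp (- s n * (norm \<xi>)\<^sup>2))) \<le> norm (fourier \<psi> \<xi>)" for n
      using s[of n] by (intro AE_I2) (simp add: norm_mult mult_left_le del: of_real_exp)
  qed measurable
  then have lim1: "A \<longlonglongrightarrow> inverse_fourier (fourier \<psi>) x" by (simp add: inverse_fourier_cis)

  have A: "A n = complex_of_real (inverse (sqrt pi) ^ CARD('n)) *
      (\<integral>z. \<psi> (x + (sqrt (s n) / pi) *\<^sub>R z) * complex_of_real (exp (- (norm z)\<^sup>2)) \<partial>lborel)" for n
  proof -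
    define g where "g \<xi> = complex_of_real (exp (- s n * (norm \<xi>)\<^sup>2))" for \<xi> :: "real^'n"
    have g: "integrable lborel g"
      unfolding g_def using gaussian_integrable[OF s[of n], where 'n='n] by (simp add: complex_of_real_integrable_eq del: of_real_exp)
    have "A n = (\<integral>\<xi>. g \<xi> * cis (2 * pi * (x \<bullet> \<xi>)) * (\<integral>y. \<psi> y * cis (- 2 * pi * (\<xi> \<bullet> y)) \<partial>lborel) \<partial>lborel)"
      unfolding A_def g_def fourier_cis by (simp add: mult_ac inner_commute)
    also have "\<dots> = (\<integral>y. \<psi> y * (\<integral>\<xi>. g \<xi> * cis (2 * pi * (x \<bullet> \<xi>)) * cis (- 2 * pi * (\<xi> \<bullet> y)) \<partial>lborel) \<partial>lborel)"
      by (rule Fubini_bounded_kernel(2)[OF integrable_mult_cis(1)[OF g] \<psi>(3), where B=1]) auto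
    also have "\<dots> = (\<integral>y. \<psi> y * fourier g (y - x) \<partial>lborel)"
    proof -
      have "cis (2 * pi * (x \<bullet> \<xi>)) * cis (- 2 * pi * (\<xi> \<bullet> y)) = cis (- 2 * pi * (\<xi> \<bullet> (y - x)))" for \<xi> y
        by (simp add: cis_mult inner_diff_right algebra_simps inner_commute)
      then show ?thesis unfolding fourier_cis by (simp only: mult.assoc)
    qed
    \<comment> \<open>The substitution \<open>y = x + (sqrt s / pi) z\<close> turns the Gaussian of width \<open>sqrt s\<close> into a fixed one.\<close>
    also have "\<dots> = complex_of_real ((sqrt (s n) / pi) ^ CARD('n)) *
        (\<integral>z. \<psi> (x + (sqrt (s n) / pi) *\<^sub>R z) * fourier g (x + (sqrt (s n) / pi) *\<^sub>R z - x) \<partial>lborel)"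
      unfolding g_def gaussian_fourier[OF s] using s[of n] by (intro integral_lborel_scale) auto
    also have "\<dots> = complex_of_real ((sqrt (s n) / pi) ^ CARD('n)) *
        (\<integral>z. \<psi> (x + (sqrt (s n) / pi) *\<^sub>R z) *
          (complex_of_real (sqrt (pi / s n) ^ CARD('n)) * complex_of_real (exp (- (norm z)\<^sup>2))) \<partial>lborel)"
    proof -
      have "(pi\<^sup>2 * (norm (x + (sqrt (s n) / pi) *\<^sub>R z - x))\<^sup>2) / s n = (norm z)\<^sup>2" for z
        using s[of n] by (simp add: power_mult_distrib power_divide)
      then have "fourier g (x + (sqrt (s n) / pi) *\<^sub>R z - x)
          = complex_of_real (sqrt (pi / s n) ^ CARD('n)) * complex_of_real (exp (- (norm z)\<^sup>2))" for z
        unfolding g_def gaussian_fourier[OF s] by simp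
      then show ?thesis by simp
    qed
    also have "\<dots> = complex_of_real ((sqrt (s n) / pi) ^ CARD('n) * sqrt (pi / s n) ^ CARD('n)) *
        (\<integral>z. \<psi> (x + (sqrt (s n) / pi) *\<^sub>R z) * complex_of_real (exp (- (norm z)\<^sup>2)) \<partial>lborel)"
      by (simp only: mult.left_commute[of "\<psi> _"] integral_mult_right_zero of_real_mult mult.assoc)
    also have "(sqrt (s n) / pi) ^ CARD('n) * sqrt (pi / s n) ^ CARD('n) = inverse (sqrt pi) ^ CARD('n)"
      unfolding power_mult_distrib[symmetric] using s[of n]
      by (intro arg_cong[of _ _ "\<lambda>a. a ^ _"]) (simp add: real_sqrt_divide field_simps)
    finally show ?thesis by simp
  qed
  have "(\<lambda>n. \<integral>z. \<psi> (x + (sqrt (s n) / pi) *\<^sub>R z) * complex_of_real (exp (- (norm z)\<^sup>2)) \<partial>lborel)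
      \<longlonglongrightarrow> (\<integral>z. \<psi> x * complex_of_real (exp (- (norm (z::real^'n))\<^sup>2)) \<partial>lborel)"
  proof (rule integral_dominated_convergence)
    show "integrable lborel (\<lambda>z::real^'n. B * exp (- (norm z)\<^sup>2))"
      using gaussian_integrable[of 1, where 'n='n] by auto
    show "AE z in lborel. norm (\<psi> (x + (sqrt (s n) / pi) *\<^sub>R z) * complex_of_real (exp (- (norm z)\<^sup>2))) \<le> B * exp (- (norm z)\<^sup>2)" for n
      by (intro AE_I2) (simp add: norm_mult mult_right_mono \<psi>(2) del: of_real_exp)
    show "AE z in lborel. (\<lambda>n. \<psi> (x + (sqrt (s n) / pi) *\<^sub>R z) * complex_of_real (exp (- (norm z)\<^sup>2)))
        \<longlonglongrightarrow> \<psi> x * complex_of_real (exp (- (norm z)\<^sup>2))"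
    proof (intro AE_I2 tendsto_mult tendsto_const)
      fix z :: "real^'n"
      have "(\<lambda>n. x + (sqrt (s n) / pi) *\<^sub>R z) \<longlonglongrightarrow> x + (sqrt 0 / pi) *\<^sub>R z"
        by (intro tendsto_intros s0) auto
      then show "(\<lambda>n. \<psi> (x + (sqrt (s n) / pi) *\<^sub>R z)) \<longlonglongrightarrow> \<psi> x"
        using \<psi>(1) by (intro isCont_tendsto_compose[of x \<psi>]) (auto simp: continuous_on_eq_continuous_at)
    qed
  qed measurable
  then have "A \<longlonglongrightarrow> complex_of_real (inverse (sqrt pi) ^ CARD('n)) * (\<psi> x * complex_of_real (sqrt pi ^ CARD('n)))"
    unfolding A integral_mult_right_zero gaussian_total by (intro tendsto_mult tendsto_const)
  moreover have "complex_of_real (inverse (sqrt pi) ^ CARD('n)) * (\<psi> x * complex_of_real (sqrt pi ^ CARD('n))) = \<psi> x"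
    by (simp add: field_simps)
  ultimately show ?thesis using LIMSEQ_unique[OF lim1] by simp
qed

lemma schwartz_inversion:
  fixes \<psi> :: "real^'n::finite \<Rightarrow> complex"
  assumes \<psi>: "\<psi> \<in> schwartz"
  shows "inverse_fourier (fourier \<psi>) = \<psi>"
proof
  fix x
  obtain C where C: "\<And>x. norm (\<psi> x) \<le> C * decay_weight x"
    using schwartz_decay[OF \<psi>] by blast
  have "norm (\<psi> x) \<le> \<bar>C\<bar>" for x
  proof -
    have "norm (\<psi> x) \<le> \<bar>C\<bar> * decay_weight x"
      by (rule order_trans[OF C]) (intro mult_right_mono; simp)
    also have "\<dots> \<le> \<bar>C\<bar>" by (simp add: mult_left_le decay_weight_le_1)
    finally show ?thesis .
  qed
  then show "inverse_fourier (fourier \<psi>) x = \<psi> x"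
    by (intro fourier_inversion schwartz_continuous schwartz_integrable fourier_schwartz_integrable \<psi>)
qed

text \<open>Both sides have the same Fourier transform.\<close>

lemma partial_deriv_commute_schwartz:
  assumes \<psi>: "\<psi> \<in> schwartz"
  shows "partial_deriv i (partial_deriv j \<psi>) = partial_deriv j (partial_deriv i \<psi>)"
proof -
  have "fourier (partial_deriv i (partial_deriv j \<psi>)) = fourier (partial_deriv j (partial_deriv i \<psi>))"
    by (intro ext) (simp add: fourier_partial_deriv schwartz_partial_deriv \<psi>)
  then show ?thesis
    by (metis schwartz_inversion schwartz_partial_deriv \<psi>)
qed

lemma convol_eq_inverse_fourier:
  fixes k :: "real^'n::finite \<Rightarrow> complex"
  assumes k: "integrable lborel k" and \<eta>: "\<eta> \<in> schwartz"
  shows "convol (*) k \<eta> x = inverse_fourier (\<lambda>\<xi>. fourier k \<xi> * fourier \<eta> \<xi>) x"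
proof -
  have "convol (*) k \<eta> x = (\<integral>y. k y * inverse_fourier (fourier \<eta>) (x - y) \<partial>lborel)"
    by (simp add: convol_def schwartz_inversion \<eta>)
  also have "\<dots> = (\<integral>y. k y * (\<integral>\<xi>. fourier \<eta> \<xi> * cis (2 * pi * (x \<bullet> \<xi>)) * cis (- 2 * pi * (y \<bullet> \<xi>)) \<partial>lborel) \<partial>lborel)"
  proof -
    have "cis (2 * pi * ((x - y) \<bullet> \<xi>)) = cis (2 * pi * (x \<bullet> \<xi>)) * cis (- 2 * pi * (y \<bullet> \<xi>))" for y \<xi>
      by (simp add: cis_mult inner_diff_left algebra_simps)
    then show ?thesis unfolding inverse_fourier_cis by (simp only: mult.assoc)
  qed
  also have "\<dots> = (\<integral>\<xi>. fourier \<eta> \<xi> * cis (2 * pi * (x \<bullet> \<xi>)) * (\<integral>y. k y * cis (- 2 * pi * (y \<bullet> \<xi>)) \<partial>lborel) \<partial>lborel)"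
    by (rule Fubini_bounded_kernel(2)[OF k integrable_mult_cis(1)[OF fourier_schwartz_integrable[OF \<eta>]], where B=1]) auto
  also have "\<dots> = inverse_fourier (\<lambda>\<xi>. fourier k \<xi> * fourier \<eta> \<xi>) x"
    unfolding inverse_fourier_cis fourier_cis[of k] by (simp add: mult_ac)
  finally show ?thesis .
qed

lemma integrable_convol_L1:
  fixes k :: "real^'n::finite \<Rightarrow> complex"
  assumes k: "integrable lborel k" and \<eta>: "integrable lborel \<eta>"
  shows "integrable lborel (convol (*) k \<eta>)"
proof -
  have [measurable]: "k \<in> borel_measurable borel" "\<eta> \<in> borel_measurable borel"
    using borel_measurable_integrable[OF k] borel_measurable_integrable[OF \<eta>] by auto
  have "integrable (lborel \<Otimes>\<^sub>M lborel) (\<lambda>(y,x). k y * \<eta> (x - y))"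
  proof (rule lborel_pair.Fubini_integrable)
    have "(\<integral>x. norm (\<eta> (x - y)) \<partial>lborel) = (\<integral>x. norm (\<eta> x) \<partial>lborel)" for y
      using integral_lborel_plus[of "\<lambda>x. norm (\<eta> x)" "- y"] by simp
    then show "integrable lborel (\<lambda>y. LINT x|lborel. norm (case (y, x) of (y, x) \<Rightarrow> k y * \<eta> (x - y)))"
      using k by (simp add: norm_mult)
    show "AE y in lborel. integrable lborel (\<lambda>x. case (y, x) of (y, x) \<Rightarrow> k y * \<eta> (x - y))"
      using integrable_lborel_plus[OF \<eta>, of "- _"] by simp
  qed measurable
  from lborel_pair.integrable_snd[OF this] show ?thesis
    by (simp add: convol_def[abs_def])
qed

section \<open>Gamma integrals\<close>

lemma has_bochner_integral_Gamma:
  fixes a p :: real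
  assumes "a > 0" "p > 0"
  shows "has_bochner_integral lborel (\<lambda>t. indicator {0<..} t * (t powr (p - 1) * exp (- (a * t)))) (Gamma p / a powr p)"
proof -
  have "has_bochner_integral lborel (\<lambda>t. indicator {0..} t * t powr (p - 1) / exp t) (Gamma p)"
  proof (rule has_bochner_integral_nn_integral)
    show "(\<integral>\<^sup>+ t. ennreal (indicator {0..} t * t powr (p - 1) / exp t) \<partial>lborel) = ennreal (Gamma p)"
      using Gamma_conv_nn_integral_real[OF \<open>p > 0\<close>] by simp
  qed (use \<open>p > 0\<close> in \<open>auto intro!: less_imp_le Gamma_real_pos\<close>)
  moreover have "(\<lambda>t. indicator {0..} t * t powr (p - 1) / exp t) = (\<lambda>t::real. indicator {0<..} t * (t powr (p - 1) * exp (- t)))"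
    by (auto simp: fun_eq_iff indicator_def exp_minus divide_inverse)
  ultimately have "has_bochner_integral lborel (\<lambda>t. indicator {0<..} t * (t powr (p - 1) * exp (- t))) (Gamma p)"
    by simp
  then have "has_bochner_integral lborel (\<lambda>t. indicator {0<..} (0 + a * t) * ((0 + a * t) powr (p - 1) * exp (- (0 + a * t)))) (Gamma p /\<^sub>R \<bar>a\<bar>)"
    using assms by (subst (asm) lborel_has_bochner_integral_real_affine_iff[of a _ _ 0]) auto
  then have "has_bochner_integral lborel (\<lambda>t. (1 / a powr (p - 1)) * (indicator {0<..} (0 + a * t) * ((0 + a * t) powr (p - 1) * exp (- (0 + a * t)))))
      ((1 / a powr (p - 1)) * (Gamma p /\<^sub>R \<bar>a\<bar>))"
    by (intro has_bochner_integral_mult_right) auto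
  moreover have "(1 / a powr (p - 1)) * (indicator {0<..} (0 + a * t) * ((0 + a * t) powr (p - 1) * exp (- (0 + a * t))))
      = indicator {0<..} t * (t powr (p - 1) * exp (- (a * t)))" for t
    using assms by (auto simp: indicator_def powr_mult zero_less_mult_iff)
  moreover have "(1 / a powr (p - 1)) * (Gamma p /\<^sub>R \<bar>a\<bar>) = Gamma p / a powr p"
    using assms by (simp add: powr_diff field_simps)
  ultimately show ?thesis by simp
qed

lemma absolutely_integrable_iff_has_bochner_integral:
  fixes f :: "real \<Rightarrow> real"
  assumes [measurable]: "f \<in> borel_measurable borel" "S \<in> sets borel"
  shows "f absolutely_integrable_on S \<and> integral S f = b \<longleftrightarrow> has_bochner_integral lborel (\<lambda>t. indicator S t * f t) b"
proof -
  have m: "(\<lambda>t. indicator S t *\<^sub>R f t) \<in> borel_measurable lborel" by measurable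
  have "f absolutely_integrable_on S \<longleftrightarrow> integrable lborel (\<lambda>t. indicator S t * f t)"
    unfolding set_integrable_def using integrable_completion[OF m] by simp
  moreover have "integral S f = (\<integral>t. indicator S t * f t \<partial>lborel)" if "f absolutely_integrable_on S"
    using set_lebesgue_integral_eq_integral(2)[OF that] integral_completion[OF m]
    by (simp add: set_lebesgue_integral_def)
  ultimately show ?thesis unfolding has_bochner_integral_iff by metis
qed

text \<open>The substitution \<open>t \<mapsto> 1 / t\<close> in the Gamma integral.\<close>

lemma has_bochner_integral_inverse_Gamma:
  fixes a p :: real
  assumes "a > 0" "p > 0"
  shows "has_bochner_integral lborel (\<lambda>t. indicator {0<..} t * (t powr (- p - 1) * exp (- (a / t)))) (Gamma p / a powr p)"
proof -
  define f where "f t = t powr (p - 1) * exp (- (a * t))" for t :: real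
  have "f absolutely_integrable_on {0<..} \<and> integral {0<..} f = Gamma p / a powr p"
    using has_bochner_integral_Gamma[OF assms]
    by (subst absolutely_integrable_iff_has_bochner_integral) (auto simp: f_def[abs_def])
  moreover have im: "(\<lambda>t. 1 / t) ` {0<..} = {(0::real)<..}"
    by (auto intro!: image_eqI[of _ _ "1 / _"])
  ultimately have "(\<lambda>t. \<bar>- 1 / t\<^sup>2\<bar> * f (1 / t)) absolutely_integrable_on {0<..} \<and>
      integral {0<..} (\<lambda>t. \<bar>- 1 / t\<^sup>2\<bar> * f (1 / t)) = Gamma p / a powr p"
    by (subst has_absolute_integral_change_of_variables_1')
       (auto intro!: derivative_eq_intros simp: inj_on_def power2_eq_square)
  then have "has_bochner_integral lborel (\<lambda>t. indicator {0<..} t * (\<bar>- 1 / t\<^sup>2\<bar> * f (1 / t))) (Gamma p / a powr p)"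
    by (subst (asm) absolutely_integrable_iff_has_bochner_integral) (auto simp: f_def[abs_def])
  moreover have "indicator {0<..} t * (\<bar>- 1 / t\<^sup>2\<bar> * f (1 / t)) = indicator {0<..} t * (t powr (- p - 1) * exp (- (a / t)))" for t
  proof (cases "t > 0")
    case True
    then have "\<bar>- 1 / t\<^sup>2\<bar> * (1 / t) powr (p - 1) = t powr (- p - 1)"
      by (simp add: powr_diff powr_divide powr_minus power2_eq_square field_simps)
    then show ?thesis using True by (simp add: f_def mult.assoc[symmetric])
  qed simp
  ultimately show ?thesis by simp
qed

section \<open>The square root of the Laplacian as a convolution\<close>

text \<open>The fundamental solution of the heat equation at time \<open>s\<close>; its Fourier transform is
  \<open>exp (- s * (2 * pi * norm \<xi>)\<^sup>2)\<close>.\<close>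

definition heat_kernel :: "real \<Rightarrow> real^'n::finite \<Rightarrow> real" where
  "heat_kernel s x = sqrt (1 / (4 * pi * s)) ^ CARD('n) * exp (- (1 / (4 * s)) * (norm x)\<^sup>2)"

lemma heat_kernel_nonneg: "s > 0 \<Longrightarrow> 0 \<le> heat_kernel s x"
  unfolding heat_kernel_def by simp

lemma measurable_heat_kernel [measurable]:
  "(\<lambda>(s, x). heat_kernel s (x::real^'n::finite)) \<in> borel_measurable (borel \<Otimes>\<^sub>M borel)"
  unfolding heat_kernel_def[abs_def] by measurable

lemma heat_kernel_integrable: "s > 0 \<Longrightarrow> integrable lborel (heat_kernel s :: real^'n::finite \<Rightarrow> real)"
  unfolding heat_kernel_def[abs_def] by (intro integrable_mult_right gaussian_integrable) auto

lemma fourier_heat_kernel: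
  fixes \<xi> :: "real^'n::finite"
  assumes "s > 0"
  shows "fourier (\<lambda>x. complex_of_real (heat_kernel s x)) \<xi> = complex_of_real (exp (- s * (2 * pi * norm \<xi>)\<^sup>2))"
proof -
  have "fourier (\<lambda>x. complex_of_real (heat_kernel s x)) \<xi>
      = complex_of_real (sqrt (1 / (4 * pi * s)) ^ CARD('n)) *
        fourier (\<lambda>x. complex_of_real (exp (- (1 / (4 * s)) * (norm x)\<^sup>2))) \<xi>"
    unfolding heat_kernel_def fourier_def of_real_mult mult.assoc by (rule integral_mult_right_zero)
  also have "\<dots> = complex_of_real (sqrt (1 / (4 * pi * s)) ^ CARD('n)) *
      complex_of_real (sqrt (pi / (1 / (4 * s))) ^ CARD('n) * exp (- (pi\<^sup>2 * (norm \<xi>)\<^sup>2) / (1 / (4 * s))))"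
    using assms by (subst gaussian_fourier) auto
  also have "\<dots> = complex_of_real ((sqrt (1 / (4 * pi * s)) * sqrt (pi / (1 / (4 * s)))) ^ CARD('n) *
      exp (- (pi\<^sup>2 * (norm \<xi>)\<^sup>2) / (1 / (4 * s))))"
    unfolding power_mult_distrib of_real_mult by (simp only: mult.assoc)
  also have "sqrt (1 / (4 * pi * s)) * sqrt (pi / (1 / (4 * s))) = 1"
    unfolding real_sqrt_mult[symmetric] using assms by simp
  also have "- (pi\<^sup>2 * (norm \<xi>)\<^sup>2) / (1 / (4 * s)) = - s * (2 * pi * norm \<xi>)\<^sup>2"
    by (simp add: power_mult_distrib)
  finally show ?thesis by simp
qed

lemma heat_kernel_total: "s > 0 \<Longrightarrow> (\<integral>x. heat_kernel s (x::real^'n::finite) \<partial>lborel) = 1"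
proof -
  assume "s > 0"
  then have "complex_of_real (\<integral>x. heat_kernel s (x::real^'n) \<partial>lborel) = complex_of_real 1"
    using fourier_heat_kernel[of s "0::real^'n"] by (simp add: fourier_cis)
  then show ?thesis by (simp only: of_real_eq_iff)
qed

text \<open>Heat kernels are nonnegative with integral one, so integrating them against an integrable weight gives an
  integrable kernel, and its Fourier transform is the Laplace transform of the weight at
  \<open>(2 * pi * norm \<xi>)\<^sup>2\<close>.\<close>

lemma heat_mixture:
  fixes w :: "real \<Rightarrow> real"
  assumes w: "integrable lborel w" and w0: "\<And>s. s \<le> 0 \<Longrightarrow> w s = 0"
  defines "k \<equiv> (\<lambda>x::real^'n::finite. complex_of_real (\<integral>s. w s * heat_kernel s x \<partial>lborel))"
  shows "integrable lborel k"
    and "fourier k \<xi> = complex_of_real (\<integral>s. w s * exp (- s * (2 * pi * norm \<xi>)\<^sup>2) \<partial>lborel)"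
proof -
  have [measurable]: "w \<in> borel_measurable borel" using borel_measurable_integrable[OF w] by simp
  have int: "integrable (lborel \<Otimes>\<^sub>M lborel) (\<lambda>(s, x::real^'n). complex_of_real (w s * heat_kernel s x))"
  proof (rule lborel_pair.Fubini_integrable)
    have "(\<integral>x. norm (complex_of_real (w s * heat_kernel s (x::real^'n))) \<partial>lborel) = norm (w s)" for s
    proof (cases "s > 0")
      case True
      then have "norm (complex_of_real (w s * heat_kernel s x)) = norm (w s) * heat_kernel s (x::real^'n)" for x
        unfolding norm_of_real by (simp add: abs_mult heat_kernel_nonneg)
      then show ?thesis using True heat_kernel_total[of s, where 'n='n] by (simp only:) simp
    qed (simp add: w0)
    then show "integrable lborel (\<lambda>s. LINT x|lborel. norm (case (s, x::real^'n) of (s, x) \<Rightarrow> complex_of_real (w s * heat_kernel s x)))"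
      using w by simp
    have "integrable lborel (\<lambda>x::real^'n. complex_of_real (w s * heat_kernel s x))" for s
      using heat_kernel_integrable[of s, where 'n='n] w0[of s] by (cases "s > 0") (simp_all add: complex_of_real_integrable_eq)
    then show "AE s in lborel. integrable lborel (\<lambda>x::real^'n. case (s, x) of (s, x) \<Rightarrow> complex_of_real (w s * heat_kernel s x))"
      by simp
  qed measurable
  show "integrable lborel k"
    using lborel_pair.integrable_snd[OF int] by (simp only: k_def integral_complex_of_real)
  have int': "integrable (lborel \<Otimes>\<^sub>M lborel) (\<lambda>(s, x::real^'n). complex_of_real (w s * heat_kernel s x) * cis (- 2 * pi * (x \<bullet> \<xi>)))"
  proof -
    have "integrable (lborel \<Otimes>\<^sub>M lborel) (\<lambda>z. (case z of (s, x::real^'n) \<Rightarrow> complex_of_real (w s * heat_kernel s x))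
        * (case z of (s, x) \<Rightarrow> cis (- 2 * pi * (x \<bullet> \<xi>))))"
      by (rule integrable_mult_bounded[OF int, where B=1]) auto
    then show ?thesis by (simp add: case_prod_beta')
  qed
  have "fourier k \<xi> = (\<integral>x. (\<integral>s. complex_of_real (w s * heat_kernel s x) * cis (- 2 * pi * (x \<bullet> \<xi>)) \<partial>lborel) \<partial>lborel)"
    by (simp only: k_def fourier_cis integral_mult_left_zero integral_complex_of_real)
  also have "\<dots> = (\<integral>s. (\<integral>x. complex_of_real (w s * heat_kernel s x) * cis (- 2 * pi * (x \<bullet> \<xi>)) \<partial>lborel) \<partial>lborel)"
    by (rule lborel_pair.Fubini_integral[OF int'])
  also have "\<dots> = (\<integral>s. complex_of_real (w s * exp (- s * (2 * pi * norm \<xi>)\<^sup>2)) \<partial>lborel)"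
  proof (rule Bochner_Integration.integral_cong[OF refl])
    fix s
    have "(\<integral>x. complex_of_real (w s * heat_kernel s x) * cis (- 2 * pi * (x \<bullet> \<xi>)) \<partial>lborel)
        = complex_of_real (w s) * fourier (\<lambda>x. complex_of_real (heat_kernel s x)) \<xi>"
      unfolding fourier_cis of_real_mult mult.assoc by simp
    then show "(\<integral>x. complex_of_real (w s * heat_kernel s x) * cis (- 2 * pi * (x \<bullet> \<xi>)) \<partial>lborel)
        = complex_of_real (w s * exp (- s * (2 * pi * norm \<xi>)\<^sup>2))"
      using fourier_heat_kernel[of s \<xi>] w0[of s] by (cases "s > 0") simp_all
  qed
  finally show "fourier k \<xi> = complex_of_real (\<integral>s. w s * exp (- s * (2 * pi * norm \<xi>)\<^sup>2) \<partial>lborel)"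
    by (simp only: integral_complex_of_real)
qed

text \<open>The identity \<open>sqrt a = a * \<integral> s powr (- 1 / 2) * exp (- s * a) / sqrt \<pi>\<close> over \<open>s > 0\<close> has a weight that is not
  integrable at infinity.  Its part on \<open>{0<..1}\<close> is kept as \<open>short_weight\<close>; on \<open>{1<..}\<close>, integrating by parts
  replaces it by its negative derivative \<open>long_weight\<close> and absorbs the factor \<open>a\<close>.\<close>

definition short_weight :: "real \<Rightarrow> real" where
  "short_weight s = indicator {0<..1} s * (s powr (- 1 / 2) / sqrt pi)"

definition long_weight :: "real \<Rightarrow> real" where
  "long_weight s = indicator {1<..} s * (s powr (- 3 / 2) / (2 * sqrt pi))"

lemma measurable_weights [measurable]:
  "short_weight \<in> borel_measurable borel" "long_weight \<in> borel_measurable borel"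
  unfolding short_weight_def[abs_def] long_weight_def[abs_def] by measurable

lemma integrable_short_weight: "integrable lborel short_weight"
proof (rule Bochner_Integration.integrable_bound)
  show "integrable lborel (\<lambda>t::real. exp 1 / sqrt pi * (indicator {0<..} t * (t powr (1 / 2 - 1) * exp (- (1 * t)))))"
    using has_bochner_integral_Gamma[of 1 "1 / 2"] unfolding has_bochner_integral_iff by (intro integrable_mult_right) auto
  have "exp 1 * exp (- t) \<ge> (1::real)" if "t \<le> 1" for t
    using that by (simp flip: exp_add)
  then have "s powr (- 1 / 2) \<le> exp 1 * (s powr (- 1 / 2) * exp (- s))" if "s \<le> 1" for s :: real
    using that mult_left_mono[of 1 "exp 1 * exp (- s)" "s powr (- 1 / 2)"] by (simp add: mult_ac)
  then show "AE s in lborel. norm (short_weight s) \<le> norm (exp 1 / sqrt pi * (indicator {0<..} s * (s powr (1 / 2 - 1) * exp (- (1 * s)))))"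
    by (intro AE_I2) (auto simp: short_weight_def indicator_def divide_right_mono)
qed measurable

lemma has_bochner_integral_long_weight: "has_bochner_integral lborel long_weight (1 / sqrt pi)"
proof (rule has_bochner_integral_nn_integral)
  have "(\<integral>\<^sup>+s. ennreal (s powr (- 3 / 2) / (2 * sqrt pi)) * indicator {1..} s \<partial>lborel) = ennreal (0 - (- (1 powr (- 1 / 2)) / sqrt pi))"
  proof (rule nn_integral_FTC_atLeast[where F = "\<lambda>s. - (s powr (- 1 / 2)) / sqrt pi"])
    show "((\<lambda>s. - (s powr (- 1 / 2)) / sqrt pi) has_real_derivative s powr (- 3 / 2) / (2 * sqrt pi)) (at s)" if "1 \<le> s" for s
    proof -
      have "((\<lambda>s. - (s powr (- 1 / 2))) has_real_derivative - ((- 1 / 2) * s powr (- 1 / 2 - 1))) (at s)"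
        using that by (intro DERIV_minus has_real_derivative_powr) auto
      from DERIV_cdivide[OF this, of "sqrt pi"] show ?thesis by (simp add: mult.commute)
    qed
    have "((\<lambda>s::real. s powr (- 1 / 2)) \<longlongrightarrow> 0) at_top"
      by (rule tendsto_neg_powr) (auto intro: filterlim_ident)
    from tendsto_divide[OF tendsto_minus[OF this] tendsto_const[of "sqrt pi"]]
    show "((\<lambda>s. - (s powr (- 1 / 2)) / sqrt pi) \<longlongrightarrow> 0) at_top" by simp
  qed auto
  also have "(\<integral>\<^sup>+s. ennreal (s powr (- 3 / 2) / (2 * sqrt pi)) * indicator {1..} s \<partial>lborel) = (\<integral>\<^sup>+s. ennreal (long_weight s) \<partial>lborel)"
  proof (rule nn_integral_cong_AE)
    show "AE s in lborel. ennreal (s powr (- 3 / 2) / (2 * sqrt pi)) * indicator {1..} s = ennreal (long_weight s)"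
      using AE_lborel_singleton[of "1::real"]
      by eventually_elim (simp add: long_weight_def indicator_def)
  qed
  finally show "(\<integral>\<^sup>+s. ennreal (long_weight s) \<partial>lborel) = ennreal (1 / sqrt pi)" by simp
qed (auto simp: long_weight_def)

lemma integrable_mult_exp_decay:
  fixes w :: "real \<Rightarrow> real"
  assumes w: "integrable lborel w" and w0: "\<And>s. s \<le> 0 \<Longrightarrow> w s = 0" and a: "a \<ge> 0"
  shows "integrable lborel (\<lambda>s. w s * exp (- s * a))"
proof (rule Bochner_Integration.integrable_bound[OF w])
  show "(\<lambda>s. w s * exp (- s * a)) \<in> borel_measurable lborel"
    using borel_measurable_integrable[OF w] by measurable
  show "AE s in lborel. norm (w s * exp (- s * a)) \<le> norm (w s)"
  proof (intro AE_I2)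
    fix s
    show "norm (w s * exp (- s * a)) \<le> norm (w s)"
      using w0[of s] a by (cases "s > 0") (simp_all add: abs_mult mult_left_le)
  qed
qed

lemma sqrt_as_Laplace_transforms:
  fixes a :: real
  assumes a: "a \<ge> 0"
  shows "sqrt a = a * (\<integral>s. short_weight s * exp (- s * a) \<partial>lborel) +
     (exp (- a) / sqrt pi - (\<integral>s. long_weight s * exp (- s * a) \<partial>lborel))"
proof (cases "a = 0")
  case True
  then show ?thesis using has_bochner_integral_long_weight by (simp add: has_bochner_integral_iff)
next
  case False
  with a have a: "a > 0" by simp
  define m where "m s = indicator {0<..} s * (s powr (1 / 2 - 1) * exp (- (a * s)))" for s :: real
  have m: "has_bochner_integral lborel m (sqrt pi / sqrt a)"
    using has_bochner_integral_Gamma[OF a, of "1 / 2"] a unfolding m_def by (simp add: Gamma_one_half_real powr_half_sqrt)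
  have iw: "integrable lborel (\<lambda>s. short_weight s * exp (- s * a))" "integrable lborel (\<lambda>s. long_weight s * exp (- s * a))"
  proof -
    have "integrable lborel long_weight"
      using has_bochner_integral_long_weight by (simp add: has_bochner_integral_iff)
    moreover have "short_weight s = 0" "long_weight s = 0" if "s \<le> 0" for s
      using that by (auto simp: short_weight_def long_weight_def)
    ultimately show "integrable lborel (\<lambda>s. short_weight s * exp (- s * a))" "integrable lborel (\<lambda>s. long_weight s * exp (- s * a))"
      using a by (intro integrable_mult_exp_decay integrable_short_weight; simp)+
  qed
  \<comment> \<open>An antiderivative of the difference of the integrands on \<open>{1<..}\<close> before and after integration by parts; it vanishes at \<open>1\<close> and at infinity.\<close>
  define F where "F s = s powr (- 1 / 2) * (exp (- s * a) - exp (- a)) / sqrt pi" for s :: real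
  define f where "f s = s powr (- 3 / 2) / (2 * sqrt pi) * (exp (- a) - exp (- s * a)) - a / sqrt pi * (s powr (- 1 / 2) * exp (- s * a))" for s :: real
  have feq: "indicator {1<..} s * f s = exp (- a) * long_weight s - long_weight s * exp (- s * a)
      - (a / sqrt pi * m s - a * (short_weight s * exp (- s * a)))" for s
  proof -
    have "m s = indicator {0<..} s * (s powr (- 1 / 2) * exp (- s * a))"
      by (simp only: m_def mult.commute[of a s] mult_minus_left) simp
    then show ?thesis
      by (cases "s \<le> 0"; cases "s \<le> 1") (simp_all add: f_def long_weight_def short_weight_def left_diff_distrib right_diff_distrib diff_divide_distrib mult_ac)
  qed
  have fint: "has_bochner_integral lborel (\<lambda>s. indicator {1<..} s * f s)
      (exp (- a) * (1 / sqrt pi) - (\<integral>s. long_weight s * exp (- s * a) \<partial>lborel)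
      - (a / sqrt pi * (sqrt pi / sqrt a) - a * (\<integral>s. short_weight s * exp (- s * a) \<partial>lborel)))"
    unfolding feq by (intro has_bochner_integral_diff has_bochner_integral_mult_right m
      has_bochner_integral_long_weight has_bochner_integral_integrable iw)
  have "(LBINT s=ereal 1..\<infinity>. f s) = 0 - F 1"
  proof (rule interval_integral_FTC_integrable)
    show "(F has_vector_derivative f s) (at s)" if "ereal 1 < ereal s" for s
    proof -
      have "((\<lambda>s. s powr (- 1 / 2) * (exp (- s * a) - exp (- a))) has_real_derivative
          (- 1 / 2) * s powr (- 1 / 2 - 1) * (exp (- s * a) - exp (- a)) + (exp (- s * a) * (- 1 * a) - 0) * s powr (- 1 / 2)) (at s)"
        using that by (intro DERIV_mult has_real_derivative_powr DERIV_diff DERIV_const DERIV_chain2[OF DERIV_exp] DERIV_cmult_right DERIV_minus DERIV_ident) auto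
      from DERIV_cdivide[OF this, of "sqrt pi"] have "(F has_real_derivative f s) (at s)"
        unfolding F_def f_def
      proof (rule DERIV_cong)
        have "((- 1 / 2) * P * (E - A) + (E * (- 1 * a) - 0) * Q) / c = P / (2 * c) * (A - E) - a / c * (Q * E)"
          for P Q E A c :: real
          by (simp add: add_divide_distrib diff_divide_distrib algebra_simps)
        moreover have "- 1 / 2 - 1 = (- 3 / 2 :: real)" by simp
        ultimately show "((- 1 / 2) * s powr (- 1 / 2 - 1) * (exp (- s * a) - exp (- a)) + (exp (- s * a) * (- 1 * a) - 0) * s powr (- 1 / 2)) / sqrt pi
          = s powr (- 3 / 2) / (2 * sqrt pi) * (exp (- a) - exp (- s * a)) - a / sqrt pi * (s powr (- 1 / 2) * exp (- s * a))"
          by (simp only:)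
      qed
      then show ?thesis by (simp add: has_real_derivative_iff_has_vector_derivative)
    qed
    show "isCont f s" if "ereal 1 < ereal s" for s
      using that unfolding f_def by (intro continuous_intros) auto
    have "einterval (ereal 1) \<infinity> = {1<..}" by (auto simp: einterval_def)
    then show "set_integrable lborel (einterval (ereal 1) \<infinity>) f"
      using fint by (simp add: set_integrable_def has_bochner_integral_iff)
    have "isCont F 1" unfolding F_def by (intro continuous_intros) auto
    then show "((F \<circ> real_of_ereal) \<longlongrightarrow> F 1) (at_right (ereal 1))"
      unfolding ereal_tendsto_simps by (auto simp: isCont_def intro: filterlim_mono at_le)
    have "((\<lambda>s::real. s powr (- 1 / 2)) \<longlongrightarrow> 0) at_top"
      by (rule tendsto_neg_powr) (auto intro: filterlim_ident)
    moreover have "((\<lambda>s. exp (- s * a) - exp (- a)) \<longlongrightarrow> 0 - exp (- a)) at_top"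
    proof (intro tendsto_intros filterlim_compose[OF exp_at_bot])
      show "filterlim (\<lambda>s. - s * a) at_bot at_top"
        using filterlim_tendsto_neg_mult_at_bot[OF tendsto_const[of "- a"] _ filterlim_ident] a by (simp add: mult.commute)
    qed
    ultimately have "((\<lambda>s. s powr (- 1 / 2) * (exp (- s * a) - exp (- a)) / sqrt pi) \<longlongrightarrow> 0 * (0 - exp (- a)) / sqrt pi) at_top"
      by (rule tendsto_divide[OF tendsto_mult tendsto_const]) simp
    then show "((F \<circ> real_of_ereal) \<longlongrightarrow> 0) (at_left \<infinity>)"
      unfolding ereal_tendsto_simps F_def by simp
  qed auto
  also have "F 1 = 0" by (simp add: F_def)
  finally have "(\<integral>s. indicator {1<..} s * f s \<partial>lborel) = 0"
    by (simp add: interval_lebesgue_integral_def einterval_def set_lebesgue_integral_def greaterThan_def)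
  moreover have "a / sqrt pi * (sqrt pi / sqrt a) = sqrt a"
    using a by (simp add: real_div_sqrt)
  ultimately show ?thesis
    using fint unfolding has_bochner_integral_iff by simp
qed

text \<open>The boundary term of the integration by parts, \<open>exp (- a) / sqrt pi\<close>, is the transform of a multiple of the heat
  kernel at time \<open>1\<close>.\<close>

lemma sqrt_laplacian_kernels:
  obtains k1 k2 :: "real^'n::finite \<Rightarrow> complex"
  where "integrable lborel k1" "integrable lborel k2"
    "\<And>\<xi>. complex_of_real (2 * pi * norm \<xi>) = complex_of_real ((2 * pi * norm \<xi>)\<^sup>2) * fourier k1 \<xi> + fourier k2 \<xi>"
proof -
  define k1 where "k1 x = complex_of_real (\<integral>s. short_weight s * heat_kernel s x \<partial>lborel)" for x :: "real^'n"
  define k3 where "k3 x = complex_of_real (\<integral>s. long_weight s * heat_kernel s x \<partial>lborel)" for x :: "real^'n"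
  define g where "g x = complex_of_real (1 / sqrt pi) * complex_of_real (heat_kernel 1 x)" for x :: "real^'n"
  have w0: "short_weight s = 0" "long_weight s = 0" if "s \<le> 0" for s
    using that by (auto simp: short_weight_def long_weight_def)
  have lw: "integrable lborel long_weight"
    using has_bochner_integral_long_weight by (simp add: has_bochner_integral_iff)
  have k1: "integrable lborel k1" "\<And>\<xi>. fourier k1 \<xi> = complex_of_real (\<integral>s. short_weight s * exp (- s * (2 * pi * norm \<xi>)\<^sup>2) \<partial>lborel)"
    unfolding k1_def by (intro heat_mixture integrable_short_weight w0; assumption)+
  have k3: "integrable lborel k3" "\<And>\<xi>. fourier k3 \<xi> = complex_of_real (\<integral>s. long_weight s * exp (- s * (2 * pi * norm \<xi>)\<^sup>2) \<partial>lborel)"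
    unfolding k3_def by (intro heat_mixture lw w0; assumption)+
  have g: "integrable lborel g"
    unfolding g_def by (intro integrable_mult_right) (simp add: complex_of_real_integrable_eq heat_kernel_integrable)
  have Fg: "fourier g \<xi> = complex_of_real (exp (- (2 * pi * norm \<xi>)\<^sup>2) / sqrt pi)" for \<xi>
    using fourier_heat_kernel[of 1 \<xi>] unfolding g_def fourier_def mult.assoc by simp
  have "complex_of_real (2 * pi * norm \<xi>) = complex_of_real ((2 * pi * norm \<xi>)\<^sup>2) * fourier k1 \<xi> + fourier (\<lambda>x. g x - k3 x) \<xi>" for \<xi>
  proof -
    have "fourier (\<lambda>x. g x - k3 x) \<xi> = fourier g \<xi> - fourier k3 \<xi>"
      unfolding fourier_cis left_diff_distrib
      by (intro Bochner_Integration.integral_diff integrable_mult_cis g k3)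
    moreover have "2 * pi * norm \<xi> = (2 * pi * norm \<xi>)\<^sup>2 * (\<integral>s. short_weight s * exp (- s * (2 * pi * norm \<xi>)\<^sup>2) \<partial>lborel) +
        (exp (- (2 * pi * norm \<xi>)\<^sup>2) / sqrt pi - (\<integral>s. long_weight s * exp (- s * (2 * pi * norm \<xi>)\<^sup>2) \<partial>lborel))"
      using sqrt_as_Laplace_transforms[of "(2 * pi * norm \<xi>)\<^sup>2"] by (simp add: real_sqrt_abs)
    from arg_cong[OF this, of complex_of_real] have "complex_of_real (2 * pi * norm \<xi>) =
        complex_of_real ((2 * pi * norm \<xi>)\<^sup>2) * fourier k1 \<xi> + (fourier g \<xi> - fourier k3 \<xi>)"
      unfolding k1(2) k3(2) Fg by (simp only: of_real_add of_real_mult of_real_diff)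
    ultimately show ?thesis by simp
  qed
  then show ?thesis
    using that[of k1 "\<lambda>x. g x - k3 x"] k1(1) k3(1) g by (auto intro: Bochner_Integration.integrable_diff)
qed

lemma frac_laplacian_half:
  "frac_laplacian (1 / 2) \<psi> = inverse_fourier (\<lambda>\<xi>. complex_of_real (2 * pi * norm \<xi>) * fourier \<psi> \<xi>)"
  unfolding frac_laplacian_def inverse_fourier_def
  by (simp add: fun_eq_iff mult.assoc flip: integral_mult_right_zero)

text \<open>The kernels do not depend on \<open>\<eta>\<close>, so derivatives of \<open>\<eta>\<close> are covered by the same representation.\<close>

lemma frac_laplacian_half_convol:
  obtains k1 k2 :: "real^'n::finite \<Rightarrow> complex"
  where "integrable lborel k1" "integrable lborel k2"
    "\<And>\<eta>. \<eta> \<in> schwartz \<Longrightarrow> frac_laplacian (1 / 2) \<eta> =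
      (\<lambda>x. convol (*) k2 \<eta> x - (\<Sum>i\<in>UNIV. convol (*) k1 (partial_deriv i (partial_deriv i \<eta>)) x))"
proof -
  obtain k1 k2 :: "real^'n \<Rightarrow> complex" where k: "integrable lborel k1" "integrable lborel k2"
    and eq: "\<And>\<xi>. complex_of_real (2 * pi * norm \<xi>) = complex_of_real ((2 * pi * norm \<xi>)\<^sup>2) * fourier k1 \<xi> + fourier k2 \<xi>"
    using sqrt_laplacian_kernels by blast
  have "frac_laplacian (1 / 2) \<eta> x = convol (*) k2 \<eta> x - (\<Sum>i\<in>UNIV. convol (*) k1 (partial_deriv i (partial_deriv i \<eta>)) x)"
    if \<eta>: "\<eta> \<in> schwartz" for \<eta> x
  proof -
    have int: "integrable lborel (\<lambda>\<xi>. fourier k \<xi> * fourier \<phi> \<xi> * cis (2 * pi * (x \<bullet> \<xi>)))"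
      if "integrable lborel k" "\<phi> \<in> schwartz" for k \<phi> :: "real^'n \<Rightarrow> complex"
    proof -
      have "fourier k \<in> borel_measurable lborel"
        using measurable_fourier[of k] borel_measurable_integrable[OF that(1)] by simp
      then have "integrable lborel (\<lambda>\<xi>. fourier \<phi> \<xi> * fourier k \<xi>)"
        by (intro integrable_mult_bounded[where B="\<integral>x. norm (k x) \<partial>lborel"] fourier_schwartz_integrable that norm_fourier_le)
      then show ?thesis by (intro integrable_mult_cis) (simp add: mult.commute)
    qed
    have "(\<Sum>i\<in>UNIV. fourier (partial_deriv i (partial_deriv i \<eta>)) \<xi>) = - complex_of_real ((2 * pi * norm \<xi>)\<^sup>2) * fourier \<eta> \<xi>" for \<xi>
    proof -
      have "fourier (partial_deriv i (partial_deriv i \<eta>)) \<xi> = - (complex_of_real ((2 * pi)\<^sup>2) * fourier \<eta> \<xi>) * complex_of_real ((\<xi> $ i)\<^sup>2)" for i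
        by (simp add: fourier_partial_deriv schwartz_partial_deriv \<eta> power2_eq_square mult_ac)
      then have "(\<Sum>i\<in>UNIV. fourier (partial_deriv i (partial_deriv i \<eta>)) \<xi>)
          = - (complex_of_real ((2 * pi)\<^sup>2) * fourier \<eta> \<xi>) * complex_of_real ((norm \<xi>)\<^sup>2)"
        unfolding norm_squared_vec of_real_sum sum_distrib_left by simp
      then show ?thesis by (simp add: power_mult_distrib mult_ac)
    qed
    then have "complex_of_real (2 * pi * norm \<xi>) * fourier \<eta> \<xi> = fourier k2 \<xi> * fourier \<eta> \<xi>
        - (\<Sum>i\<in>UNIV. fourier k1 \<xi> * fourier (partial_deriv i (partial_deriv i \<eta>)) \<xi>)" for \<xi>
      unfolding eq sum_distrib_left[symmetric] by (simp add: algebra_simps)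
    then have "frac_laplacian (1 / 2) \<eta> x = inverse_fourier (\<lambda>\<xi>. fourier k2 \<xi> * fourier \<eta> \<xi>) x
        - (\<Sum>i\<in>UNIV. inverse_fourier (\<lambda>\<xi>. fourier k1 \<xi> * fourier (partial_deriv i (partial_deriv i \<eta>)) \<xi>) x)"
      unfolding frac_laplacian_half inverse_fourier_cis
      by (simp only: left_diff_distrib sum_distrib_right)
         (simp add: int k \<eta> schwartz_partial_deriv)
    then show ?thesis
      by (simp add: convol_eq_inverse_fourier k \<eta> schwartz_partial_deriv)
  qed
  then show ?thesis using that[OF k] by blast
qed

text \<open>Convolving with an integrable kernel preserves integrability, and commutes with derivatives of Schwartz
  functions; the order of the derivatives does not matter by \<open>partial_deriv_commute_schwartz\<close>.\<close>

lemma frac_laplacian_half_schwartz: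
  fixes \<eta> :: "real^'n::finite \<Rightarrow> complex"
  assumes \<eta>: "\<eta> \<in> schwartz"
  shows integrable_frac_laplacian_half: "integrable lborel (frac_laplacian (1 / 2) \<eta>)"
    and partial_deriv_frac_laplacian_half:
      "partial_deriv i (frac_laplacian (1 / 2) \<eta>) = frac_laplacian (1 / 2) (partial_deriv i \<eta>)"
proof -
  obtain k1 k2 :: "real^'n \<Rightarrow> complex" where k: "integrable lborel k1" "integrable lborel k2"
    and eq: "\<And>\<eta>. \<eta> \<in> schwartz \<Longrightarrow> frac_laplacian (1 / 2) \<eta> =
      (\<lambda>x. convol (*) k2 \<eta> x - (\<Sum>i\<in>UNIV. convol (*) k1 (partial_deriv i (partial_deriv i \<eta>)) x))"
    using frac_laplacian_half_convol by blast
  show "integrable lborel (frac_laplacian (1 / 2) \<eta>)"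
    unfolding eq[OF \<eta>]
    by (intro Bochner_Integration.integrable_diff Bochner_Integration.integrable_sum integrable_convol_L1
      k schwartz_integrable schwartz_partial_deriv \<eta>)
  have D: "partially_differentiable i (convol (*) k \<phi>) (convol (*) k (partial_deriv i \<phi>))"
    if "integrable lborel k" "\<phi> \<in> schwartz" for k \<phi> :: "real^'n \<Rightarrow> complex"
    by (rule partially_differentiable_convol_schwartz[OF bounded_bilinear_mult convolvable_integrable[OF that(1)] that(2)])
  have comm: "partial_deriv i (partial_deriv j (partial_deriv j \<eta>)) = partial_deriv j (partial_deriv j (partial_deriv i \<eta>))" for j
    using partial_deriv_commute_schwartz schwartz_partial_deriv \<eta> by metis
  have "partially_differentiable i
      (\<lambda>x. convol (*) k2 \<eta> x - (\<Sum>j\<in>UNIV. convol (*) k1 (partial_deriv j (partial_deriv j \<eta>)) x))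
      (\<lambda>x. convol (*) k2 (partial_deriv i \<eta>) x - (\<Sum>j\<in>UNIV. convol (*) k1 (partial_deriv i (partial_deriv j (partial_deriv j \<eta>))) x))"
    unfolding partially_differentiable_def
  proof
    fix x
    show "((\<lambda>t. convol (*) k2 \<eta> (x + t *\<^sub>R axis i 1) - (\<Sum>j\<in>UNIV. convol (*) k1 (partial_deriv j (partial_deriv j \<eta>)) (x + t *\<^sub>R axis i 1)))
      has_vector_derivative convol (*) k2 (partial_deriv i \<eta>) x - (\<Sum>j\<in>UNIV. convol (*) k1 (partial_deriv i (partial_deriv j (partial_deriv j \<eta>))) x)) (at 0)"
      using D[OF k(2) \<eta>] D[OF k(1) schwartz_partial_deriv[OF schwartz_partial_deriv[OF \<eta>]]]
      unfolding partially_differentiable_def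
      by (intro has_vector_derivative_diff has_vector_derivative_sum) blast+
  qed
  from partially_differentiable_imp[OF this]
  show "partial_deriv i (frac_laplacian (1 / 2) \<eta>) = frac_laplacian (1 / 2) (partial_deriv i \<eta>)"
    unfolding eq[OF \<eta>] eq[OF schwartz_partial_deriv[OF \<eta>]] comm .
qed

section \<open>Functionals bounded by finitely many seminorms\<close>

text \<open>A Gamma integral writes \<open>(1 + (norm x)\<^sup>2) powr (- (d + 1) / 2)\<close> as a superposition of Gaussians over \<open>t\<close>;
  integrating in \<open>x\<close> first leaves \<open>t powr (- 1 / 2) * exp (- t)\<close>, which is integrable on the half-line.\<close>

lemma integrable_inverse_polynomial_weight:
  "integrable lborel (\<lambda>x::real^'n::finite. 1 / (1 + norm x ^ (CARD('n) + 1)))"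
proof -
  define d where "d = CARD('n)"
  define p where "p = (real d + 1) / 2"
  define J where "J x = Gamma p / (1 + (norm x)\<^sup>2) powr p" for x :: "real^'n"
  have p: "p > 0" by (simp add: p_def add_pos_pos)
  define q where "q t x = indicator {0<..} t * (t powr (p - 1) * exp (- ((1 + (norm x)\<^sup>2) * t)))" for t and x :: "real^'n"
  have q: "has_bochner_integral lborel (\<lambda>t. q t x) (J x)" for x
    unfolding q_def J_def by (rule has_bochner_integral_Gamma) (auto simp: p add_pos_nonneg)
  have qx: "q t x = indicator {0<..} t * (t powr (p - 1) * exp (- t)) * exp (- t * (norm x)\<^sup>2)" for t x
  proof -
    have "exp (- ((1 + (norm x)\<^sup>2) * t)) = exp (- t) * exp (- t * (norm x)\<^sup>2)"
      by (simp add: exp_add[symmetric] algebra_simps)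
    then show ?thesis unfolding q_def by simp
  qed
  have "integrable (lborel \<Otimes>\<^sub>M lborel) (\<lambda>(t, x). q t x)"
  proof (rule lborel_pair.Fubini_integrable)
    show "(\<lambda>(t, x). q t x) \<in> borel_measurable (lborel \<Otimes>\<^sub>M lborel)"
      unfolding q_def[abs_def] by measurable
    have "integrable lborel (\<lambda>x. q t x)" for t
    proof (cases "t > 0")
      case True
      then show ?thesis unfolding qx using gaussian_integrable[OF True, where 'n='n] by (intro integrable_mult_right)
    qed (simp add: q_def)
    then show "AE t in lborel. integrable lborel (\<lambda>x. case (t, x) of (t, x) \<Rightarrow> q t x)" by simp
    have "(\<integral>x. norm (q t x) \<partial>lborel) = sqrt pi ^ d * (indicator {0<..} t * (t powr (1 / 2 - 1) * exp (- (1 * t))))" for t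
    proof (cases "t > 0")
      case True
      have "norm (q t x) = q t x" for x by (simp add: q_def)
      then have "(\<integral>x. norm (q t x) \<partial>lborel) = t powr (p - 1) * exp (- t) * sqrt (pi / t) ^ d"
        unfolding qx using True by (simp add: gaussian_integral[OF True, where 'n='n, simplified] d_def)
      also have "sqrt (pi / t) ^ d = sqrt pi ^ d * t powr (- (real d / 2))"
        using True by (simp add: real_sqrt_divide power_divide powr_minus powr_half_sqrt[symmetric] powr_powr powr_realpow[symmetric] field_simps)
      also have "t powr (p - 1) * exp (- t) * (sqrt pi ^ d * t powr (- (real d / 2)))
          = sqrt pi ^ d * ((t powr (p - 1) * t powr (- (real d / 2))) * exp (- t))" by simp
      also have "t powr (p - 1) * t powr (- (real d / 2)) = t powr (1 / 2 - 1)"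
        unfolding powr_add[symmetric] p_def by (simp add: add_divide_distrib)
      finally show ?thesis using True by simp
    qed (simp add: q_def)
    moreover have "integrable lborel (\<lambda>t. sqrt pi ^ d * (indicator {0<..} t * (t powr (1 / 2 - 1) * exp (- (1 * t)))))"
      using has_bochner_integral_Gamma[of 1 "1 / 2"] unfolding has_bochner_integral_iff by (intro integrable_mult_right) auto
    ultimately show "integrable lborel (\<lambda>t. LINT x|lborel. norm (case (t, x) of (t, x) \<Rightarrow> q t x))" by simp
  qed
  from lborel_pair.integrable_snd[OF this] have J: "integrable lborel J"
    using q by (simp add: has_bochner_integral_iff)
  show ?thesis
  proof (rule Bochner_Integration.integrable_bound)
    show "integrable lborel (\<lambda>x. 2 powr p / Gamma p * J x)" using J by (intro integrable_mult_right)
    show "AE x in lborel. norm (1 / (1 + norm (x::real^'n) ^ (CARD('n) + 1))) \<le> norm (2 powr p / Gamma p * J x)"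
    proof (intro AE_I2)
      fix x :: "real^'n"
      have "(1 + (norm x)\<^sup>2) powr p \<le> 2 powr p * (1 + norm x ^ (d + 1))"
      proof (cases "norm x \<le> 1")
        case True
        then have "(1 + (norm x)\<^sup>2) powr p \<le> 2 powr p" using p by (intro powr_mono2) (auto simp: abs_square_le_1 power_le_one)
        also have "\<dots> \<le> 2 powr p * (1 + norm x ^ (d + 1))" by simp
        finally show ?thesis .
      next
        case False
        then have "(1 + (norm x)\<^sup>2) powr p \<le> (2 * (norm x)\<^sup>2) powr p"
          using p by (intro powr_mono2) (auto simp: one_le_power)
        also have "\<dots> = 2 powr p * norm x ^ (d + 1)"
        proof -
          have "((norm x)\<^sup>2) powr p = norm x powr (2 * p)"
            using powr_realpow[of "norm x" 2] False by (simp add: powr_powr[symmetric])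
          also have "2 * p = real (d + 1)" by (simp add: p_def)
          also have "norm x powr real (d + 1) = norm x ^ (d + 1)"
            using False by (intro powr_realpow) linarith
          finally show ?thesis by (simp add: powr_mult)
        qed
        also have "\<dots> \<le> 2 powr p * (1 + norm x ^ (d + 1))" by simp
        finally show ?thesis .
      qed
      moreover have "1 + norm x ^ (d + 1) > 0" "(1 + (norm x)\<^sup>2) powr p > 0"
        by (auto simp: add_pos_nonneg) (metis add_pos_nonneg less_numeral_extra(1,3) zero_le_power2)
      ultimately have "1 / (1 + norm x ^ (d + 1)) \<le> 2 powr p / (1 + (norm x)\<^sup>2) powr p"
        by (simp add: divide_simps mult.commute)
      also have "\<dots> = 2 powr p / Gamma p * J x"
        using Gamma_real_pos[OF p] by (simp add: J_def)
      finally have le: "1 / (1 + norm x ^ (d + 1)) \<le> 2 powr p / Gamma p * J x" .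
      have "0 \<le> 1 / (1 + norm x ^ (d + 1))" by simp
      then have "norm (1 / (1 + norm x ^ (d + 1))) = 1 / (1 + norm x ^ (d + 1))"
        unfolding real_norm_def by (rule abs_of_nonneg)
      then show "norm (1 / (1 + norm x ^ (CARD('n) + 1))) \<le> norm (2 powr p / Gamma p * J x)"
        unfolding d_def[symmetric] using order_trans[OF le abs_ge_self] unfolding real_norm_def by metis
    qed
  qed measurable
qed

lemma s_half_smooth: "\<psi> \<in> s_half \<Longrightarrow> smooth \<psi>"
  by (simp add: s_half_def)

lemma s_half_partial_deriv: "\<psi> \<in> s_half \<Longrightarrow> partial_deriv i \<psi> \<in> s_half"
  unfolding s_half_def by (auto simp: smooth_partial_deriv simp flip: partial_derivs_snoc)

lemma s_half_diff:
  fixes \<phi> \<psi> :: "real^'n::finite \<Rightarrow> complex"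
  assumes "\<phi> \<in> s_half" "\<psi> \<in> s_half"
  shows "(\<lambda>x. \<phi> x - \<psi> x) \<in> s_half"
proof -
  have *: "(\<lambda>x. \<phi> x - \<psi> x) = (\<lambda>x. \<phi> x + (- 1) * \<psi> x)" by simp
  have s: "smooth \<phi>" "smooth \<psi>" using assms by (auto intro: s_half_smooth)
  have "partial_derivs w (\<lambda>x. \<phi> x - \<psi> x) = (\<lambda>x. partial_derivs w \<phi> x - partial_derivs w \<psi> x)" for w
  proof -
    have "partial_derivs w (\<lambda>x. \<phi> x + (- 1) * \<psi> x) = (\<lambda>x. partial_derivs w \<phi> x + (- 1) * partial_derivs w \<psi> x)"
      by (simp only: smooth_add(2)[OF s(1) smooth_cmult(1)[OF s(2)]] smooth_cmult(2)[OF s(2)])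
    then show ?thesis by simp
  qed
  moreover have "smooth (\<lambda>x. \<phi> x - \<psi> x)"
    unfolding * by (intro smooth_add smooth_cmult s)
  ultimately show ?thesis
    using assms unfolding s_half_def by (auto simp: scaleR_diff_right intro!: bounded_minus_comp)
qed

lemma s_half_seminorm_ge:
  fixes \<psi> :: "real^'n::finite \<Rightarrow> complex"
  assumes "\<psi> \<in> s_half"
  shows "norm ((1 + norm x ^ (CARD('n) + 1)) *\<^sub>R partial_derivs w \<psi> x) \<le> s_half_seminorm w \<psi>"
  unfolding s_half_seminorm_def
proof (rule cSUP_upper)
  have "bounded (range (\<lambda>x. (1 + norm x ^ (CARD('n) + 1)) *\<^sub>R partial_derivs w \<psi> x))"
    using assms unfolding s_half_def by blast
  then obtain B where "\<And>x. norm ((1 + norm x ^ (CARD('n) + 1)) *\<^sub>R partial_derivs w \<psi> x) \<le> B"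
    unfolding bounded_iff by auto
  then show "bdd_above (range (\<lambda>x. norm ((1 + norm x ^ (CARD('n) + 1)) *\<^sub>R partial_derivs w \<psi> x)))"
    by (intro bdd_aboveI2)
qed simp

lemma s_half_seminorm_nonneg: "\<psi> \<in> s_half \<Longrightarrow> 0 \<le> s_half_seminorm w \<psi>"
  using order_trans[OF norm_ge_zero s_half_seminorm_ge[of \<psi> 0 w]] .

lemma s_half_seminorm_diff_self:
  fixes \<psi> :: "real^'n::finite \<Rightarrow> complex"
  shows "s_half_seminorm w (\<lambda>x. \<psi> x - \<psi> x) = 0"
proof -
  have "partially_differentiable i (\<lambda>_::real^'n. 0::complex) (\<lambda>_. 0)" for i
    by (simp add: partially_differentiable_def)
  then have "partial_derivs w (\<lambda>_::real^'n. 0::complex) = (\<lambda>_. 0)"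
    by (intro smoothI(2)[of "\<lambda>_ _. 0"]) auto
  then show ?thesis by (simp add: s_half_seminorm_def)
qed

text \<open>Linearity together with a bound by finitely many seminorms is stable under differentiation and sums, by
  appending letters to the words and by taking unions; it implies continuity.\<close>

definition s_half_bounded :: "'n::finite functional \<Rightarrow> bool" where
  "s_half_bounded T \<longleftrightarrow>
     (\<forall>\<phi>\<in>s_half. \<forall>\<psi>\<in>s_half. T (\<lambda>x. \<phi> x + \<psi> x) = T \<phi> + T \<psi>) \<and>
     (\<forall>c. \<forall>\<psi>\<in>s_half. T (\<lambda>x. c * \<psi> x) = c * T \<psi>) \<and>
     (\<exists>W C. finite W \<and> C \<ge> 0 \<and> (\<forall>\<psi>\<in>s_half. norm (T \<psi>) \<le> C * (\<Sum>w\<in>W. s_half_seminorm w \<psi>)))"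

lemma s_half_bounded_function_dist:
  fixes u :: "real^'n::finite \<Rightarrow> complex"
  assumes [measurable]: "u \<in> borel_measurable borel" and B: "\<And>x. norm (u x) \<le> B"
  shows "s_half_bounded (function_dist u)"
proof -
  let ?p = "\<lambda>x::real^'n. 1 + norm x ^ (CARD('n) + 1)"
  have B0: "B \<ge> 0" using B[of 0] norm_ge_zero order_trans by blast
  have pos: "?p x > 0" for x by (simp add: add_pos_nonneg)
  have bound: "norm (u x * \<psi> x) \<le> B * s_half_seminorm [] \<psi> * (1 / ?p x)" if "\<psi> \<in> s_half" for \<psi> x
  proof -
    have "norm (\<psi> x) \<le> s_half_seminorm [] \<psi> * (1 / ?p x)"
      using s_half_seminorm_ge[OF that, of x "[]"] pos[of x] by (simp add: pos_le_divide_eq mult.commute)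
    then have "norm (u x) * norm (\<psi> x) \<le> B * (s_half_seminorm [] \<psi> * (1 / ?p x))"
      using B[of x] B0 by (intro mult_mono) auto
    then show ?thesis by (simp add: norm_mult)
  qed
  have int: "integrable lborel (\<lambda>x. u x * \<psi> x)" if \<psi>: "\<psi> \<in> s_half" for \<psi>
  proof (rule Bochner_Integration.integrable_bound)
    show "integrable lborel (\<lambda>x::real^'n. B * s_half_seminorm [] \<psi> * (1 / ?p x))"
      by (intro integrable_mult_right integrable_inverse_polynomial_weight)
    have [measurable]: "\<psi> \<in> borel_measurable borel"
      using \<psi> by (intro borel_measurable_continuous_onI smooth_continuous s_half_smooth)
    show "(\<lambda>x. u x * \<psi> x) \<in> borel_measurable lborel" by measurable
    show "AE x in lborel. norm (u x * \<psi> x) \<le> norm (B * s_half_seminorm [] \<psi> * (1 / ?p x))"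
      using bound[OF \<psi>] by (intro AE_I2) (metis abs_ge_self order_trans real_norm_def)
  qed
  define I where "I = (\<integral>x. 1 / ?p x \<partial>lborel)"
  have I0: "I \<ge> 0" unfolding I_def using pos by (intro integral_nonneg_AE AE_I2) (auto simp: less_imp_le)
  have "norm (function_dist u \<psi>) \<le> B * I * (\<Sum>w\<in>{[]}. s_half_seminorm w \<psi>)" if \<psi>: "\<psi> \<in> s_half" for \<psi>
  proof -
    have "norm (function_dist u \<psi>) \<le> (\<integral>x. B * s_half_seminorm [] \<psi> * (1 / ?p x) \<partial>lborel)"
      unfolding function_dist_def
      by (intro Bochner_Integration.integral_norm_bound_integral int \<psi> bound integrable_mult_right integrable_inverse_polynomial_weight)
    also have "\<dots> = B * s_half_seminorm [] \<psi> * I"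
      unfolding I_def by (rule integral_mult_right_zero)
    finally show ?thesis by (simp add: mult_ac)
  qed
  moreover have "B * I \<ge> 0" using B0 I0 by simp
  moreover have "finite {[]::'n list}" by simp
  ultimately have "\<exists>W C. finite W \<and> C \<ge> 0 \<and> (\<forall>\<psi>\<in>s_half. norm (function_dist u \<psi>) \<le> C * (\<Sum>w\<in>W. s_half_seminorm w \<psi>))"
    by blast
  moreover have "function_dist u (\<lambda>x. \<phi> x + \<psi> x) = function_dist u \<phi> + function_dist u \<psi>"
    if "\<phi> \<in> s_half" "\<psi> \<in> s_half" for \<phi> \<psi>
    unfolding function_dist_def distrib_left by (intro Bochner_Integration.integral_add int that)
  moreover have "function_dist u (\<lambda>x. c * \<psi> x) = c * function_dist u \<psi>" for c \<psi>
    unfolding function_dist_def mult.left_commute[of _ c] by (rule integral_mult_right_zero)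
  ultimately show ?thesis unfolding s_half_bounded_def by blast
qed

lemma s_half_bounded_dist_deriv:
  assumes T: "s_half_bounded T"
  shows "s_half_bounded (dist_deriv i T)"
proof -
  obtain W C where W: "finite W" "C \<ge> 0" "\<And>\<psi>. \<psi> \<in> s_half \<Longrightarrow> norm (T \<psi>) \<le> C * (\<Sum>w\<in>W. s_half_seminorm w \<psi>)"
    using T unfolding s_half_bounded_def by blast
  have "norm (dist_deriv i T \<psi>) \<le> C * (\<Sum>w\<in>(\<lambda>w. w @ [i]) ` W. s_half_seminorm w \<psi>)" if "\<psi> \<in> s_half" for \<psi>
  proof -
    have "s_half_seminorm w (partial_deriv i \<psi>) = s_half_seminorm (w @ [i]) \<psi>" for w
      by (simp add: s_half_seminorm_def partial_derivs_snoc)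
    moreover have "inj_on (\<lambda>w. w @ [i]) W" by (simp add: inj_on_def)
    ultimately show ?thesis
      using W(3)[OF s_half_partial_deriv[OF that], of i] by (simp add: dist_deriv_def sum.reindex)
  qed
  moreover have "partial_deriv i (\<lambda>x. \<phi> x + \<psi> x) = (\<lambda>x. partial_deriv i \<phi> x + partial_deriv i \<psi> x)"
    if "\<phi> \<in> s_half" "\<psi> \<in> s_half" for \<phi> \<psi> :: "real^'a \<Rightarrow> complex"
    using smooth_add(2)[OF that[THEN s_half_smooth], of "[i]"] by (simp add: partial_derivs_Cons)
  moreover have "partial_deriv i (\<lambda>x. c * \<psi> x) = (\<lambda>x. c * partial_deriv i \<psi> x)"
    if "\<psi> \<in> s_half" for c and \<psi> :: "real^'a \<Rightarrow> complex"
    using smooth_cmult(2)[OF that[THEN s_half_smooth], of "[i]"] by (simp add: partial_derivs_Cons)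
  ultimately show ?thesis
    using T W(1,2) unfolding s_half_bounded_def
    by (intro conjI exI[of _ "(\<lambda>w. w @ [i]) ` W"] exI[of _ C])
       (auto simp: dist_deriv_def s_half_partial_deriv)
qed

lemma s_half_bounded_add:
  assumes S: "s_half_bounded S" and T: "s_half_bounded T"
  shows "s_half_bounded (\<lambda>\<psi>. S \<psi> + T \<psi>)"
proof -
  obtain V B where V: "finite V" "B \<ge> 0" "\<And>\<psi>. \<psi> \<in> s_half \<Longrightarrow> norm (S \<psi>) \<le> B * (\<Sum>w\<in>V. s_half_seminorm w \<psi>)"
    using S unfolding s_half_bounded_def by blast
  obtain W C where W: "finite W" "C \<ge> 0" "\<And>\<psi>. \<psi> \<in> s_half \<Longrightarrow> norm (T \<psi>) \<le> C * (\<Sum>w\<in>W. s_half_seminorm w \<psi>)"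
    using T unfolding s_half_bounded_def by blast
  have "norm (S \<psi> + T \<psi>) \<le> (B + C) * (\<Sum>w\<in>V \<union> W. s_half_seminorm w \<psi>)" if \<psi>: "\<psi> \<in> s_half" for \<psi>
  proof -
    have "norm (S \<psi> + T \<psi>) \<le> B * (\<Sum>w\<in>V. s_half_seminorm w \<psi>) + C * (\<Sum>w\<in>W. s_half_seminorm w \<psi>)"
      by (rule order_trans[OF norm_triangle_ineq add_mono[OF V(3)[OF \<psi>] W(3)[OF \<psi>]]])
    also have "\<dots> \<le> B * (\<Sum>w\<in>V \<union> W. s_half_seminorm w \<psi>) + C * (\<Sum>w\<in>V \<union> W. s_half_seminorm w \<psi>)"
      using V W \<psi> by (intro add_mono mult_left_mono sum_mono2) (auto simp: s_half_seminorm_nonneg)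
    finally show ?thesis by (simp add: distrib_right)
  qed
  moreover have "B + C \<ge> 0" "finite (V \<union> W)" using V W by auto
  ultimately show ?thesis
    using S T unfolding s_half_bounded_def
    by (intro conjI exI[of _ "V \<union> W"] exI[of _ "B + C"]) (auto simp: distrib_left)
qed

lemma s_half_bounded_zero: "s_half_bounded (\<lambda>_. 0)"
  unfolding s_half_bounded_def by (auto intro!: exI[of _ "{}"] exI[of _ 0])

lemma s_half_bounded_sum:
  "finite A \<Longrightarrow> (\<And>i. i \<in> A \<Longrightarrow> s_half_bounded (T i)) \<Longrightarrow> s_half_bounded (\<lambda>\<psi>. \<Sum>i\<in>A. T i \<psi>)"
  by (induction A rule: finite_induct) (auto simp: s_half_bounded_zero intro: s_half_bounded_add)

lemma s_half_bounded_uminus: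
  assumes "s_half_bounded T"
  shows "s_half_bounded (\<lambda>\<psi>. - T \<psi>)"
  using assms unfolding s_half_bounded_def by (simp add: add.commute)

text \<open>Around a given \<open>\<phi>\<close>, the finitely many seminorm balls entering the bound intersect in an open set on which
  \<open>T\<close> varies as little as required, if their radii are small.\<close>

lemma s_half_bounded_in_dual:
  fixes T :: "'n::finite functional"
  assumes T: "s_half_bounded T"
  shows "T \<in> s_half_dual"
proof -
  obtain W0 C where W0: "finite W0" "C \<ge> 0" "\<And>\<psi>. \<psi> \<in> s_half \<Longrightarrow> norm (T \<psi>) \<le> C * (\<Sum>w\<in>W0. s_half_seminorm w \<psi>)"
    using T unfolding s_half_bounded_def by blast
  \<comment> \<open>The finite family of balls intersected below must not be empty.\<close>
  define W where "W = insert [] W0"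
  have W: "finite W" "W \<noteq> {}" using W0 by (auto simp: W_def)
  have TW: "norm (T \<psi>) \<le> C * (\<Sum>w\<in>W. s_half_seminorm w \<psi>)" if \<psi>: "\<psi> \<in> s_half" for \<psi>
    by (rule order_trans[OF W0(3)[OF \<psi>]])
       (use W0 \<psi> in \<open>auto simp: W_def intro!: mult_left_mono sum_mono2 s_half_seminorm_nonneg\<close>)
  define ball where "ball w \<phi> \<epsilon> = {\<psi> \<in> s_half. s_half_seminorm w (\<lambda>x. \<psi> x - \<phi> x) < \<epsilon>}"
    for w and \<phi> :: "real^'n \<Rightarrow> complex" and \<epsilon> :: real
  have ball_open: "openin s_half_topology (ball w \<phi> \<epsilon>)" if "\<phi> \<in> s_half" "\<epsilon> > 0" for w \<phi> \<epsilon>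
    unfolding s_half_topology_def ball_def using that by (intro topology_generated_by_Basis) blast
  have ball_self: "\<phi> \<in> ball w \<phi> \<epsilon>" if "\<phi> \<in> s_half" "\<epsilon> > 0" for w \<phi> \<epsilon>
    using that unfolding ball_def mem_Collect_eq s_half_seminorm_diff_self by simp
  have top: "topspace s_half_topology = (s_half :: (real^'n \<Rightarrow> complex) set)"
  proof
    show "topspace s_half_topology \<subseteq> (s_half :: (real^'n \<Rightarrow> complex) set)"
      unfolding s_half_topology_def topology_generated_by_topspace by auto
    show "(s_half :: (real^'n \<Rightarrow> complex) set) \<subseteq> topspace s_half_topology"
      using ball_open[of _ 1 "[]"] ball_self[of _ 1 "[]"] openin_subset by fastforce
  qed
  have diff: "T (\<lambda>x. \<psi> x - \<phi> x) = T \<psi> - T \<phi>" if "\<psi> \<in> s_half" "\<phi> \<in> s_half" for \<psi> \<phi>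
  proof -
    have "T \<psi> = T (\<lambda>x. (\<psi> x - \<phi> x) + \<phi> x)" by simp
    also have "\<dots> = T (\<lambda>x. \<psi> x - \<phi> x) + T \<phi>"
    proof -
      have "\<forall>\<phi>\<in>s_half. \<forall>\<psi>\<in>s_half. T (\<lambda>x. \<phi> x + \<psi> x) = T \<phi> + T \<psi>"
        using T unfolding s_half_bounded_def by blast
      from bspec[OF bspec[OF this s_half_diff[OF that]] that(2)] show ?thesis .
    qed
    finally show ?thesis by simp
  qed
  have "continuous_map s_half_topology euclidean T"
    unfolding continuous_map_def
  proof (intro conjI allI impI)
    fix U :: "complex set" assume U: "openin euclidean U"
    show "openin s_half_topology {\<psi> \<in> topspace s_half_topology. T \<psi> \<in> U}"
    proof (subst openin_subopen, intro ballI)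
      fix \<phi> assume "\<phi> \<in> {\<psi> \<in> topspace s_half_topology. T \<psi> \<in> U}"
      then have \<phi>: "\<phi> \<in> s_half" "T \<phi> \<in> U" by (auto simp: top)
      obtain e where e: "e > 0" "\<And>z. dist z (T \<phi>) < e \<Longrightarrow> z \<in> U"
        using U \<phi>(2) by (metis open_dist open_openin)
      define \<epsilon> where "\<epsilon> = e / (C * card W + 1)"
      have den: "C * card W + 1 > 0" using W0(2) by (simp add: add_nonneg_pos)
      then have \<epsilon>: "\<epsilon> > 0" using e(1) by (simp add: \<epsilon>_def)
      define V where "V = \<Inter> ((\<lambda>w. ball w \<phi> \<epsilon>) ` W)"
      have "openin s_half_topology V"
        unfolding V_def using W by (intro openin_Inter) (auto intro: ball_open[OF \<phi>(1) \<epsilon>])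
      moreover have "\<phi> \<in> V" unfolding V_def using ball_self[OF \<phi>(1) \<epsilon>] by auto
      moreover have "V \<subseteq> {\<psi> \<in> topspace s_half_topology. T \<psi> \<in> U}"
      proof
        fix \<psi> assume "\<psi> \<in> V"
        then have s: "\<psi> \<in> s_half" and sm: "\<And>w. w \<in> W \<Longrightarrow> s_half_seminorm w (\<lambda>x. \<psi> x - \<phi> x) < \<epsilon>"
          unfolding V_def ball_def using W(2) by auto
        have "norm (T \<psi> - T \<phi>) \<le> C * (\<Sum>w\<in>W. s_half_seminorm w (\<lambda>x. \<psi> x - \<phi> x))"
          unfolding diff[OF s \<phi>(1), symmetric] by (intro TW s_half_diff s \<phi>)
        also have "\<dots> \<le> C * (\<Sum>w\<in>W. \<epsilon>)"
          using sm W0(2) by (intro mult_left_mono sum_mono) (auto simp: less_imp_le)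
        also have "\<dots> = C * card W * \<epsilon>" by simp
        also have "\<dots> < (C * card W + 1) * \<epsilon>" using \<epsilon> by (simp add: distrib_right)
        also have "\<dots> = e" using den by (simp add: \<epsilon>_def)
        finally have "T \<psi> \<in> U" by (intro e(2)) (simp add: dist_norm)
        then show "\<psi> \<in> {\<psi> \<in> topspace s_half_topology. T \<psi> \<in> U}" using s by (simp add: top)
      qed
      ultimately show "\<exists>V. openin s_half_topology V \<and> \<phi> \<in> V \<and> V \<subseteq> {\<psi> \<in> topspace s_half_topology. T \<psi> \<in> U}"
        by blast
    qed
  qed simp
  then show ?thesis using T unfolding s_half_dual_def s_half_bounded_def by blast
qed

lemma s_half_bounded_neg_laplacian_power:
  assumes "s_half_bounded T"
  shows "s_half_bounded ((dist_neg_laplacian ^^ m) T)"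
proof (induction m)
  case (Suc m)
  then show ?case
    unfolding funpow.simps o_def
    by (subst dist_neg_laplacian_def)
       (intro s_half_bounded_uminus s_half_bounded_sum s_half_bounded_dist_deriv; simp)
qed (use assms in simp)

lemma s_half_bounded_divergence:
  fixes F :: "real^'n::finite \<Rightarrow> real^'n"
  assumes F: "F \<in> borel_measurable borel" and B: "\<And>x. norm (F x) \<le> B"
  shows "s_half_bounded (dist_divergence F)"
  unfolding dist_divergence_def
proof (intro s_half_bounded_sum s_half_bounded_dist_deriv s_half_bounded_function_dist)
  show "(\<lambda>x. complex_of_real (F x $ i)) \<in> borel_measurable borel" for i
    unfolding cart_eq_inner_axis using F by measurable
  show "norm (complex_of_real (F x $ i)) \<le> B" for i x
    using component_le_norm_cart[of "F x" i] B[of x] by simp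
qed simp

section \<open>The geometric distribution function\<close>

lemma geometric_cdf_density:
  fixes f :: "real^'n::finite \<Rightarrow> real"
  assumes P: "P = density lborel (\<lambda>x. ennreal (f x))" and f0: "\<forall>x. 0 \<le> f x" and f[measurable]: "f \<in> borel_measurable borel"
  shows "geometric_cdf P x = (\<integral>z. f z *\<^sub>R sgn (x - z) \<partial>lborel)"
proof -
  have "indicator {z. z \<noteq> x} z *\<^sub>R ((x - z) /\<^sub>R norm (x - z)) = sgn (x - z)" for z
    by (simp add: indicator_def sgn_div_norm)
  then have "geometric_cdf P x = (\<integral>z. sgn (x - z) \<partial>P)"
    unfolding geometric_cdf_def by simp
  also have "\<dots> = (\<integral>z. f z *\<^sub>R sgn (x - z) \<partial>lborel)"
    unfolding P using f0 by (subst integral_density) (auto simp: sgn_div_norm)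
  finally show ?thesis .
qed

lemma measurable_sgn_vec [measurable]: "(sgn :: real^'n::finite \<Rightarrow> real^'n) \<in> borel_measurable borel"
  unfolding sgn_div_norm[abs_def] by measurable

text \<open>The cdf is the convolution of the bounded kernel \<^const>\<open>sgn\<close> with the density, for the product that multiplies a
  vector by the real part of a scalar.\<close>

lemma smooth_geometric_cdf:
  fixes f :: "real^'n::finite \<Rightarrow> real"
  assumes P: "P = density lborel (\<lambda>x. ennreal (f x))" and f0: "\<forall>x. 0 \<le> f x"
    and f: "(\<lambda>x. complex_of_real (f x)) \<in> schwartz"
  shows "smooth (geometric_cdf P)"
proof -
  have fm: "f \<in> borel_measurable borel"
    using schwartz_measurable[OF f] by (simp add: borel_measurable_complex_iff)
  define p where "p k c = Re c *\<^sub>R k" for k :: "real^'n" and c :: complex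
  have p: "bounded_bilinear p"
    unfolding p_def
    by (rule bounded_bilinear.flip[OF bounded_bilinear.comp1[OF bounded_bilinear_scaleR bounded_linear_Re]])
  have "geometric_cdf P = convol p sgn (\<lambda>x. complex_of_real (f x))"
  proof
    fix x
    have "geometric_cdf P x = (\<integral>z. f z *\<^sub>R sgn (x - z) \<partial>lborel)"
      by (rule geometric_cdf_density[OF P f0 fm])
    also have "\<dots> = (\<integral>y. f (x - y) *\<^sub>R sgn (x - (x - y)) \<partial>lborel)"
      by (rule integral_lborel_diff[symmetric])
    finally show "geometric_cdf P x = convol p sgn (\<lambda>x. complex_of_real (f x)) x"
      by (simp add: convol_def p_def)
  qed
  moreover have "convolvable (sgn :: real^'n \<Rightarrow> real^'n)"
    by (rule convolvable_bounded[where B=1]) (auto simp: norm_sgn)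
  ultimately show ?thesis using smooth_convol_schwartz[OF p _ f] by simp
qed

lemma norm_geometric_cdf_le:
  fixes P :: "(real^'n::finite) measure"
  assumes "prob_space P"
  shows "norm (geometric_cdf P x) \<le> 1"
proof -
  interpret prob_space P by fact
  have n: "norm (indicator {z. z \<noteq> x} z *\<^sub>R ((x - z) /\<^sub>R norm (x - z))) \<le> 1" for z
    by (simp add: indicator_def)
  show ?thesis
  proof (cases "integrable P (\<lambda>z. indicator {z. z \<noteq> x} z *\<^sub>R ((x - z) /\<^sub>R norm (x - z)))")
    case True
    have "norm (geometric_cdf P x) \<le> (\<integral>z. norm (indicator {z. z \<noteq> x} z *\<^sub>R ((x - z) /\<^sub>R norm (x - z))) \<partial>P)"
      unfolding geometric_cdf_def by (rule integral_norm_bound)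
    also have "\<dots> \<le> (\<integral>z. 1 \<partial>P)"
      using True n by (intro integral_mono integrable_norm) auto
    finally show ?thesis by (simp add: prob_space)
  next
    case False
    then show ?thesis unfolding geometric_cdf_def by (simp add: not_integrable_integral_eq)
  qed
qed

section \<open>Gaussian superposition of the sign field\<close>

text \<open>The integrand in \<open>y $ j / norm y = \<integral> t powr (- 1 / 2) / sqrt \<pi> * (y $ j * exp (- t * (norm y)\<^sup>2))\<close> over \<open>t > 0\<close>.\<close>

definition sign_mixture :: "'n::finite \<Rightarrow> real \<Rightarrow> real^'n \<Rightarrow> real" where
  "sign_mixture j t y = indicator {0<..} t * (t powr (- 1 / 2) / sqrt pi) * (y $ j * exp (- t * (norm y)\<^sup>2))"

text \<open>The inverse Fourier transform of \<^term>\<open>sign_mixture j t\<close>.\<close>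

definition sign_mixture_hat :: "'n::finite \<Rightarrow> real \<Rightarrow> real^'n \<Rightarrow> complex" where
  "sign_mixture_hat j t \<xi> = complex_of_real (indicator {0<..} t * (t powr (- 1 / 2) / sqrt pi)) *
     (pi * \<i> * (\<xi> $ j) / t * complex_of_real (sqrt (pi / t) ^ CARD('n) * exp (- (pi\<^sup>2 * (norm \<xi>)\<^sup>2) / t)))"

lemma measurable_sign_mixture [measurable]:
  "(\<lambda>(t, y). sign_mixture j t y) \<in> borel_measurable (borel \<Otimes>\<^sub>M borel)"
  unfolding sign_mixture_def[abs_def] by measurable

lemma has_bochner_integral_sign_mixture:
  "has_bochner_integral lborel (\<lambda>t. sign_mixture j t y) (sgn y $ j)"
proof (cases "y = 0")
  case True
  then show ?thesis by (simp add: sign_mixture_def has_bochner_integral_zero)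
next
  case False
  then have "has_bochner_integral lborel (\<lambda>t. (y $ j / sqrt pi) * (indicator {0<..} t * (t powr (1 / 2 - 1) * exp (- ((norm y)\<^sup>2 * t)))))
     ((y $ j / sqrt pi) * (Gamma (1 / 2) / (norm y)\<^sup>2 powr (1 / 2)))"
    by (intro has_bochner_integral_mult_right has_bochner_integral_Gamma) auto
  moreover have "(y $ j / sqrt pi) * (Gamma (1 / 2) / (norm y)\<^sup>2 powr (1 / 2)) = sgn y $ j"
  proof -
    have eq: "sgn y $ j = inverse (norm y) * y $ j" by (simp add: sgn_div_norm)
    have "(norm y)\<^sup>2 powr (1 / 2) = norm y" by (simp add: powr_half_sqrt)
    moreover have "a / sqrt pi * (sqrt pi / b) = inverse b * a" for a b :: real
      by (simp add: divide_inverse mult.commute)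
    ultimately show ?thesis unfolding eq Gamma_one_half_real by metis
  qed
  moreover have "(y $ j / sqrt pi) * (indicator {0<..} t * (t powr (1 / 2 - 1) * exp (- ((norm y)\<^sup>2 * t)))) = sign_mixture j t y" for t
    by (simp add: sign_mixture_def mult_ac)
  ultimately show ?thesis by simp
qed

text \<open>In \<open>t\<close> the mixture has the constant sign of \<open>y $ j\<close>, so the integral of its modulus is \<open>\<bar>sgn y $ j\<bar>\<close>.  The bound is
  uniform in \<open>y\<close>, which makes the exchange of integrals in \<open>sign_mixture_pairing\<close> legitimate.\<close>

lemma integral_norm_sign_mixture: "(\<integral>t. norm (sign_mixture j t y) \<partial>lborel) \<le> 1"
proof -
  have "norm (sign_mixture j t y) = sgn (y $ j) * sign_mixture j t y" for t
    by (simp add: sign_mixture_def abs_mult sgn_if)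
  then have "(\<integral>t. norm (sign_mixture j t y) \<partial>lborel) = sgn (y $ j) * sgn y $ j"
    using has_bochner_integral_sign_mixture[of j y] by (simp add: has_bochner_integral_iff)
  also have "\<dots> = \<bar>sgn y $ j\<bar>"
  proof -
    have eq: "sgn y $ j = inverse (norm y) * y $ j" by (simp add: sgn_div_norm)
    show ?thesis unfolding eq by (simp add: abs_mult sgn_if)
  qed
  also have "\<dots> \<le> norm (sgn y)" by (rule component_le_norm_cart)
  also have "\<dots> \<le> 1" by (simp add: norm_sgn)
  finally show ?thesis .
qed

lemma sign_mixture_integrable: "integrable lborel (\<lambda>y::real^'n::finite. complex_of_real (sign_mixture j t y))"
proof (cases "t > 0")
  case True
  obtain C where C: "\<And>x::real^'n. \<bar>x $ j\<bar> * exp (- t * (norm x)\<^sup>2) \<le> C * decay_weight x"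
    using coordinate_gaussian_decay[OF True] by blast
  have "integrable lborel (\<lambda>y::real^'n. complex_of_real (y $ j * exp (- t * (norm y)\<^sup>2)))"
    by (rule integrable_decaying[of _ C]) (use C in \<open>simp_all add: norm_mult del: of_real_exp\<close>)
  then have "integrable lborel (\<lambda>y::real^'n. complex_of_real (t powr (- 1 / 2) / sqrt pi) * complex_of_real (y $ j * exp (- t * (norm y)\<^sup>2)))"
    by (rule integrable_mult_right)
  then show ?thesis using True unfolding sign_mixture_def by simp
qed (simp add: sign_mixture_def)

lemma sign_mixture_bounded: "\<exists>B. \<forall>y::real^'n::finite. norm (complex_of_real (sign_mixture j t y)) \<le> B"
proof (cases "t > 0")
  case True
  obtain C where C: "\<And>x::real^'n. \<bar>x $ j\<bar> * exp (- t * (norm x)\<^sup>2) \<le> C * decay_weight x"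
    using coordinate_gaussian_decay[OF True] by blast
  have "norm (complex_of_real (sign_mixture j t y)) \<le> t powr (- 1 / 2) / sqrt pi * \<bar>C\<bar>" for y :: "real^'n"
  proof -
    have "C * decay_weight y \<le> \<bar>C\<bar> * 1"
      by (intro mult_mono) (auto simp: decay_weight_le_1)
    then have "\<bar>y $ j\<bar> * exp (- t * (norm y)\<^sup>2) \<le> \<bar>C\<bar>" using C[of y] by linarith
    then have "t powr (- 1 / 2) / sqrt pi * (\<bar>y $ j\<bar> * exp (- t * (norm y)\<^sup>2)) \<le> t powr (- 1 / 2) / sqrt pi * \<bar>C\<bar>"
      by (intro mult_left_mono) auto
    then show ?thesis using True unfolding sign_mixture_def norm_of_real by (simp add: abs_mult)
  qed
  then show ?thesis by blast
qed (auto simp: sign_mixture_def)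

lemma inverse_fourier_sign_mixture:
  "inverse_fourier (\<lambda>y. complex_of_real (sign_mixture j t y)) \<xi> = sign_mixture_hat j t \<xi>"
proof (cases "t > 0")
  case True
  have "inverse_fourier (\<lambda>y. complex_of_real (sign_mixture j t y)) \<xi>
      = complex_of_real (t powr (- 1 / 2) / sqrt pi) * fourier (\<lambda>y. complex_of_real (y $ j * exp (- t * (norm y)\<^sup>2))) (- \<xi>)"
    unfolding inverse_fourier_eq_fourier fourier_def sign_mixture_def integral_mult_right_zero[symmetric] using True
    by (simp add: mult.assoc)
  then show ?thesis
    unfolding coordinate_gaussian_fourier[OF True] sign_mixture_hat_def using True by simp
qed (simp add: sign_mixture_def sign_mixture_hat_def inverse_fourier_def)

text \<open>The integral of \<open>f z * sign_mixture j t (x - z) * inverse_fourier u x\<close> over \<open>x\<close>, \<open>z\<close> and \<open>t\<close> converges absolutely.  For fixed \<open>t\<close> the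
  multiplication formula moves it to the frequency side, first in \<open>x\<close> and then in \<open>z\<close>.  There the integral over
  \<open>t\<close> has to stay outside: for a general \<open>u\<close> the double integral over \<open>t\<close> and \<open>\<xi>\<close> need not
  converge absolutely near \<open>\<xi> = 0\<close>.\<close>

lemma sign_mixture_pairing:
  fixes f u :: "real^'n::finite \<Rightarrow> complex"
  assumes f: "integrable lborel f" and u: "integrable lborel u" and \<phi>: "integrable lborel (inverse_fourier u)"
  shows "has_bochner_integral lborel
     (\<lambda>t. \<integral>\<xi>. u \<xi> * sign_mixture_hat j t \<xi> * inverse_fourier f \<xi> \<partial>lborel)
     (\<integral>x. (\<integral>z. f z * complex_of_real (sgn (x - z) $ j) \<partial>lborel) * inverse_fourier u x \<partial>lborel)"
proof -
  define \<phi> where "\<phi> = inverse_fourier u"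
  have \<phi>: "integrable lborel \<phi>" using \<phi> by (simp add: \<phi>_def)
  have [measurable]: "f \<in> borel_measurable borel" "\<phi> \<in> borel_measurable borel"
    using borel_measurable_integrable[OF f] borel_measurable_integrable[OF \<phi>] by auto
  define q where "q t y = complex_of_real (sign_mixture j t y)" for t and y :: "real^'n"
  have [measurable]: "(\<lambda>(t, y). q t y) \<in> borel_measurable (borel \<Otimes>\<^sub>M borel)"
    unfolding q_def by measurable
  have q: "integrable lborel (q t)" for t
    unfolding q_def by (rule sign_mixture_integrable)
  have qhat: "inverse_fourier (q t) = sign_mixture_hat j t" for t
    unfolding q_def using inverse_fourier_sign_mixture by blast
  define H where "H w = \<phi> (fst w) * f (snd w)" for w :: "(real^'n) \<times> (real^'n)"
  have Hm[measurable]: "H \<in> borel_measurable borel"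
    unfolding H_def borel_prod[symmetric] by measurable
  have H: "integrable lborel H"
  proof -
    have "integrable (lborel \<Otimes>\<^sub>M lborel) (\<lambda>(x, z). \<phi> x * (f z * 1))"
      by (rule Fubini_bounded_kernel(1)[OF \<phi> f, of "\<lambda>_ _. 1" 1]) auto
    then show ?thesis by (simp add: H_def[abs_def] lborel_prod case_prod_beta')
  qed
  have mdiff: "(\<lambda>w::(real^'n) \<times> (real^'n). fst w - snd w) \<in> borel_measurable borel"
    by (intro borel_measurable_continuous_onI continuous_intros)
  have jm[measurable]: "(\<lambda>(w, t). H w * q t (fst w - snd w)) \<in> borel_measurable (lborel \<Otimes>\<^sub>M lborel)"
  proof -
    define s where "s w = fst w - snd w" for w :: "(real^'n) \<times> (real^'n)"
    have [measurable]: "s \<in> borel_measurable borel"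
      unfolding s_def by (rule mdiff)
    have "(\<lambda>(w, t). H w * q t (s w)) \<in> borel_measurable (lborel \<Otimes>\<^sub>M lborel)" by measurable
    then show ?thesis by (simp add: s_def)
  qed
  have int: "integrable (lborel \<Otimes>\<^sub>M lborel) (\<lambda>(w, t). H w * q t (fst w - snd w))"
  proof (rule lborel_pair.Fubini_integrable[OF jm])
    show "integrable lborel (\<lambda>w. LINT t|lborel. norm (case (w, t) of (w, t) \<Rightarrow> H w * q t (fst w - snd w)))"
    proof (rule Bochner_Integration.integrable_bound[OF integrable_norm[OF H]])
      show "(\<lambda>w. LINT t|lborel. norm (case (w, t) of (w, t) \<Rightarrow> H w * q t (fst w - snd w))) \<in> borel_measurable lborel"
        using measurable_compose[OF jm borel_measurable_norm]
        by (intro lborel.borel_measurable_lebesgue_integral) (simp add: case_prod_beta')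
      have "(\<integral>t. norm (H w * q t y) \<partial>lborel) = norm (H w) * (\<integral>t. norm (sign_mixture j t y) \<partial>lborel)" for w y
        by (simp add: norm_mult q_def)
      then show "AE w in lborel. norm (LINT t|lborel. norm (case (w, t) of (w, t) \<Rightarrow> H w * q t (fst w - snd w))) \<le> norm (norm (H w))"
        using integral_norm_sign_mixture[of j] by (auto intro!: AE_I2 mult_left_le simp: abs_mult)
    qed
    have "integrable lborel (\<lambda>t. q t y)" for y
      unfolding q_def using has_bochner_integral_sign_mixture[of j y] by (simp add: complex_of_real_integrable_eq has_bochner_integral_iff)
    then show "AE w in lborel. integrable lborel (\<lambda>t. case (w, t) of (w, t) \<Rightarrow> H w * q t (fst w - snd w))" by simp
  qed
  have inner: "(\<integral>w. H w * q t (fst w - snd w) \<partial>lborel) = (\<integral>\<xi>. u \<xi> * sign_mixture_hat j t \<xi> * inverse_fourier f \<xi> \<partial>lborel)" for t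
  proof -
    obtain B where B: "\<And>\<xi>. norm (inverse_fourier (q t) \<xi>) \<le> B"
      unfolding inverse_fourier_eq_fourier using norm_fourier_le by blast
    have m: "inverse_fourier (q t) \<in> borel_measurable lborel"
      using measurable_fourier[of "q t"] borel_measurable_integrable[OF q[of t]]
      unfolding inverse_fourier_eq_fourier[abs_def] by measurable
    have "(\<integral>w. H w * q t (fst w - snd w) \<partial>lborel) = (\<integral>z. f z * (\<integral>x. q t (x - z) * \<phi> x \<partial>lborel) \<partial>lborel)"
    proof -
      obtain B where "\<And>y. norm (q t y) \<le> B"
        using sign_mixture_bounded[of j t] unfolding q_def by blast
      moreover have "(\<lambda>w. q t (fst w - snd w)) \<in> borel_measurable lborel"
        using measurable_compose[OF mdiff, of "q t" borel] borel_measurable_integrable[OF q[of t]] by simp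
      ultimately have "integrable lborel (\<lambda>w. H w * q t (fst w - snd w))"
        by (intro integrable_mult_bounded[OF H])
      from integral_lborel_pair(2)[OF this] show ?thesis
        by (simp add: H_def mult_ac flip: integral_mult_right_zero)
    qed
    also have "\<dots> = (\<integral>z. f z * (\<integral>\<xi>. u \<xi> * inverse_fourier (q t) \<xi> * cis (2 * pi * (z \<bullet> \<xi>)) \<partial>lborel) \<partial>lborel)"
    proof -
      have "inverse_fourier (\<lambda>x. q t (x - z)) \<xi> = inverse_fourier (q t) \<xi> * cis (2 * pi * (z \<bullet> \<xi>))" for z \<xi>
        unfolding inverse_fourier_eq_fourier fourier_translate by simp
      then have "(\<integral>x. q t (x - z) * \<phi> x \<partial>lborel) = (\<integral>\<xi>. u \<xi> * inverse_fourier (q t) \<xi> * cis (2 * pi * (z \<bullet> \<xi>)) \<partial>lborel)" for z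
        unfolding \<phi>_def using inverse_fourier_multiplication[OF integrable_lborel_plus[OF q[of t], of "- z"] u]
        by (simp add: mult.assoc)
      then show ?thesis by simp
    qed
    also have "\<dots> = (\<integral>\<xi>. u \<xi> * inverse_fourier (q t) \<xi> * (\<integral>z. f z * cis (2 * pi * (z \<bullet> \<xi>)) \<partial>lborel) \<partial>lborel)"
      by (rule Fubini_bounded_kernel(2)[OF f integrable_mult_bounded[OF u m B], where B=1]) auto
    also have "\<dots> = (\<integral>\<xi>. u \<xi> * sign_mixture_hat j t \<xi> * inverse_fourier f \<xi> \<partial>lborel)"
      by (simp add: inverse_fourier_cis[of f] qhat inner_commute)
    finally show ?thesis .
  qed
  have "integrable lborel (\<lambda>t. \<integral>w. H w * q t (fst w - snd w) \<partial>lborel)"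
    using lborel_pair.integrable_snd[OF int] .
  moreover have "(\<integral>t. \<integral>w. H w * q t (fst w - snd w) \<partial>lborel \<partial>lborel)
      = (\<integral>x. (\<integral>z. f z * complex_of_real (sgn (x - z) $ j) \<partial>lborel) * \<phi> x \<partial>lborel)"
  proof -
    have "(\<integral>t. \<integral>w. H w * q t (fst w - snd w) \<partial>lborel \<partial>lborel) = (\<integral>w. \<integral>t. H w * q t (fst w - snd w) \<partial>lborel \<partial>lborel)"
      by (rule lborel_pair.Fubini_integral[OF int])
    also have "\<dots> = (\<integral>w. H w * complex_of_real (sgn (fst w - snd w) $ j) \<partial>lborel)"
    proof -
      have "(\<integral>t. q t y \<partial>lborel) = complex_of_real (sgn y $ j)" for y
        unfolding q_def using has_bochner_integral_sign_mixture[of j y] by (simp add: has_bochner_integral_iff)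
      then show ?thesis by simp
    qed
    also have "\<dots> = (\<integral>x. \<phi> x * (\<integral>z. f z * complex_of_real (sgn (x - z) $ j) \<partial>lborel) \<partial>lborel)"
    proof -
      have "integrable lborel (\<lambda>w. H w * complex_of_real (sgn (fst w - snd w) $ j))"
      proof (rule integrable_mult_bounded[OF H, where B = 1])
        show "norm (complex_of_real (sgn (fst w - snd w) $ j)) \<le> 1" for w :: "(real^'n) \<times> (real^'n)"
          using component_le_norm_cart[of "sgn (fst w - snd w)" j] norm_sgn[of "fst w - snd w"]
          by (simp split: if_splits)
        show "(\<lambda>w. complex_of_real (sgn (fst w - snd w) $ j)) \<in> borel_measurable lborel"
          using measurable_compose[OF mdiff, of "\<lambda>y. complex_of_real (sgn y $ j)" borel] by simp
      qed
      from integral_lborel_pair(1)[OF this] show ?thesis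
        by (simp add: H_def mult.assoc)
    qed
    finally show ?thesis by (simp add: mult.commute)
  qed
  ultimately show ?thesis
    unfolding inner \<phi>_def[symmetric] by (simp add: has_bochner_integral_iff)
qed

section \<open>The symbol of the operator\<close>

text \<open>The Fourier transform of the divergence of the field with components \<^term>\<open>sign_mixture j t\<close>.  Away from the
  origin its integral over \<open>t\<close> is a multiple of the Riesz symbol \<open>norm \<xi> powr (1 - d)\<close>.\<close>

definition riesz_slice :: "real \<Rightarrow> real^'n::finite \<Rightarrow> real" where
  "riesz_slice t \<xi> = indicator {0<..} t * (t powr (- 1 / 2) / sqrt pi) *
     (2 * pi\<^sup>2 * (norm \<xi>)\<^sup>2 / t * (sqrt (pi / t) ^ CARD('n) * exp (- (pi\<^sup>2 * (norm \<xi>)\<^sup>2) / t)))"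

lemma measurable_riesz_slice [measurable]:
  "(\<lambda>(t, \<xi>). riesz_slice t (\<xi>::real^'n::finite)) \<in> borel_measurable (borel \<Otimes>\<^sub>M borel)"
  unfolding riesz_slice_def[abs_def] by measurable

lemma riesz_slice_nonneg: "0 \<le> riesz_slice t \<xi>"
  unfolding riesz_slice_def by (auto simp: indicator_def)

lemma divergence_of_sign_mixture_hat:
  fixes \<xi> :: "real^'n::finite"
  shows "- (\<Sum>j\<in>UNIV. 2 * pi * \<i> * (\<xi> $ j) * sign_mixture_hat j t \<xi>) = complex_of_real (riesz_slice t \<xi>)"
proof -
  define a where "a = indicator {0<..} t * (t powr (- 1 / 2) / sqrt pi)"
  define b where "b = sqrt (pi / t) ^ CARD('n) * exp (- (pi\<^sup>2 * (norm \<xi>)\<^sup>2) / t)"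
  have "2 * pi * \<i> * (\<xi> $ j) * sign_mixture_hat j t \<xi> = - complex_of_real (a * (2 * pi\<^sup>2 / t * b)) * complex_of_real ((\<xi> $ j)\<^sup>2)" for j
    unfolding sign_mixture_hat_def a_def[symmetric] b_def[symmetric]
    by (simp add: power2_eq_square divide_inverse mult_ac)
  then have "(\<Sum>j\<in>UNIV. 2 * pi * \<i> * (\<xi> $ j) * sign_mixture_hat j t \<xi>) = - complex_of_real (a * (2 * pi\<^sup>2 / t * b)) * complex_of_real ((norm \<xi>)\<^sup>2)"
    unfolding norm_squared_vec of_real_sum sum_distrib_left by simp
  moreover have "riesz_slice t \<xi> = a * (2 * pi\<^sup>2 / t * b) * (norm \<xi>)\<^sup>2"
    unfolding riesz_slice_def a_def[symmetric] b_def[symmetric] by simp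
  ultimately show ?thesis by simp
qed

lemma riesz_slice_bounded: "\<exists>B. \<forall>\<xi>::real^'n::finite. norm (complex_of_real (riesz_slice t \<xi>)) \<le> B"
proof (cases "t > 0")
  case True
  define a where "a = (t powr (- 1 / 2) / sqrt pi) * sqrt (pi / t) ^ CARD('n)"
  have a: "a \<ge> 0" using True by (simp add: a_def)
  have "norm (complex_of_real (riesz_slice t \<xi>)) \<le> a * 2" for \<xi> :: "real^'n"
  proof -
    define b where "b = pi\<^sup>2 * (norm \<xi>)\<^sup>2 / t"
    have "riesz_slice t \<xi> = a * (2 * (b * exp (- b)))"
      using True by (simp add: riesz_slice_def a_def b_def)
    also have "\<dots> \<le> a * (2 * 1)"
    proof -
      have "b \<le> exp b" using exp_ge_add_one_self[of b] by linarith
      then have "b * exp (- b) \<le> exp b * exp (- b)" by (intro mult_right_mono) auto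
      then have "b * exp (- b) \<le> 1" by (simp add: exp_minus)
      then show ?thesis using a by (intro mult_left_mono) auto
    qed
    finally show ?thesis using riesz_slice_nonneg[of t \<xi>] by simp
  qed
  then show ?thesis by blast
qed (auto simp: riesz_slice_def)

lemma gamma_const_pos: "gamma_const d > 0"
  unfolding gamma_const_def by (intro positive_imp_inverse_positive mult_pos_pos Gamma_real_pos) auto

text \<open>The powers of \<open>norm \<xi>\<close> cancel, and the normalising constant of the operator is precisely what the Gamma integral
  leaves behind.\<close>

lemma integral_riesz_slice:
  fixes \<xi> :: "real^'n::finite"
  assumes "\<xi> \<noteq> 0"
  shows "has_bochner_integral lborel (\<lambda>t. riesz_slice t \<xi> * (2 * pi * norm \<xi>) ^ (CARD('n) - 1)) (1 / gamma_const CARD('n))"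
proof -
  define d where "d = CARD('n)"
  define r where "r = norm \<xi>"
  define p where "p = (real d + 1) / 2"
  have d: "d \<ge> 1" unfolding d_def by (simp add: Suc_leI)
  have r: "r > 0" using assms by (simp add: r_def)
  define c where "c = (2 * pi * r) ^ (d - 1) * (2 * pi\<^sup>2 * r\<^sup>2 * sqrt pi ^ d / sqrt pi)"
  have "has_bochner_integral lborel (\<lambda>t. c * (indicator {0<..} t * (t powr (- p - 1) * exp (- ((pi\<^sup>2 * r\<^sup>2) / t)))))
      (c * (Gamma p / (pi\<^sup>2 * r\<^sup>2) powr p))"
    using r by (intro has_bochner_integral_mult_right has_bochner_integral_inverse_Gamma) (auto simp: p_def)
  moreover have "c * (indicator {0<..} t * (t powr (- p - 1) * exp (- ((pi\<^sup>2 * r\<^sup>2) / t)))) = riesz_slice t \<xi> * (2 * pi * norm \<xi>) ^ (CARD('n) - 1)" for t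
  proof (cases "t > 0")
    case True
    have "sqrt (pi / t) ^ d = sqrt pi ^ d / sqrt t ^ d" by (simp add: real_sqrt_divide power_divide)
    also have "sqrt t ^ d = t powr (real d / 2)"
      using True by (simp add: powr_half_sqrt[symmetric] powr_powr powr_realpow[symmetric])
    also have "sqrt pi ^ d / t powr (real d / 2) = sqrt pi ^ d * t powr (- (real d / 2))"
      by (simp only: powr_minus divide_inverse)
    finally have e1: "sqrt (pi / t) ^ d = sqrt pi ^ d * t powr (- (real d / 2))" .
    have "t powr (- p - 1) = t powr (- 1 / 2 + (- 1) + (- (real d / 2)))"
      by (rule arg_cong[of _ _ "\<lambda>a. t powr a"]) (simp add: p_def add_divide_distrib)
    also have "\<dots> = t powr (- 1 / 2) * (1 / t) * t powr (- (real d / 2))"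
      unfolding powr_add using True by (simp add: powr_minus_divide)
    finally have e2: "t powr (- p - 1) = t powr (- 1 / 2) * (1 / t) * t powr (- (real d / 2))" .
    show ?thesis
      using True unfolding riesz_slice_def d_def[symmetric] r_def[symmetric] e1 e2 c_def by simp
  qed (simp add: riesz_slice_def)
  moreover have "c * (Gamma p / (pi\<^sup>2 * r\<^sup>2) powr p) = 1 / gamma_const CARD('n)"
  proof -
    have "(pi\<^sup>2 * r\<^sup>2) powr p = (pi * r) powr (2 * p)"
      using r powr_realpow[of "pi * r" 2] by (simp add: powr_powr[symmetric] power_mult_distrib[symmetric])
    also have "2 * p = real (d + 1)" by (simp add: p_def)
    also have "(pi * r) powr real (d + 1) = (pi * r) ^ (d + 1)" using r by (intro powr_realpow) simp
    also have "\<dots> = (pi * r) ^ (d - 1) * (pi * r)\<^sup>2"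
      using d by (simp flip: power_add)
    finally have e3: "(pi\<^sup>2 * r\<^sup>2) powr p = (pi * r) ^ (d - 1) * (pi * r)\<^sup>2" .
    have e4: "sqrt pi ^ d / sqrt pi = pi powr ((real d - 1) / 2)"
      using powr_realpow[of "sqrt pi" d] by (simp add: powr_half_sqrt[symmetric] powr_powr diff_divide_distrib powr_diff)
    have e5: "(2 * pi * r) ^ (d - 1) = 2 ^ (d - 1) * (pi * r) ^ (d - 1)"
      by (simp add: power_mult_distrib mult.assoc)
    have e6: "2 ^ (d - 1) * 2 = (2::real) ^ d" using d by (simp add: power_eq_if)
    have nz: "(pi * r) ^ (d - 1) * (pi * r)\<^sup>2 \<noteq> 0" using r by simp
    have "c * (Gamma p / (pi\<^sup>2 * r\<^sup>2) powr p) =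
       (2 ^ (d - 1) * 2) * (sqrt pi ^ d / sqrt pi) * Gamma p * (((pi * r) ^ (d - 1) * (pi * r)\<^sup>2) / ((pi * r) ^ (d - 1) * (pi * r)\<^sup>2))"
      unfolding c_def e3 e5 by (simp add: power_mult_distrib)
    also have "\<dots> = 2 ^ d * pi powr ((real d - 1) / 2) * Gamma p"
      unfolding e4 e6 divide_self[OF nz] by simp
    finally show ?thesis unfolding gamma_const_def d_def[symmetric] p_def by (simp add: inverse_eq_divide)
  qed
  ultimately show ?thesis by simp
qed

lemma dist_neg_laplacian_apply:
  "dist_neg_laplacian T \<psi> = - (\<Sum>i\<in>UNIV. T (partial_deriv i (partial_deriv i \<psi>)))"
  by (simp add: dist_neg_laplacian_def dist_deriv_def)

text \<open>Odd and even dimension are treated together: \<open>op\<close> is the identity with symbol \<open>M = 1\<close> in the first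
  case, and the square root of the Laplacian with symbol \<open>M = 2 * pi * norm \<xi>\<close> in the second.\<close>

context
  fixes F :: "real^'n::finite \<Rightarrow> real^'n" and f :: "real^'n \<Rightarrow> complex"
    and M :: "real^'n \<Rightarrow> complex" and op :: "(real^'n \<Rightarrow> complex) \<Rightarrow> real^'n \<Rightarrow> complex"
  assumes f: "integrable lborel f"
    and F: "\<And>x j. complex_of_real (F x $ j) = (\<integral>z. f z * complex_of_real (sgn (x - z) $ j) \<partial>lborel)"
    and op_fourier: "\<And>\<eta>. \<eta> \<in> schwartz \<Longrightarrow> op \<eta> = inverse_fourier (\<lambda>\<xi>. M \<xi> * fourier \<eta> \<xi>)"
    and op_integrable: "\<And>\<eta>. \<eta> \<in> schwartz \<Longrightarrow> integrable lborel (op \<eta>)"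
    and M_integrable: "\<And>\<eta>. \<eta> \<in> schwartz \<Longrightarrow> integrable lborel (\<lambda>\<xi>. M \<xi> * fourier \<eta> \<xi>)"
    and op_deriv: "\<And>\<eta> i. \<eta> \<in> schwartz \<Longrightarrow> partial_deriv i (op \<eta>) = op (partial_deriv i \<eta>)"
begin

lemma inverse_fourier_bounded_measurable:
  assumes "integrable lborel (h :: real^'n \<Rightarrow> complex)"
  shows "inverse_fourier h \<in> borel_measurable lborel" "norm (inverse_fourier h \<xi>) \<le> (\<integral>x. norm (h x) \<partial>lborel)"
proof -
  show "inverse_fourier h \<in> borel_measurable lborel"
    using measurable_fourier[of h] borel_measurable_integrable[OF assms]
    unfolding inverse_fourier_eq_fourier[abs_def] by measurable
  show "norm (inverse_fourier h \<xi>) \<le> (\<integral>x. norm (h x) \<partial>lborel)"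
    unfolding inverse_fourier_eq_fourier by (rule norm_fourier_le)
qed

lemma divergence_pairing:
  assumes \<eta>: "\<eta> \<in> schwartz"
  shows "has_bochner_integral lborel
     (\<lambda>t. \<integral>\<xi>. complex_of_real (riesz_slice t \<xi>) * (M \<xi> * fourier \<eta> \<xi>) * inverse_fourier f \<xi> \<partial>lborel)
     (dist_divergence F (op \<eta>))"
proof -
  define u where "u j \<xi> = M \<xi> * fourier (partial_deriv j \<eta>) \<xi>" for j \<xi>
  have u: "integrable lborel (u j)" for j
    unfolding u_def by (intro M_integrable schwartz_partial_deriv \<eta>)
  have op: "op (partial_deriv j \<eta>) = inverse_fourier (u j)" for j
    unfolding u_def by (intro op_fourier schwartz_partial_deriv \<eta>)
  have "has_bochner_integral lborel (\<lambda>t. - (\<Sum>j\<in>UNIV. \<integral>\<xi>. u j \<xi> * sign_mixture_hat j t \<xi> * inverse_fourier f \<xi> \<partial>lborel))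
     (- (\<Sum>j\<in>UNIV. \<integral>x. (\<integral>z. f z * complex_of_real (sgn (x - z) $ j) \<partial>lborel) * inverse_fourier (u j) x \<partial>lborel))"
    by (intro has_bochner_integral_minus has_bochner_integral_sum sign_mixture_pairing f u)
       (metis op op_integrable schwartz_partial_deriv \<eta>)
  moreover have "- (\<Sum>j\<in>UNIV. \<integral>x. (\<integral>z. f z * complex_of_real (sgn (x - z) $ j) \<partial>lborel) * inverse_fourier (u j) x \<partial>lborel)
      = dist_divergence F (op \<eta>)"
    by (simp add: dist_divergence_def dist_deriv_def function_dist_def F op_deriv \<eta> op sum_negf)
  moreover have "- (\<Sum>j\<in>UNIV. \<integral>\<xi>. u j \<xi> * sign_mixture_hat j t \<xi> * inverse_fourier f \<xi> \<partial>lborel)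
      = (\<integral>\<xi>. complex_of_real (riesz_slice t \<xi>) * (M \<xi> * fourier \<eta> \<xi>) * inverse_fourier f \<xi> \<partial>lborel)" for t
  proof -
    have int: "integrable lborel (\<lambda>\<xi>. u j \<xi> * sign_mixture_hat j t \<xi> * inverse_fourier f \<xi>)" for j
    proof (rule integrable_mult_bounded[OF _ inverse_fourier_bounded_measurable[OF f]])
      have "sign_mixture_hat j t = inverse_fourier (\<lambda>y::real^'n. complex_of_real (sign_mixture j t y))"
        by (rule ext) (simp only: inverse_fourier_sign_mixture)
      then show "integrable lborel (\<lambda>\<xi>. u j \<xi> * sign_mixture_hat j t \<xi>)"
        using integrable_mult_bounded[OF u inverse_fourier_bounded_measurable[OF sign_mixture_integrable]] by simp
    qed
    have "complex_of_real (riesz_slice t \<xi>) * (M \<xi> * fourier \<eta> \<xi>) * inverse_fourier f \<xi>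
        = - (\<Sum>j\<in>UNIV. u j \<xi> * sign_mixture_hat j t \<xi> * inverse_fourier f \<xi>)" for \<xi>
      unfolding divergence_of_sign_mixture_hat[symmetric] u_def
      by (simp add: fourier_partial_deriv \<eta> sum_distrib_left sum_distrib_right mult_ac)
    then show ?thesis using int by simp
  qed
  ultimately show ?thesis by simp
qed

text \<open>For fixed \<open>t\<close> the function \<^const>\<open>riesz_slice\<close> is bounded, so the frequency integrals converge for every \<open>m\<close> and
  each further Laplacian contributes a factor to the integrand.\<close>

lemma laplacian_power_pairing:
  assumes "\<eta> \<in> schwartz"
  shows "integrable lborel (\<lambda>\<xi>. complex_of_real ((2 * pi * norm \<xi>) ^ (2 * m)) * (M \<xi> * fourier \<eta> \<xi>))" (is "?I m \<eta>")
    and "has_bochner_integral lborel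
     (\<lambda>t. \<integral>\<xi>. complex_of_real (riesz_slice t \<xi>) * (complex_of_real ((2 * pi * norm \<xi>) ^ (2 * m)) * (M \<xi> * fourier \<eta> \<xi>))
        * inverse_fourier f \<xi> \<partial>lborel)
     ((dist_neg_laplacian ^^ m) (dist_divergence F) (op \<eta>))" (is "?H m \<eta>")
proof -
  have "?I m \<eta> \<and> ?H m \<eta>" using assms
  proof (induction m arbitrary: \<eta>)
    case 0
    then show ?case using M_integrable divergence_pairing by simp
  next
    case (Suc m)
    define v where "v \<eta> \<xi> = complex_of_real ((2 * pi * norm \<xi>) ^ (2 * m)) * (M \<xi> * fourier \<eta> \<xi>)" for \<eta> \<xi>
    define D where "D i = partial_deriv i (partial_deriv i \<eta>)" for i
    have D: "D i \<in> schwartz" for i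
      unfolding D_def by (intro schwartz_partial_deriv Suc.prems)
    have vint: "integrable lborel (v (D i))" for i
      using Suc.IH[OF D[of i]] unfolding v_def by blast
    have eq: "complex_of_real ((2 * pi * norm \<xi>) ^ (2 * Suc m)) * (M \<xi> * fourier \<eta> \<xi>) = - (\<Sum>i\<in>UNIV. v (D i) \<xi>)" for \<xi>
    proof -
      have "v (D i) \<xi> = - (v \<eta> \<xi> * complex_of_real ((2 * pi)\<^sup>2)) * complex_of_real ((\<xi> $ i)\<^sup>2)" for i
        unfolding v_def D_def by (simp add: fourier_partial_deriv schwartz_partial_deriv Suc.prems power2_eq_square)
      then have "(\<Sum>i\<in>UNIV. v (D i) \<xi>) = - (v \<eta> \<xi> * complex_of_real ((2 * pi)\<^sup>2)) * complex_of_real ((norm \<xi>)\<^sup>2)"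
        unfolding norm_squared_vec of_real_sum sum_distrib_left by simp
      then show ?thesis unfolding v_def by (simp add: power_mult_distrib power2_eq_square)
    qed
    have I: "?I (Suc m) \<eta>"
      unfolding eq by (intro integrable_minus Bochner_Integration.integrable_sum vint)
    have "has_bochner_integral lborel
        (\<lambda>t. - (\<Sum>i\<in>UNIV. \<integral>\<xi>. complex_of_real (riesz_slice t \<xi>) * v (D i) \<xi> * inverse_fourier f \<xi> \<partial>lborel))
        (- (\<Sum>i\<in>UNIV. (dist_neg_laplacian ^^ m) (dist_divergence F) (op (D i))))"
      using Suc.IH[OF D] unfolding v_def
      by (intro has_bochner_integral_minus has_bochner_integral_sum) blast
    moreover have "- (\<Sum>i\<in>UNIV. (dist_neg_laplacian ^^ m) (dist_divergence F) (op (D i)))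
        = (dist_neg_laplacian ^^ Suc m) (dist_divergence F) (op \<eta>)"
      by (simp add: dist_neg_laplacian_apply D_def op_deriv schwartz_partial_deriv Suc.prems)
    moreover have "- (\<Sum>i\<in>UNIV. \<integral>\<xi>. complex_of_real (riesz_slice t \<xi>) * v (D i) \<xi> * inverse_fourier f \<xi> \<partial>lborel)
        = (\<integral>\<xi>. complex_of_real (riesz_slice t \<xi>) * (complex_of_real ((2 * pi * norm \<xi>) ^ (2 * Suc m)) * (M \<xi> * fourier \<eta> \<xi>))
        * inverse_fourier f \<xi> \<partial>lborel)" for t
    proof -
      obtain B where B: "\<And>\<xi>::real^'n. norm (complex_of_real (riesz_slice t \<xi>)) \<le> B"
        using riesz_slice_bounded by blast
      have "integrable lborel (\<lambda>\<xi>. v (D i) \<xi> * complex_of_real (riesz_slice t \<xi>))" for i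
        by (rule integrable_mult_bounded[OF vint _ B]) measurable
      from integrable_mult_bounded[OF this inverse_fourier_bounded_measurable[OF f]]
      have int: "integrable lborel (\<lambda>\<xi>. complex_of_real (riesz_slice t \<xi>) * v (D i) \<xi> * inverse_fourier f \<xi>)" for i
        by (simp add: mult.commute[of "complex_of_real _"])
      show ?thesis
        unfolding eq using int by (simp add: sum_distrib_left sum_distrib_right)
    qed
    ultimately have "?H (Suc m) \<eta>" by simp
    with I show ?case by blast
  qed
  then show "?I m \<eta>" "?H m \<eta>" by blast+
qed

text \<open>When the symbol of the operator is \<open>(2 * pi * norm \<xi>) ^ (d - 1)\<close>, the integral over \<open>t\<close> does not depend
  on the frequency.  Carrying it out first leaves Parseval's identity for \<open>f\<close> and \<open>\<psi>\<close>.\<close>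

lemma laplacian_power_divergence:
  assumes fS: "f \<in> schwartz" and \<psi>: "\<psi> \<in> schwartz"
    and M: "\<And>\<xi>. complex_of_real ((2 * pi * norm \<xi>) ^ (2 * m)) * M \<xi> = complex_of_real ((2 * pi * norm \<xi>) ^ (CARD('n) - 1))"
  shows "complex_of_real (gamma_const CARD('n)) * (dist_neg_laplacian ^^ m) (dist_divergence F) (op \<psi>)
      = (\<integral>x. f x * \<psi> x \<partial>lborel)"
proof -
  define g where "g \<xi> = fourier \<psi> \<xi> * inverse_fourier f \<xi>" for \<xi>
  define N where "N \<xi> = (2 * pi * norm \<xi>) ^ (CARD('n) - 1)" for \<xi> :: "real^'n"
  have g: "integrable lborel g"
    unfolding g_def
    by (rule integrable_mult_bounded[OF fourier_schwartz_integrable[OF \<psi>] inverse_fourier_bounded_measurable[OF f]])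
  have [measurable]: "g \<in> borel_measurable borel" "N \<in> borel_measurable borel"
    using borel_measurable_integrable[OF g] unfolding N_def by auto
  have R: "has_bochner_integral lborel (\<lambda>t. riesz_slice t \<xi> * N \<xi>) (1 / gamma_const CARD('n))" if "\<xi> \<noteq> 0" for \<xi> :: "real^'n"
    unfolding N_def by (rule integral_riesz_slice[OF that])
  have nz: "AE \<xi> in lborel. \<xi> \<noteq> (0::real^'n)" by (rule AE_lborel_singleton)
  have jm[measurable]: "(\<lambda>(\<xi>, t). complex_of_real (riesz_slice t \<xi> * N \<xi>) * g \<xi>) \<in> borel_measurable (lborel \<Otimes>\<^sub>M lborel)"
    by measurable
  have int: "integrable (lborel \<Otimes>\<^sub>M lborel) (\<lambda>(\<xi>, t). complex_of_real (riesz_slice t \<xi> * N \<xi>) * g \<xi>)"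
  proof (rule lborel_pair.Fubini_integrable[OF jm])
    have R0: "\<bar>riesz_slice t \<xi> * N \<xi>\<bar> = riesz_slice t \<xi> * N \<xi>" for t \<xi>
      using riesz_slice_nonneg[of t \<xi>] by (intro abs_of_nonneg mult_nonneg_nonneg) (auto simp: N_def)
    have L: "(LINT t|lborel. norm (complex_of_real (riesz_slice t \<xi> * N \<xi>) * g \<xi>)) = 1 / gamma_const CARD('n) * norm (g \<xi>)" if "\<xi> \<noteq> 0" for \<xi>
      unfolding norm_mult norm_of_real R0 using R[OF that] by (simp add: has_bochner_integral_iff)
    have ae: "AE \<xi> in lborel. 1 / gamma_const CARD('n) * norm (g \<xi>) = (LINT t|lborel. norm (case (\<xi>, t) of (\<xi>, t) \<Rightarrow> complex_of_real (riesz_slice t \<xi> * N \<xi>) * g \<xi>))"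
      using nz
    proof eventually_elim
      case (elim \<xi>)
      show ?case using L[OF elim] by (simp only: prod.case)
    qed
    have meas: "(\<lambda>\<xi>. LINT t|lborel. norm (case (\<xi>, t) of (\<xi>, t) \<Rightarrow> complex_of_real (riesz_slice t \<xi> * N \<xi>) * g \<xi>)) \<in> borel_measurable lborel"
      using measurable_compose[OF jm borel_measurable_norm]
      by (intro lborel.borel_measurable_lebesgue_integral) (simp add: case_prod_beta')
    show "integrable lborel (\<lambda>\<xi>. LINT t|lborel. norm (case (\<xi>, t) of (\<xi>, t) \<Rightarrow> complex_of_real (riesz_slice t \<xi> * N \<xi>) * g \<xi>))"
      by (rule integrable_cong_AE_imp[OF _ meas ae]) (intro integrable_mult_right integrable_norm g)
    show "AE \<xi> in lborel. integrable lborel (\<lambda>t. case (\<xi>, t) of (\<xi>, t) \<Rightarrow> complex_of_real (riesz_slice t \<xi> * N \<xi>) * g \<xi>)"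
      using nz
    proof eventually_elim
      case (elim \<xi>)
      have "integrable lborel (\<lambda>t. complex_of_real (riesz_slice t \<xi> * N \<xi>))"
        using R[OF elim] unfolding complex_of_real_integrable_eq by (simp add: has_bochner_integral_iff)
      then show ?case by simp
    qed
  qed
  have "complex_of_real (riesz_slice t \<xi>) * (complex_of_real ((2 * pi * norm \<xi>) ^ (2 * m)) * (M \<xi> * fourier \<psi> \<xi>)) * inverse_fourier f \<xi>
      = complex_of_real (riesz_slice t \<xi> * N \<xi>) * g \<xi>" for t \<xi>
  proof -
    have "complex_of_real ((2 * pi * norm \<xi>) ^ (2 * m)) * (M \<xi> * fourier \<psi> \<xi>) = complex_of_real (N \<xi>) * fourier \<psi> \<xi>"
      unfolding N_def M[symmetric] by (simp only: mult.assoc)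
    then show ?thesis unfolding g_def of_real_mult by (simp only: mult.assoc)
  qed
  then have "(dist_neg_laplacian ^^ m) (dist_divergence F) (op \<psi>)
      = (\<integral>t. (\<integral>\<xi>. complex_of_real (riesz_slice t \<xi> * N \<xi>) * g \<xi> \<partial>lborel) \<partial>lborel)"
    using has_bochner_integral_integral_eq[OF laplacian_power_pairing(2)[OF \<psi>, of m]] by (simp only:)
  also have "\<dots> = (\<integral>\<xi>. (\<integral>t. complex_of_real (riesz_slice t \<xi> * N \<xi>) * g \<xi> \<partial>lborel) \<partial>lborel)"
    by (rule lborel_pair.Fubini_integral[OF int])
  also have "\<dots> = (\<integral>\<xi>. complex_of_real (1 / gamma_const CARD('n)) * g \<xi> \<partial>lborel)"
  proof (rule integral_cong_AE)
    show "(\<lambda>\<xi>. \<integral>t. complex_of_real (riesz_slice t \<xi> * N \<xi>) * g \<xi> \<partial>lborel) \<in> borel_measurable lborel"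
      by (rule lborel.borel_measurable_lebesgue_integral[OF jm])
    show "AE \<xi> in lborel. (\<integral>t. complex_of_real (riesz_slice t \<xi> * N \<xi>) * g \<xi> \<partial>lborel) = complex_of_real (1 / gamma_const CARD('n)) * g \<xi>"
      using nz
    proof eventually_elim
      case (elim \<xi>)
      have "(\<integral>t. complex_of_real (riesz_slice t \<xi> * N \<xi>) \<partial>lborel) = complex_of_real (1 / gamma_const CARD('n))"
        using R[OF elim] unfolding integral_complex_of_real by (simp add: has_bochner_integral_iff)
      then show ?case by simp
    qed
  qed measurable
  also have "\<dots> = complex_of_real (1 / gamma_const CARD('n)) * (\<integral>x. f x * \<psi> x \<partial>lborel)"
    using inverse_fourier_multiplication[OF f fourier_schwartz_integrable[OF \<psi>]]
    unfolding g_def schwartz_inversion[OF \<psi>] by simp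
  finally show ?thesis using gamma_const_pos[of "CARD('n)"] by simp
qed

end

theorem theorem3p1:
  fixes P :: "(real^'n::finite) measure" and f :: "real^'n \<Rightarrow> real"
  assumes "prob_space P" and "sets P = sets borel"
    and "\<forall>x. 0 \<le> f x" and "P = density lborel (\<lambda>x. ennreal (f x))"
    and "(\<lambda>x. complex_of_real (f x)) \<in> schwartz"
  shows "smooth (geometric_cdf P) \<and>
    (\<exists>g. continuous_on UNIV g \<and> represented_by (L_op (geometric_cdf P)) g \<and>
         (\<forall>x. g x = complex_of_real (f x)))"
proof (intro conjI exI[of _ "\<lambda>x. complex_of_real (f x)"] allI refl)
  let ?f = "\<lambda>x. complex_of_real (f x)"
  let ?F = "geometric_cdf P"
  note P = assms(4) and f0 = assms(3) and fS = assms(5)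
  show sm: "smooth ?F" by (rule smooth_geometric_cdf[OF P f0 fS])
  show "continuous_on UNIV ?f" by (rule schwartz_continuous[OF fS])
  have fint: "integrable lborel ?f" by (rule schwartz_integrable[OF fS])
  have fm[measurable]: "f \<in> borel_measurable borel"
    using schwartz_measurable[OF fS] by (simp add: borel_measurable_complex_iff)
  have F: "complex_of_real (?F x $ j) = (\<integral>z. ?f z * complex_of_real (sgn (x - z) $ j) \<partial>lborel)" for x j
  proof -
    have int: "integrable lborel (\<lambda>z. f z *\<^sub>R sgn (x - z))"
    proof (rule Bochner_Integration.integrable_bound[of _ ?f])
      show "AE z in lborel. norm (f z *\<^sub>R sgn (x - z)) \<le> norm (?f z)"
        by (intro AE_I2) (simp add: norm_sgn)
    qed (use fint in auto)
    have "?F x $ j = (\<integral>z. f z *\<^sub>R sgn (x - z) \<partial>lborel) $ j"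
      by (simp only: geometric_cdf_density[OF P f0 fm])
    also have "\<dots> = (\<integral>z. (f z *\<^sub>R sgn (x - z)) $ j \<partial>lborel)"
      by (rule integral_bounded_linear[OF bounded_linear_vec_nth int, symmetric])
    finally show ?thesis by (simp flip: integral_complex_of_real)
  qed
  show "represented_by (L_op ?F) ?f"
    unfolding represented_by_def
  proof (intro ballI conjI)
    fix \<psi> :: "real^'n \<Rightarrow> complex" assume \<psi>: "\<psi> \<in> schwartz"
    obtain C where C: "\<And>x. norm (\<psi> x) \<le> C * decay_weight x" using schwartz_decay[OF \<psi>] by blast
    have "norm (\<psi> x) \<le> \<bar>C\<bar>" for x
    proof -
      have "C * decay_weight x \<le> \<bar>C\<bar> * 1" by (intro mult_mono) (auto simp: decay_weight_le_1)
      then show ?thesis using C[of x] by linarith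
    qed
    then show "integrable lborel (\<lambda>x. ?f x * \<psi> x)"
      using schwartz_measurable[OF \<psi>] by (intro integrable_mult_bounded[OF fint]) auto
    have "complex_of_real (gamma_const CARD('n)) * dist_neg_laplacian_power (dist_divergence ?F) \<psi> = (\<integral>x. ?f x * \<psi> x \<partial>lborel)"
    proof (cases "odd CARD('n)")
      case True
      have "complex_of_real (gamma_const CARD('n)) * (dist_neg_laplacian ^^ ((CARD('n) - 1) div 2)) (dist_divergence ?F) \<psi> = (\<integral>x. ?f x * \<psi> x \<partial>lborel)"
      proof (rule laplacian_power_divergence[where op = "\<lambda>\<eta>. \<eta>" and M = "\<lambda>_. 1", OF fint F])
        show "complex_of_real ((2 * pi * norm \<xi>) ^ (2 * ((CARD('n) - 1) div 2))) * 1 = complex_of_real ((2 * pi * norm \<xi>) ^ (CARD('n) - 1))" for \<xi> :: "real^'n"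
          using True by simp
      qed (simp_all add: schwartz_inversion schwartz_integrable fourier_schwartz_integrable fS \<psi>)
      then show ?thesis using True by (simp add: dist_neg_laplacian_power_def)
    next
      case False
      define m where "m = (CARD('n) - 2) div 2"
      \<comment> \<open>The even powers come from the iterated Laplacian, the remaining one from its square root.\<close>
      have d: "2 * m + 1 = CARD('n) - 1"
      proof -
        have "CARD('n) > 0" by simp
        then show ?thesis using False unfolding m_def by presburger
      qed
      have Fm: "?F \<in> borel_measurable borel"
        by (rule borel_measurable_continuous_onI[OF smooth_continuous[OF sm]])
      have dual: "(dist_neg_laplacian ^^ m) (dist_divergence ?F) \<in> s_half_dual"
        by (intro s_half_bounded_in_dual s_half_bounded_neg_laplacian_power
          s_half_bounded_divergence[OF Fm norm_geometric_cdf_le[OF assms(1)]])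
      have "complex_of_real (gamma_const CARD('n)) * (dist_neg_laplacian ^^ m) (dist_divergence ?F) (frac_laplacian (1 / 2) \<psi>) = (\<integral>x. ?f x * \<psi> x \<partial>lborel)"
      proof (rule laplacian_power_divergence[where op = "frac_laplacian (1 / 2)" and M = "\<lambda>\<xi>. complex_of_real (2 * pi * norm \<xi>)", OF fint F])
        show "complex_of_real ((2 * pi * norm \<xi>) ^ (2 * m)) * complex_of_real (2 * pi * norm \<xi>) = complex_of_real ((2 * pi * norm \<xi>) ^ (CARD('n) - 1))" for \<xi> :: "real^'n"
          unfolding d[symmetric] power_add power_one_right of_real_mult ..
        show "integrable lborel (\<lambda>\<xi>. complex_of_real (2 * pi * norm \<xi>) * fourier \<eta> \<xi>)" if "\<eta> \<in> schwartz" for \<eta> :: "real^'n \<Rightarrow> complex"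
          using integrable_mult_right[OF norm_fourier_schwartz_integrable[OF that], of "complex_of_real (2 * pi)"]
          by (simp add: mult.assoc)
        show "frac_laplacian (1 / 2) \<eta> = inverse_fourier (\<lambda>\<xi>. complex_of_real (2 * pi * norm \<xi>) * fourier \<eta> \<xi>)" for \<eta> :: "real^'n \<Rightarrow> complex"
          by (rule frac_laplacian_half)
      qed (simp_all only: integrable_frac_laplacian_half partial_deriv_frac_laplacian_half fS \<psi>)
      then show ?thesis using False dual by (simp add: dist_neg_laplacian_power_def dist_sqrt_laplacian_def m_def)
    qed
    then show "L_op ?F \<psi> = function_dist ?f \<psi>"
      unfolding L_op_def function_dist_def .
  qed
qed

end
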